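(* Consider a sequence $\phi_i\in Ham(D^2,\partial D^2)$ that satisfies the following conditions: (1) each $\phi_i$ is graphical, and $\phi_i\to id$ in the $C^0$-topology; (2) $\phi_i=\phi_{H_i}^1$ with $H_i$ convergent in the $L^{(1,\infty)}$-topology. Then $\lim_{i\to\infty}\operatorname{Cal}(\phi_i)=0$.
   Context: $D^2\subset\mathbb{R}^2$ is the closed unit disc with $\Omega=dq\wedge dp$; $Ham(D^2,\partial D^2)$ is the group of time-one maps $\phi_H^1$ of smooth Hamiltonians $H:[0,1]\times D^2\to\mathbb{R}$ supported in $\operatorname{Int}D^2$ (with $X_H\rfloor\Omega=dH_t$); it equals the group of area-preserving diffeomorphisms supported in $\operatorname{Int}D^2$. The Hamiltonians $H_i$ are smooth and supported in $\operatorname{Int}D^2$. The $L^{(1,\infty)}$-norm is $\|H\|=\int_0^1(\max H_t-\min H_t)\,dt$. The Calabi invariant is $\operatorname{Cal}(\phi)=\int_0^1\int_{D^2}H(t,x)\,\Omega\,dt$ for any such $H$ with $\phi=\phi_H^1$ (independent of $H$). Graphical: embed $D^2$ in an area-preserving way as the upper hemisphere of $S^2$ (with suitably scaled standard area form $\omega$) and extend maps by the identity. Fix a Darboux–Weinstein chart of the diagonal $\Delta\subset(S^2\times S^2,\omega\oplus-\omega)$, i.e. a symplectic diffeomorphism $\Psi:U_\Delta\to\mathcal V$ from a neighborhood $U_\Delta$ of $\Delta$ onto a neighborhood of the zero section in $T^*\Delta$, identifying $\Delta$ with the zero section; let $\pi_\Delta:U_\Delta\to\Delta$ be $\Psi$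 followed by the cotangent projection. Then $\phi$ is ($\Psi$-)graphical if $\operatorname{Graph}\phi=\{(\phi(x),x)\}\subset U_\Delta$ and $\pi_\Delta|_{\operatorname{Graph}\phi}:\operatorname{Graph}\phi\to\Delta$ is one-to-one. *)

theory Defs
  imports "HOL-Analysis.Analysis"
begin

text \<open>Smooth maps. For an open set \<open>S\<close>, \<open>Ck_on k S f\<close> says that \<open>f\<close> is of class
  \<open>C\<^sup>k\<close> on \<open>S\<close> (via iterated directional derivatives). A map on an arbitrary subset of a
  Euclidean space is smooth if near every point it extends to a smooth map on an open set;
  this covers manifolds with boundary or corners and submanifolds.\<close>

primrec Ck_on :: "nat \<Rightarrow> 'a::euclidean_space set \<Rightarrow> ('a \<Rightarrow> 'b::real_normed_vector) \<Rightarrow> bool" where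
  "Ck_on 0 S f \<longleftrightarrow> continuous_on S f"
| "Ck_on (Suc k) S f \<longleftrightarrow>
     (\<forall>x\<in>S. f differentiable (at x)) \<and> (\<forall>v. Ck_on k S (\<lambda>x. frechet_derivative f (at x) v))"

definition smooth_on :: "'a::euclidean_space set \<Rightarrow> ('a \<Rightarrow> 'b::real_normed_vector) \<Rightarrow> bool" where
  "smooth_on S f \<longleftrightarrow>
     (\<forall>x\<in>S. \<exists>U g. open U \<and> x \<in> U \<and> (\<forall>k. Ck_on k U g) \<and> (\<forall>y\<in>U \<inter> S. g y = f y))"

text \<open>Maps of the disc are represented by total functions on the plane with coordinates
  \<open>q = x $ 1\<close>, \<open>p = x $ 2\<close>; values off the disc (and off the time interval \<open>[0,1]\<close>) are never
  used. All derivatives on the disc are therefore taken within the disc.\<close>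

definition D2 :: "(real^2) set" where
  "D2 = cball 0 1"

definition Omega :: "real^2 \<Rightarrow> real^2 \<Rightarrow> real" where
  "Omega u v = u $ 1 * v $ 2 - u $ 2 * v $ 1"

definition hamiltonian :: "(real \<Rightarrow> real^2 \<Rightarrow> real) \<Rightarrow> bool" where
  "hamiltonian H \<longleftrightarrow>
     smooth_on ({0..1} \<times> D2) (\<lambda>(t, x). H t x) \<and>
     closure {(t, x). t \<in> {0..1} \<and> x \<in> D2 \<and> H t x \<noteq> 0} \<subseteq> {0..1} \<times> interior D2"

text \<open>\<open>X\<close> is the value at \<open>x\<close> of the Hamiltonian vector field of \<open>H t\<close>:
  contracting \<open>\<Omega>\<close> with \<open>X\<close> gives the differential of \<open>H t\<close>.\<close>

definition hamiltonian_vector ::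
  "(real \<Rightarrow> real^2 \<Rightarrow> real) \<Rightarrow> real \<Rightarrow> real^2 \<Rightarrow> real^2 \<Rightarrow> bool" where
  "hamiltonian_vector H t x X \<longleftrightarrow> (H t has_derivative (\<lambda>v. Omega X v)) (at x within D2)"

definition hamiltonian_flow ::
  "(real \<Rightarrow> real^2 \<Rightarrow> real) \<Rightarrow> (real \<Rightarrow> real^2 \<Rightarrow> real^2) \<Rightarrow> bool" where
  "hamiltonian_flow H \<Phi> \<longleftrightarrow>
     (\<forall>x\<in>D2. \<Phi> 0 x = x \<and>
       (\<forall>t\<in>{0..1}. \<Phi> t x \<in> D2 \<and>
          (\<exists>X. hamiltonian_vector H t (\<Phi> t x) X \<and>
               ((\<lambda>s. \<Phi> s x) has_vector_derivative X) (at t within {0..1}))))"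

definition time_one_map :: "(real \<Rightarrow> real^2 \<Rightarrow> real) \<Rightarrow> (real^2 \<Rightarrow> real^2) \<Rightarrow> bool" where
  "time_one_map H \<phi> \<longleftrightarrow> (\<exists>\<Phi>. hamiltonian_flow H \<Phi> \<and> (\<forall>x\<in>D2. \<phi> x = \<Phi> 1 x))"

definition Ham_D2 :: "(real^2 \<Rightarrow> real^2) set" where
  "Ham_D2 = {\<phi>. \<exists>H. hamiltonian H \<and> time_one_map H \<phi>}"

definition Cal :: "(real^2 \<Rightarrow> real^2) \<Rightarrow> real" where
  "Cal \<phi> = (THE c. \<exists>H. hamiltonian H \<and> time_one_map H \<phi> \<and>
     c = (LINT t:{0..1}|lborel. (LINT x:D2|lborel. H t x)))"

text \<open>The \<open>L\<^sup>(\<^sup>1\<^sup>,\<^sup>\<infinity>\<^sup>)\<close>-norm. Limits are allowed to be non-smooth: they range over functions that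
  are continuous in space, measurable in time, and have integrable oscillation
  (representatives of the elements of the completion). Integrability is required explicitly
  because the Lebesgue integral of a non-integrable function is \<open>0\<close> by convention.\<close>

definition osc :: "(real^2 \<Rightarrow> real) \<Rightarrow> real" where
  "osc f = (SUP x\<in>D2. f x) - (INF x\<in>D2. f x)"

definition L1inf_norm :: "(real \<Rightarrow> real^2 \<Rightarrow> real) \<Rightarrow> real" where
  "L1inf_norm H = (LINT t:{0..1}|lebesgue. osc (H t))"

definition L1inf :: "(real \<Rightarrow> real^2 \<Rightarrow> real) set" where
  "L1inf = {K. (\<forall>t\<in>{0..1}. continuous_on D2 (K t)) \<and>
     (\<forall>x\<in>D2. set_borel_measurable lebesgue {0..1} (\<lambda>t. K t x)) \<and>
     set_integrable lebesgue {0..1} (\<lambda>t. osc (K t))}"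

definition L1inf_convergent :: "(nat \<Rightarrow> real \<Rightarrow> real^2 \<Rightarrow> real) \<Rightarrow> bool" where
  "L1inf_convergent H \<longleftrightarrow>
     (\<exists>K\<in>L1inf. (\<lambda>i. L1inf_norm (\<lambda>t x. H i t x - K t x)) \<longlonglongrightarrow> 0)"

text \<open>The sphere with its standard area form scaled by \<open>1/2\<close>, so that a hemisphere has area
  \<open>\<pi>\<close>, the area of the unit disc.\<close>

definition S2 :: "(real^3) set" where
  "S2 = sphere 0 1"

definition omega :: "real^3 \<Rightarrow> real^3 \<Rightarrow> real^3 \<Rightarrow> real" where
  "omega x u v = (x \<bullet> cross3 u v) / 2"

definition tangent_S2 :: "real^3 \<Rightarrow> (real^3) set" where
  "tangent_S2 x = {u. x \<bullet> u = 0}"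

definition hemisphere_embedding :: "(real^2 \<Rightarrow> real^3) \<Rightarrow> bool" where
  "hemisphere_embedding e \<longleftrightarrow>
     smooth_on D2 e \<and> bij_betw e D2 {y \<in> S2. y $ 3 \<ge> 0} \<and>
     (\<forall>x\<in>D2. \<exists>A. (e has_derivative A) (at x within D2) \<and>
        (\<forall>u v. omega (e x) (A u) (A v) = Omega u v))"

definition sphere_extension ::
  "(real^2 \<Rightarrow> real^3) \<Rightarrow> (real^2 \<Rightarrow> real^2) \<Rightarrow> real^3 \<Rightarrow> real^3" where
  "sphere_extension e \<phi> y = (if y \<in> e ` D2 then e (\<phi> (inv_into D2 e y)) else y)"

text \<open>The symplectic form \<open>\<omega> \<oplus> -\<omega>\<close> on \<open>S\<^sup>2 \<times> S\<^sup>2\<close>.\<close>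

definition omega2 :: "(real^3) \<times> (real^3) \<Rightarrow> (real^3) \<times> (real^3) \<Rightarrow> (real^3) \<times> (real^3) \<Rightarrow> real" where
  "omega2 z \<xi> \<eta> = omega (fst z) (fst \<xi>) (fst \<eta>) - omega (snd z) (snd \<xi>) (snd \<eta>)"

text \<open>The diagonal \<open>\<Delta>\<close> is identified with \<open>S\<^sup>2\<close> via \<open>x \<mapsto> (x, x)\<close>, and a covector at
  \<open>x\<close> with the tangent vector \<open>p\<close> representing it through the Euclidean inner product. The
  tautological one-form is then the restriction of \<open>p \<bullet> dx\<close>, and \<open>omega_can\<close> is the
  canonical form \<open>dx \<and> dp\<close>, to be applied to vectors tangent to \<open>T_star_S2\<close>.
  The cotangent projection is \<open>fst\<close>.\<close>

definition T_star_S2 :: "((real^3) \<times> (real^3)) set" where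
  "T_star_S2 = {(x, p). x \<in> S2 \<and> p \<in> tangent_S2 x}"

definition omega_can :: "(real^3) \<times> (real^3) \<Rightarrow> (real^3) \<times> (real^3) \<Rightarrow> real" where
  "omega_can \<xi> \<eta> = fst \<xi> \<bullet> snd \<eta> - fst \<eta> \<bullet> snd \<xi>"

definition darboux_weinstein_chart ::
  "((real^3) \<times> (real^3)) set \<Rightarrow> ((real^3) \<times> (real^3)) set \<Rightarrow> ((real^3) \<times> (real^3) \<Rightarrow> (real^3) \<times> (real^3)) \<Rightarrow> bool" where
  "darboux_weinstein_chart U V \<Psi> \<longleftrightarrow>
     openin (top_of_set (S2 \<times> S2)) U \<and> (\<forall>x\<in>S2. (x, x) \<in> U) \<and>
     openin (top_of_set T_star_S2) V \<and> (\<forall>x\<in>S2. (x, 0) \<in> V) \<and>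
     bij_betw \<Psi> U V \<and> smooth_on U \<Psi> \<and> smooth_on V (inv_into U \<Psi>) \<and>
     (\<forall>x\<in>S2. \<Psi> (x, x) = (x, 0)) \<and>
     (\<forall>z\<in>U. \<exists>A. (\<Psi> has_derivative A) (at z within U) \<and>
        (\<forall>\<xi> \<in> tangent_S2 (fst z) \<times> tangent_S2 (snd z).
         \<forall>\<eta> \<in> tangent_S2 (fst z) \<times> tangent_S2 (snd z).
           omega_can (A \<xi>) (A \<eta>) = omega2 z \<xi> \<eta>))"

definition sphere_graph :: "(real^3 \<Rightarrow> real^3) \<Rightarrow> ((real^3) \<times> (real^3)) set" where
  "sphere_graph f = (\<lambda>y. (f y, y)) ` S2"

definition graphical ::
  "(real^2 \<Rightarrow> real^3) \<Rightarrow> ((real^3) \<times> (real^3)) set \<Rightarrow> ((real^3) \<times> (real^3) \<Rightarrow> (real^3) \<times> (real^3)) \<Rightarrow>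
   (real^2 \<Rightarrow> real^2) \<Rightarrow> bool" where
  "graphical e U \<Psi> \<phi> \<longleftrightarrow>
     sphere_graph (sphere_extension e \<phi>) \<subseteq> U \<and>
     inj_on (\<lambda>z. fst (\<Psi> z)) (sphere_graph (sphere_extension e \<phi>))"

end

theory Submission
  imports Defs
begin

text \<open>The argument is Usher's. For \<open>\<phi>\<close> generated by \<open>H\<close>, let \<open>A\<close> be the compactly supported
  function with \<open>dA = \<phi>\<^sup>*\<lambda> - \<lambda>\<close>, where \<open>d\<lambda> = \<Omega>\<close>; then \<open>Cal \<phi> = 1/2 \<integral>A\<close>. Near the diagonal the chart
  pulls the tautological form back to \<open>-\<lambda> \<oplus> \<lambda>\<close> plus an exact form \<open>dR\<close> with \<open>R = 0\<close> on the
  diagonal. Hence \<open>f(y) = R(\<phi>(y), y) - A(y)\<close> satisfies \<open>df = p \<cdot> db\<close>, where \<open>(b, p)\<close> is the image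
  of the graph in the cotangent bundle. Graphicality makes \<open>f\<close> a function of the base point \<open>b\<close>
  whose gradient is \<open>p\<close>, which is uniformly small when \<open>\<phi>\<close> is \<open>C\<^sup>0\<close>-small. So \<open>f\<close>, hence \<open>A\<close>, is
  uniformly small. As \<open>b\<close> is only a smooth homeomorphism, possibly with critical points, the gradient
  bound is used in integrated form.\<close>

section \<open>Integration of wedge products of differentials\<close>

text \<open>Closeness is given only in \<open>C^0\<close>, so the final bound may involve no
  derivative of \<open>\<phi>\<close>. It does not: \<open>p\<close> and \<open>R\<close> are small
  because they vanish on the diagonal and are Lipschitz with constants that come from the chart
  alone. The Lipschitz constants of \<open>\<phi>\<close> and \<open>A\<close> only license the
  integrations and never enter an estimate.

  What is established about \<open>\<phi>\<close> and \<open>A\<close> is that they are Lipschitz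
  and differentiable at each interior point. Stokes' theorem is therefore needed at that regularity,
  without second derivatives and without continuity of the first ones.

  The factor 1/2 has this origin: \<open>A\<close> integrates \<open>\<lambda>(X) + H\<close> along
  trajectories, the flow preserves area, and integration by parts turns the integral of
  \<open>\<lambda>(X)\<close> into that of \<open>H\<close>. So \<open>H\<close> is counted twice.

  Stereographic projection carries the hemisphere to the closed unit disc. The base map of the graph
  thus becomes an injective planar map, equal near the boundary to the one obtained from the
  identity, and the gradient estimate is a statement about the plane.\<close>

lemma has_derivative_imp_difference_quotient:
  fixes f :: "'a::real_normed_vector \<Rightarrow> real"
  assumes f: "(f has_derivative f') (at x)" and e: "e \<longlonglongrightarrow> 0" and e0: "\<And>n. e n \<noteq> 0"
  shows "(\<lambda>n. (f (x + e n *\<^sub>R a) - f x) / e n) \<longlonglongrightarrow> f' a"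
proof -
  have "((\<lambda>t. f (x + t *\<^sub>R a)) has_derivative (\<lambda>t. f' (t *\<^sub>R a))) (at 0)"
    by (rule has_derivative_compose[of "\<lambda>t. x + t *\<^sub>R a" "\<lambda>t. t *\<^sub>R a" 0 UNIV f f'])
      (auto intro!: derivative_eq_intros simp: f)
  moreover have "f' (t *\<^sub>R a) = f' a * t" for t
    using linear_cmul[OF has_derivative_linear[OF f]] by simp
  ultimately have "((\<lambda>t. f (x + t *\<^sub>R a)) has_real_derivative f' a) (at 0)"
    by (simp add: has_field_derivative_def)
  then have "((\<lambda>h. (f (x + h *\<^sub>R a) - f x) / h) \<longlongrightarrow> f' a) (at 0)"
    by (simp add: DERIV_def)
  moreover have "filterlim e (at 0) sequentially"
    using e e0 by (simp add: filterlim_at)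
  ultimately show ?thesis
    by (rule filterlim_compose)
qed

lemma integral_lborel_translation:
  fixes f :: "'a::euclidean_space \<Rightarrow> real"
  assumes "f \<in> borel_measurable borel"
  shows "integral\<^sup>L lborel (\<lambda>x. f (c + x)) = integral\<^sup>L lborel f"
  using integral_distr[of "(+) c" lborel borel f] assms by (simp add: lborel_distr_plus)

lemma bounded_supported_integrable:
  fixes f :: "'a::euclidean_space \<Rightarrow> real"
  assumes "f \<in> borel_measurable borel" "\<And>x. \<bar>f x\<bar> \<le> C" "\<And>x. norm x > R \<Longrightarrow> f x = 0"
  shows "integrable lborel f"
proof (rule Bochner_Integration.integrable_bound)
  show "integrable lborel (\<lambda>x::'a. C * indicator (cball 0 R) x)"
    using emeasure_lborel_cball_finite[of "0::'a" R] by (intro integrable_mult_right integrable_real_indicator) simp_all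
  show "AE x in lborel. norm (f x) \<le> norm (C * indicator (cball 0 R) x)"
    using assms(2,3) by (auto simp: indicator_def intro!: AE_I2) (smt (verit))
qed (use assms in simp)

text \<open>A discrete Stokes formula. After expansion the terms \<open>h y * w y\<close> cancel
  pointwise, and the other six products of translates pair off into translates of each other, so
  translation invariance of the integral finishes. Forward differences in one product against
  backward differences in the other make the cancellation exact at every step size.\<close>

lemma summation_by_parts:
  fixes h w :: "'a::euclidean_space \<Rightarrow> real"
  assumes h: "continuous_on UNIV h" and w: "continuous_on UNIV w"
    and supp: "\<And>y. norm y > r \<Longrightarrow> h y = 0"
  shows "integral\<^sup>L lborel (\<lambda>y. (h (y + a) - h y) * (w (y + b) - w y)
    - (h y - h (y - b)) * (w y - w (y - a))) = 0"
proof -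
  note [measurable] = borel_measurable_continuous_onI[OF h] borel_measurable_continuous_onI[OF w]
  have int: "integrable lborel (\<lambda>y. h (c + y) * w (d + y))" for c d
  proof -
    let ?K = "cball (0::'a) (r + norm c)"
    have "compact ((\<lambda>y. h (c + y) * w (d + y)) ` ?K)"
      by (intro compact_continuous_image continuous_intros continuous_on_compose2[OF h] continuous_on_compose2[OF w]) auto
    then obtain C where C: "\<And>y. y \<in> ?K \<Longrightarrow> \<bar>h (c + y) * w (d + y)\<bar> \<le> C"
      by (meson compact_imp_bounded bounded_real imageI)
    have z: "h (c + y) * w (d + y) = 0" if "norm y > r + norm c" for y
    proof -
      have "norm (c + y) > r"
        using norm_triangle_ineq4[of "c + y" c] that by simp
      then show ?thesis by (simp add: supp)
    qed
    have "\<bar>h (c + y) * w (d + y)\<bar> \<le> max C 0" for y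
      using C[of y] z[of y] by (cases "y \<in> ?K") auto
    then show ?thesis
      by (intro bounded_supported_integrable[where R = "r + norm c" and C = "max C 0"]) (auto simp: z)
  qed
  let ?J = "\<lambda>c d. integral\<^sup>L lborel (\<lambda>y. h (c + y) * w (d + y))"
  have shift: "?J c d = ?J (c + s) (d + s)" for c d s
    using integral_lborel_translation[of "\<lambda>y. h (c + y) * w (d + y)" s] by (simp add: add.assoc)
  have "integral\<^sup>L lborel (\<lambda>y. (h (y + a) - h y) * (w (y + b) - w y)
    - (h y - h (y - b)) * (w y - w (y - a)))
    = integral\<^sup>L lborel (\<lambda>y. h (a + y) * w (b + y) - h (a + y) * w (0 + y) - h (0 + y) * w (b + y)
       + h (0 + y) * w (-a + y) + h (-b + y) * w (0 + y) - h (-b + y) * w (-a + y))"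
    by (intro Bochner_Integration.integral_cong) (auto simp: algebra_simps)
  also have "\<dots> = ?J a b - ?J a 0 - ?J 0 b + ?J 0 (-a) + ?J (-b) 0 - ?J (-b) (-a)"
    by (simp only: int Bochner_Integration.integral_diff Bochner_Integration.integral_add
      Bochner_Integration.integrable_diff Bochner_Integration.integrable_add)
  also have "\<dots> = 0"
    using shift[of a b "-a-b"] shift[of a 0 "-a"] shift[of 0 b "-b"] by simp
  finally show ?thesis .
qed

text \<open>Only first derivatives are involved: \<open>dh \<and> dw\<close> is the limit of a combination of
  forward and backward difference quotients whose integral vanishes exactly.\<close>

lemma integral_wedge_eq_0:
  fixes h w :: "'a::euclidean_space \<Rightarrow> real"
  assumes h: "L-lipschitz_on UNIV h" and w: "L-lipschitz_on UNIV w"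
    and supp: "\<And>y. norm y > r \<Longrightarrow> h y = 0"
    and h': "\<And>y. norm y \<le> r \<Longrightarrow> (h has_derivative h' y) (at y)"
    and w': "\<And>y. norm y \<le> r \<Longrightarrow> (w has_derivative w' y) (at y)"
  shows "integrable lborel (\<lambda>y. indicator (cball 0 r) y * (h' y a * w' y b - h' y b * w' y a))" (is "integrable _ ?F")
    and "integral\<^sup>L lborel (\<lambda>y. indicator (cball 0 r) y * (h' y a * w' y b - h' y b * w' y a)) = 0"
proof -
  have ch: "continuous_on UNIV h" and cw: "continuous_on UNIV w"
    using h w lipschitz_on_continuous_on by blast+
  note [measurable] = borel_measurable_continuous_onI[OF ch] borel_measurable_continuous_onI[OF cw]
  have L0: "L \<ge> 0" using h by (rule lipschitz_on_nonneg)
  define \<epsilon> where "\<epsilon> n = 1 / real (Suc n)" for n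
  have \<epsilon>: "\<epsilon> \<longlonglongrightarrow> 0" and \<epsilon>0: "\<epsilon> n > 0" and \<epsilon>1: "\<epsilon> n \<le> 1" for n
    unfolding \<epsilon>_def using LIMSEQ_inverse_real_of_nat by (auto simp: inverse_eq_divide)
  define D where "D n y = ((h (y + \<epsilon> n *\<^sub>R a) - h y) * (w (y + \<epsilon> n *\<^sub>R b) - w y)
    - (h y - h (y - \<epsilon> n *\<^sub>R b)) * (w y - w (y - \<epsilon> n *\<^sub>R a))) / (\<epsilon> n)\<^sup>2" for n y
  have D0: "integral\<^sup>L lborel (D n) = 0" for n
    unfolding D_def using summation_by_parts[OF ch cw supp, where a="\<epsilon> n *\<^sub>R a" and b="\<epsilon> n *\<^sub>R b"] by simp
  have Dm[measurable]: "D n \<in> borel_measurable lborel" for n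
    unfolding D_def by measurable
  have lim: "(\<lambda>n. D n y) \<longlonglongrightarrow> ?F y" for y
  proof (cases "norm y \<le> r")
    case True
    have m\<epsilon>: "(\<lambda>n. - \<epsilon> n) \<longlonglongrightarrow> 0" using tendsto_minus[OF \<epsilon>] by simp
    have ne: "\<epsilon> n \<noteq> 0" "- \<epsilon> n \<noteq> 0" for n using \<epsilon>0[of n] by auto
    note q = has_derivative_imp_difference_quotient
    have "(\<lambda>n. ((h (y + \<epsilon> n *\<^sub>R a) - h y) / \<epsilon> n) * ((w (y + \<epsilon> n *\<^sub>R b) - w y) / \<epsilon> n)
       - ((h (y + (- \<epsilon> n) *\<^sub>R b) - h y) / (- \<epsilon> n)) * ((w (y + (- \<epsilon> n) *\<^sub>R a) - w y) / (- \<epsilon> n))) 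
       \<longlonglongrightarrow> h' y a * w' y b - h' y b * w' y a"
      by (intro tendsto_intros q[OF h'[OF True] \<epsilon> ne(1)] q[OF w'[OF True] \<epsilon> ne(1)]
         q[OF h'[OF True] m\<epsilon> ne(2)] q[OF w'[OF True] m\<epsilon> ne(2)])
    also have "(\<lambda>n. ((h (y + \<epsilon> n *\<^sub>R a) - h y) / \<epsilon> n) * ((w (y + \<epsilon> n *\<^sub>R b) - w y) / \<epsilon> n)
       - ((h (y + (- \<epsilon> n) *\<^sub>R b) - h y) / (- \<epsilon> n)) * ((w (y + (- \<epsilon> n) *\<^sub>R a) - w y) / (- \<epsilon> n))) = (\<lambda>n. D n y)"
      unfolding D_def using ne by (auto simp: fun_eq_iff power2_eq_square field_simps)
    finally show ?thesis using True by simp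
  next
    case False
    then have "h y = 0" by (simp add: supp)
    have ev: "\<forall>\<^sub>F n in sequentially. norm (y + \<epsilon> n *\<^sub>R c) > r" for c
    proof -
      have "(\<lambda>n. norm (y + \<epsilon> n *\<^sub>R c)) \<longlonglongrightarrow> norm (y + 0 *\<^sub>R c)"
        by (intro tendsto_intros \<epsilon>)
      then show ?thesis using False by (intro order_tendstoD(1)) auto
    qed
    have "\<forall>\<^sub>F n in sequentially. D n y = 0"
      using ev[of a] ev[of "-b"]
      by eventually_elim (simp add: D_def supp \<open>h y = 0\<close>)
    then show ?thesis using False by (simp add: tendsto_eventually)
  qed
  \<comment> \<open>Each product of differences is at most
    \<open>(L * \<epsilon> n * norm a) * (L * \<epsilon> n * norm b)\<close>, so dividing by the
    squared step leaves a bound independent of \<open>n\<close>. The steps are at most 1, whence a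
    common bounded support.\<close>
  define G where "G y = 2 * (L * norm a) * (L * norm b) * indicator (cball 0 (r + norm a + norm b)) y" for y :: 'a
  have G: "integrable lborel G"
    unfolding G_def using emeasure_lborel_cball_finite[of "0::'a" "r + norm a + norm b"]
    by (intro integrable_mult_right integrable_real_indicator) simp_all
  have bd: "norm (D n y) \<le> G y" for n y
  proof (cases "norm y \<le> r + norm a + norm b")
    case True
    have dl: "\<bar>g u - g v\<bar> \<le> L * norm (u - v)" if "L-lipschitz_on UNIV g" for g :: "'a \<Rightarrow> real" and u v
      using lipschitz_onD[OF that] by (auto simp: dist_norm)
    have "\<bar>(h (y + \<epsilon> n *\<^sub>R a) - h y) * (w (y + \<epsilon> n *\<^sub>R b) - w y)
       - (h y - h (y - \<epsilon> n *\<^sub>R b)) * (w y - w (y - \<epsilon> n *\<^sub>R a))\<bar>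
       \<le> \<bar>h (y + \<epsilon> n *\<^sub>R a) - h y\<bar> * \<bar>w (y + \<epsilon> n *\<^sub>R b) - w y\<bar>
       + \<bar>h y - h (y - \<epsilon> n *\<^sub>R b)\<bar> * \<bar>w y - w (y - \<epsilon> n *\<^sub>R a)\<bar>"
      by (simp add: abs_mult[symmetric])
    also have "\<dots> \<le> (L * norm (\<epsilon> n *\<^sub>R a)) * (L * norm (\<epsilon> n *\<^sub>R b)) + (L * norm (\<epsilon> n *\<^sub>R b)) * (L * norm (\<epsilon> n *\<^sub>R a))"
      using dl[OF h, of "y + \<epsilon> n *\<^sub>R a" y] dl[OF w, of "y + \<epsilon> n *\<^sub>R b" y] 
        dl[OF h, of y "y - \<epsilon> n *\<^sub>R b"] dl[OF w, of y "y - \<epsilon> n *\<^sub>R a"] L0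
      by (intro add_mono mult_mono) auto
    also have "\<dots> = G y * (\<epsilon> n)\<^sup>2"
      using True \<epsilon>0[of n] by (simp add: G_def power2_eq_square)
    finally show ?thesis
      unfolding D_def using \<epsilon>0[of n] by (simp add: abs_divide divide_le_eq)
  next
    case False
    have "norm (y + \<epsilon> n *\<^sub>R c) > r" if "norm c \<le> norm a + norm b" for c
    proof -
      have "norm (\<epsilon> n *\<^sub>R c) \<le> norm c"
        using \<epsilon>0[of n] \<epsilon>1[of n] by (simp add: mult_left_le_one_le)
      then show ?thesis
        using norm_triangle_ineq4[of "y + \<epsilon> n *\<^sub>R c" "\<epsilon> n *\<^sub>R c"] False that by simp
    qed
    from this[of a] this[of "-b"] this[of 0] show ?thesis
      using False by (simp add: D_def G_def supp)
  qed
  have Fm: "?F \<in> borel_measurable lborel"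
    by (rule borel_measurable_LIMSEQ_real[OF lim]) simp
  show "integrable lborel ?F"
    by (rule integrable_dominated_convergence[OF Fm Dm G AE_I2[OF lim] AE_I2[OF bd]])
  have "(\<lambda>n. integral\<^sup>L lborel (D n)) \<longlonglongrightarrow> integral\<^sup>L lborel ?F"
    by (rule integral_dominated_convergence[OF Fm Dm G AE_I2[OF lim] AE_I2[OF bd]])
  then show "integral\<^sup>L lborel ?F = 0"
    by (simp add: D0 LIMSEQ_const_iff)
qed

text \<open>Composing with the closest-point projection, which does not increase distances, extends
  both functions from the closed ball to Lipschitz functions on the whole space. The projection
  sends outer points to the unit sphere, where \<open>h\<close> vanishes, so the support condition
  survives.\<close>

lemma integral_wedge_ball_eq_0:
  fixes h w :: "'a::euclidean_space \<Rightarrow> real"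
  assumes h: "L-lipschitz_on (cball 0 1) h" and w: "M-lipschitz_on (cball 0 1) w"
    and r: "r < 1"
    and supp: "\<And>y. r < norm y \<Longrightarrow> norm y \<le> 1 \<Longrightarrow> h y = 0"
    and h': "\<And>y. y \<in> ball 0 1 \<Longrightarrow> (h has_derivative h' y) (at y)"
    and w': "\<And>y. y \<in> ball 0 1 \<Longrightarrow> (w has_derivative w' y) (at y)"
  shows "((\<lambda>y. h' y a * w' y b - h' y b * w' y a) has_integral 0) (ball 0 1)" (is "(?F has_integral 0) _")
proof -
  define p where "p = closest_point (cball (0::'a) 1)"
  have p1: "p y \<in> cball 0 1" for y
    unfolding p_def by (rule closest_point_in_set) auto
  have pid: "p y = y" if "norm y \<le> 1" for y
    unfolding p_def using that by (intro closest_point_self) auto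
  have pl: "dist (p x) (p y) \<le> dist x y" for x y
    unfolding p_def by (rule closest_point_lipschitz) auto
  have ext: "N-lipschitz_on UNIV (\<lambda>y. g (p y))" if "K-lipschitz_on (cball 0 1) g" "K \<le> N" for g :: "'a \<Rightarrow> real" and K N
  proof (rule lipschitz_onI)
    have "K \<ge> 0" using lipschitz_on_nonneg[OF that(1)] .
    then show "N \<ge> 0" using that by simp
    show "dist (g (p x)) (g (p y)) \<le> N * dist x y" for x y
    proof -
      have "dist (g (p x)) (g (p y)) \<le> K * dist (p x) (p y)"
        using lipschitz_onD[OF that(1)] p1 by blast
      also have "\<dots> \<le> N * dist x y"
        using pl \<open>K \<ge> 0\<close> that by (intro mult_mono) auto
      finally show ?thesis .
    qed
  qed
  have der: "((\<lambda>y. g (p y)) has_derivative g' y) (at y)" if "(g has_derivative g' y) (at y)" "y \<in> ball 0 1"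
    for g :: "'a \<Rightarrow> real" and g' y
    by (rule has_derivative_transform_within_open[OF that(1) open_ball that(2)]) (simp add: pid)
  have supp': "h (p y) = 0" if "norm y > r" for y
  proof (cases "norm y \<le> 1")
    case True
    then show ?thesis using supp[of y] that by (simp add: pid)
  next
    case False
    have "norm (p y) = 1"
    proof -
      have "p y \<in> rel_frontier (cball 0 1)"
        unfolding p_def using False by (intro closest_point_in_rel_frontier) (use rel_interior_subset[of "cball (0::'a) 1"] in \<open>auto simp: affine_hull_nonempty_interior\<close>)
      then show ?thesis by (simp add: rel_frontier_nonempty_interior)
    qed
    then show ?thesis using supp r by auto
  qed
  let ?L = "max L M"
  have d: "((\<lambda>y. h (p y)) has_derivative h' y) (at y)" "((\<lambda>y. w (p y)) has_derivative w' y) (at y)" if "norm y \<le> r" for y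
    using der[of h h' y, OF h'] der[of w w' y, OF w'] that r by auto
  note I = integral_wedge_eq_0[where h = "\<lambda>y. h (p y)" and w = "\<lambda>y. w (p y)" and L = ?L and r = r and h'=h' and w'=w' and a=a and b=b,
    OF ext[OF h] ext[OF w] supp' d]
  have z: "h' y = (\<lambda>_. 0)" if "r < norm y" "norm y < 1" for y
  proof -
    have hz: "(h has_derivative (\<lambda>_. 0)) (at y)"
    proof (rule has_derivative_transform_within_open)
      show "((\<lambda>_. 0) has_derivative (\<lambda>_. 0)) (at y)" by simp
      show "open ({y. r < norm y} \<inter> ball 0 1)"
        by (intro open_Int open_ball open_Collect_less continuous_intros)
    qed (use that supp in auto)
    show ?thesis using has_derivative_unique[OF hz h'[of y]] that by auto
  qed
  have eq: "indicator (ball 0 1) y *\<^sub>R ?F y = indicator (cball 0 r) y * ?F y" for y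
    using z[of y] r by (auto simp: indicator_def)
  have i: "integrable lborel (\<lambda>y. indicator (ball 0 1) y *\<^sub>R ?F y)"
    unfolding eq using I by simp
  have z0: "integral\<^sup>L lborel (\<lambda>y. indicator (ball 0 1) y *\<^sub>R ?F y) = 0"
    unfolding eq using I by simp
  have "((\<lambda>y. indicator (ball 0 1) y *\<^sub>R ?F y) has_integral 0) UNIV"
    using has_integral_integral_lborel[OF i] z0 by simp
  moreover have "(\<lambda>y. indicator (ball 0 1) y *\<^sub>R ?F y) = (\<lambda>y. if y \<in> ball 0 1 then ?F y else 0)"
    by (auto simp: indicator_def)
  ultimately show "(?F has_integral 0) (ball 0 1)"
    by (simp only: has_integral_restrict_UNIV)
qed

section \<open>The area formula and test functions in the plane\<close>

lemma area_formula:
  fixes g :: "real^2 \<Rightarrow> real^2" and F :: "real^2 \<Rightarrow> real"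
  assumes S: "S \<in> sets lebesgue"
    and der: "\<And>x. x \<in> S \<Longrightarrow> (g has_derivative g' x) (at x within S)"
    and inj: "inj_on g S"
    and F: "F absolutely_integrable_on g ` S"
  shows "(\<lambda>x. \<bar>Omega (g' x (axis 1 1)) (g' x (axis 2 1))\<bar> * F (g x)) absolutely_integrable_on S"
    and "integral S (\<lambda>x. \<bar>Omega (g' x (axis 1 1)) (g' x (axis 2 1))\<bar> * F (g x)) = integral (g ` S) F"
proof -
  \<comment> \<open>The scalar integrand becomes a one-component vector to match the form of the
    change-of-variables theorem, which asks for injectivity but not for a nonvanishing
    Jacobian.\<close>
  let ?f = "\<lambda>z. vec (F z) :: real^1"
  have det: "det (matrix (g' x)) = Omega (g' x (axis 1 1)) (g' x (axis 2 1))" for x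
    by (simp add: det_2 matrix_def Omega_def algebra_simps)
  have "?f absolutely_integrable_on (g ` S) \<and> integral (g ` S) ?f = vec (integral (g ` S) F)"
    using F by (simp add: absolutely_integrable_on_1_iff integral_on_1_eq)
  then have "(\<lambda>x. \<bar>det (matrix (g' x))\<bar> *\<^sub>R ?f (g x)) absolutely_integrable_on S \<and>
    integral S (\<lambda>x. \<bar>det (matrix (g' x))\<bar> *\<^sub>R ?f (g x)) = vec (integral (g ` S) F)"
    using has_absolute_integral_change_of_variables[OF S der inj, of ?f "vec (integral (g ` S) F)"] by blast
  then show "(\<lambda>x. \<bar>Omega (g' x (axis 1 1)) (g' x (axis 2 1))\<bar> * F (g x)) absolutely_integrable_on S"
    and "integral S (\<lambda>x. \<bar>Omega (g' x (axis 1 1)) (g' x (axis 2 1))\<bar> * F (g x)) = integral (g ` S) F"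
    by (auto simp: absolutely_integrable_on_1_iff integral_on_1_eq det vec_eq_iff)
qed

text \<open>For positive \<open>\<kappa>\<close>, the hat function of height
  \<open>1 / \<kappa>\<close> and mass 1 on \<open>[c - \<kappa>, c + \<kappa>]\<close>, an
  approximate delta function. It is written as a second difference of the positive part so that its
  primitive has the same shape.\<close>

definition tent :: "real \<Rightarrow> real \<Rightarrow> real \<Rightarrow> real" where
  "tent \<kappa> c s = (max 0 (s - c + \<kappa>) - 2 * max 0 (s - c) + max 0 (s - c - \<kappa>)) / \<kappa>\<^sup>2"

text \<open>The primitive of \<open>tent\<close> that rises from 0 to 1: a step function smoothed
  just enough to have a continuous derivative.\<close>

definition ramp :: "real \<Rightarrow> real \<Rightarrow> real \<Rightarrow> real" where
  "ramp \<kappa> c s = ((max 0 (s - c + \<kappa>))\<^sup>2 - 2 * (max 0 (s - c))\<^sup>2 + (max 0 (s - c - \<kappa>))\<^sup>2) / (2 * \<kappa>\<^sup>2)"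

lemma has_real_derivative_max0_squared:
  "((\<lambda>s::real. (max 0 s)\<^sup>2) has_real_derivative 2 * max 0 s) (at s)"
proof (cases "s = 0")
  case True
  have "((\<lambda>h. (max 0 (0 + h))\<^sup>2 / h) \<longlongrightarrow> 0) (at (0::real))"
  proof (rule Lim_null_comparison)
    show "\<forall>\<^sub>F h in at (0::real). norm ((max 0 (0 + h))\<^sup>2 / h) \<le> \<bar>h\<bar>"
      by (intro eventuallyI) (auto simp: max_def power2_eq_square)
    show "((\<lambda>h. \<bar>h\<bar>) \<longlongrightarrow> 0) (at (0::real))"
      by (rule tendsto_rabs_zero) simp
  qed
  then show ?thesis using True by (simp add: DERIV_def)
next
  case False
  then consider "s > 0" | "s < 0" by linarith
  then show ?thesis
  proof cases
    case 1
    have "((\<lambda>s. s\<^sup>2) has_real_derivative 2 * max 0 s) (at s)"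
      using 1 by (auto intro!: derivative_eq_intros)
    then show ?thesis
      by (rule has_field_derivative_transform_within_open[of _ _ _ "{0<..}"]) (use 1 in auto)
  next
    case 2
    have "((\<lambda>s. 0) has_real_derivative 2 * max 0 s) (at s)"
      using 2 by (auto intro!: derivative_eq_intros)
    then show ?thesis
      by (rule has_field_derivative_transform_within_open[of _ _ _ "{..<0}"]) (use 2 in auto)
  qed
qed

lemma has_real_derivative_ramp:
  "(ramp \<kappa> c has_real_derivative tent \<kappa> c s) (at s)"
proof -
  have *: "((\<lambda>s. (max 0 (s - d))\<^sup>2) has_real_derivative 2 * max 0 (s - d)) (at s)" for d :: real
  proof -
    have "((\<lambda>s. s - d) has_real_derivative 1) (at s)"
      by (auto intro!: derivative_eq_intros)
    from DERIV_chain2[OF has_real_derivative_max0_squared this] show ?thesis by simp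
  qed
  have "((\<lambda>s. ((max 0 (s - (c - \<kappa>)))\<^sup>2 - 2 * (max 0 (s - c))\<^sup>2 + (max 0 (s - (c + \<kappa>)))\<^sup>2) / (2 * \<kappa>\<^sup>2))
     has_real_derivative (2 * max 0 (s - (c - \<kappa>)) - 2 * (2 * max 0 (s - c)) + 2 * max 0 (s - (c + \<kappa>))) / (2 * \<kappa>\<^sup>2)) (at s)"
    by (intro DERIV_cdivide DERIV_add DERIV_diff DERIV_cmult *)
  moreover have "(2 * max 0 (s - (c - \<kappa>)) - 2 * (2 * max 0 (s - c)) + 2 * max 0 (s - (c + \<kappa>))) / (2 * \<kappa>\<^sup>2) = tent \<kappa> c s"
    unfolding tent_def by (cases "\<kappa> = 0") (auto simp: field_simps)
  moreover have "(\<lambda>s. ((max 0 (s - (c - \<kappa>)))\<^sup>2 - 2 * (max 0 (s - c))\<^sup>2 + (max 0 (s - (c + \<kappa>)))\<^sup>2) / (2 * \<kappa>\<^sup>2)) = ramp \<kappa> c"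
    unfolding ramp_def by (auto simp: algebra_simps)
  ultimately show ?thesis by simp
qed

context
  fixes \<kappa> c :: real
  assumes \<kappa>: "\<kappa> > 0"
begin

lemma tent_bounds: "0 \<le> tent \<kappa> c s" "tent \<kappa> c s \<le> 1 / \<kappa>"
  using \<kappa> by (auto simp: tent_def max_def field_simps power2_eq_square)

lemma tent_eq_0: "\<kappa> \<le> \<bar>s - c\<bar> \<Longrightarrow> tent \<kappa> c s = 0"
  using \<kappa> by (auto simp: tent_def max_def abs_if split: if_splits)

lemma tent_ge: "\<bar>s - c\<bar> \<le> \<kappa> / 2 \<Longrightarrow> 1 / (2 * \<kappa>) \<le> tent \<kappa> c s"
  using \<kappa> by (auto simp: tent_def max_def field_simps power2_eq_square)

lemma continuous_on_tent: "continuous_on S (tent \<kappa> c)"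
  unfolding tent_def by (intro continuous_intros) (use \<kappa> in auto)

lemma ramp_lipschitz: "(1 / \<kappa>)-lipschitz_on UNIV (ramp \<kappa> c)"
proof (rule lipschitz_onI)
  show "dist (ramp \<kappa> c x) (ramp \<kappa> c y) \<le> 1 / \<kappa> * dist x y" for x y
    using field_differentiable_bound[of UNIV "ramp \<kappa> c" "tent \<kappa> c" "1 / \<kappa>" x y] tent_bounds
    by (auto simp: dist_norm has_real_derivative_ramp)
qed (use \<kappa> in auto)

lemma ramp_bounds: "0 \<le> ramp \<kappa> c s" "ramp \<kappa> c s \<le> 1"
proof -
  have mono: "ramp \<kappa> c x \<le> ramp \<kappa> c y" if "x \<le> y" for x y
    by (rule DERIV_nonneg_imp_nondecreasing[OF that]) (use has_real_derivative_ramp tent_bounds in blast)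
  have 0: "ramp \<kappa> c x = 0" if "x \<le> c - \<kappa>" for x
    using that \<kappa> by (auto simp: ramp_def max_def)
  have 1: "ramp \<kappa> c x = 1" if "x \<ge> c + \<kappa>" for x
    using that \<kappa> by (auto simp: ramp_def max_def field_simps power2_eq_square)
  show "0 \<le> ramp \<kappa> c s" using mono[of "min s (c - \<kappa>)" s] 0[of "min s (c - \<kappa>)"] by simp
  show "ramp \<kappa> c s \<le> 1" using mono[of s "max s (c + \<kappa>)"] 1[of "max s (c + \<kappa>)"] by simp
qed

end

lemma cbox_near_subset_ball:
  fixes z :: "real^2"
  assumes "2 * \<kappa> < \<rho>"
  shows "{x::real^2. \<bar>x $ 1 - z $ 1\<bar> \<le> \<kappa> \<and> \<bar>x $ 2 - z $ 2\<bar> \<le> \<kappa>} \<subseteq> ball z \<rho>"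
proof
  fix x assume x: "x \<in> {x::real^2. \<bar>x $ 1 - z $ 1\<bar> \<le> \<kappa> \<and> \<bar>x $ 2 - z $ 2\<bar> \<le> \<kappa>}"
  have "norm (x - z) \<le> \<bar>(x - z) $ 1\<bar> + \<bar>(x - z) $ 2\<bar>"
    using norm_le_l1_cart[of "x - z"] by (simp add: sum_2)
  then show "x \<in> ball z \<rho>" using x assms by (simp add: dist_norm norm_minus_commute)
qed

lemma measure_rectangle:
  fixes z :: "real^2"
  assumes "a \<ge> 0" "b \<ge> 0"
  shows "{x::real^2. \<bar>x $ 1 - z $ 1\<bar> \<le> a \<and> \<bar>x $ 2 - z $ 2\<bar> \<le> b} \<in> lmeasurable" (is ?A)
    and "measure lebesgue {x::real^2. \<bar>x $ 1 - z $ 1\<bar> \<le> a \<and> \<bar>x $ 2 - z $ 2\<bar> \<le> b} = 4 * a * b" (is ?B)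
proof -
  have eq: "{x::real^2. \<bar>x $ 1 - z $ 1\<bar> \<le> a \<and> \<bar>x $ 2 - z $ 2\<bar> \<le> b} = cbox (vector [z $ 1 - a, z $ 2 - b]) (vector [z $ 1 + a, z $ 2 + b])"
    by (auto simp: mem_box_cart forall_2 abs_le_iff)
  show ?A unfolding eq by simp
  have "cbox (vector [z $ 1 - a, z $ 2 - b]) (vector [z $ 1 + a, z $ 2 + b] :: real^2) \<noteq> {}"
    using assms by (simp add: interval_ne_empty_cart forall_2)
  then have "measure lborel (cbox (vector [z $ 1 - a, z $ 2 - b]) (vector [z $ 1 + a, z $ 2 + b] :: real^2)) = 4 * a * b"
    by (simp add: content_cbox_cart UNIV_2)
  then show ?B unfolding eq by (simp add: measure_completion)
qed

text \<open>Testing \<open>df = P\<^sub>1 dB\<^sub>1 + P\<^sub>2 dB\<^sub>2\<close> against \<open>\<Theta>(B\<^sub>1) d(\<Theta>(B\<^sub>2))\<close>, with \<open>\<Theta>\<close> a smoothed step function,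
  compares a local average of \<open>f\<close>, taken with respect to the pullback of the area by \<open>B\<close>,
  with \<open>\<epsilon>\<close>. The total mass of the pullback is found by deforming \<open>B\<close> into \<open>E\<close>; that \<open>B\<close> may
  have critical points is harmless because the area formula does not see them.\<close>

lemma abs_le_of_gradient_small:
  fixes B E :: "real^2 \<Rightarrow> real^2" and f :: "real^2 \<Rightarrow> real"
  assumes r: "r < 1"
    and BL: "L-lipschitz_on (cball 0 1) B" and EL: "L-lipschitz_on (cball 0 1) E"
    and fL: "L-lipschitz_on (cball 0 1) f"
    and Binj: "inj_on B (cball 0 1)" and Einj: "inj_on E (cball 0 1)"
    and B1: "B ` cball 0 1 \<subseteq> cball 0 1" and BE: "B ` cball 0 1 \<subseteq> E ` cball 0 1"
    and eq: "\<And>y. r < norm y \<Longrightarrow> norm y \<le> 1 \<Longrightarrow> B y = E y"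
    and f0: "\<And>y. r < norm y \<Longrightarrow> norm y \<le> 1 \<Longrightarrow> f y = 0"
    and B': "\<And>y. y \<in> ball 0 1 \<Longrightarrow> (B has_derivative B' y) (at y)"
    and E': "\<And>y. y \<in> ball 0 1 \<Longrightarrow> (E has_derivative E' y) (at y)"
    and f': "\<And>y. y \<in> ball 0 1 \<Longrightarrow> (f has_derivative (\<lambda>v. P y $ 1 * B' y v $ 1 + P y $ 2 * B' y v $ 2)) (at y)"
    and P: "\<And>y. y \<in> ball 0 1 \<Longrightarrow> \<bar>P y $ 1\<bar> \<le> \<epsilon>"
    and detE: "\<And>y. y \<in> ball 0 1 \<Longrightarrow> 0 \<le> Omega (E' y (axis 1 1)) (E' y (axis 2 1))"
    and y0: "y0 \<in> cball 0 1"
  shows "\<bar>f y0\<bar> \<le> 32 * \<epsilon>"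
proof (cases "f y0 = 0")
  case True
  have "\<bar>P 0 $ 1\<bar> \<le> \<epsilon>" by (rule P) simp
  then show ?thesis using True by simp
next
  case False
  \<comment> \<open>Halving lets the deviation of \<open>f\<close> from \<open>f y0\<close> on the
    support of the test function be absorbed: the final estimate bounds
    \<open>2 * \<delta> * J\<close> by \<open>4 * \<epsilon> + \<delta> * J\<close>.\<close>
  define \<delta> where "\<delta> = \<bar>f y0\<bar> / 2"
  have \<delta>: "\<delta> > 0" using False by (simp add: \<delta>_def)
  define z where "z = B y0"
  let ?S = "ball (0::real^2) 1"
  let ?e1 = "axis 1 1 :: real^2" and ?e2 = "axis 2 1 :: real^2"
  have cB: "continuous_on (cball 0 1) B" and cE: "continuous_on (cball 0 1) E" and cf: "continuous_on (cball 0 1) f"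
    using BL EL fL lipschitz_on_continuous_on by blast+
  have SC: "?S \<subseteq> cball 0 1" by auto
  have oB: "open (B ` ?S)" and oE: "open (E ` ?S)"
    by (intro invariance_of_domain open_ball continuous_on_subset[OF cB SC] continuous_on_subset[OF cE SC]
        inj_on_subset[OF Binj SC] inj_on_subset[OF Einj SC])+
  \<comment> \<open>\<open>z\<close> is not in the \<open>E\<close>-image of the unit circle: there
    \<open>B\<close> and \<open>E\<close> agree, so injectivity of \<open>B\<close> would put
    \<open>y0\<close> on the circle, where \<open>f\<close> vanishes.\<close>
  have zE: "z \<in> E ` ?S"
  proof -
    have "z \<in> E ` cball 0 1" using BE y0 by (auto simp: z_def)
    then obtain y1 where y1: "y1 \<in> cball 0 1" "z = E y1" by auto
    have "norm y1 \<noteq> 1"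
    proof
      assume "norm y1 = 1"
      then have "B y1 = B y0" using eq[of y1] r y1 by (simp add: z_def)
      then have "y1 = y0" using Binj y1 y0 by (auto dest: inj_onD)
      then show False using f0[of y0] \<open>norm y1 = 1\<close> r False by simp
    qed
    then show ?thesis using y1 by (auto simp: less_le)
  qed
  \<comment> \<open>Injectivity of \<open>B\<close> keeps \<open>z\<close> off the compact image of
    the points where \<open>f\<close> is far from \<open>f y0\<close>, so a whole neighbourhood of
    \<open>z\<close> avoids it. This localises \<open>f\<close> through the values of
    \<open>B\<close> without differentiating an inverse of \<open>B\<close>.\<close>
  define C where "C = {y \<in> cball 0 1. \<bar>f y - f y0\<bar> \<ge> \<delta>}"
  have "compact C"
  proof -
    have "C = cball 0 1 \<inter> (\<lambda>y. \<bar>f y - f y0\<bar>) -` {\<delta>..}" by (auto simp: C_def)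
    moreover have "closed (cball 0 1 \<inter> (\<lambda>y. \<bar>f y - f y0\<bar>) -` {\<delta>..})"
      by (intro continuous_closed_preimage continuous_intros cf) auto
    ultimately have "closed C" "C \<subseteq> cball 0 1" by auto
    then show ?thesis by (metis bounded_cball bounded_subset compact_eq_bounded_closed)
  qed
  then have "compact (B ` C)"
    by (intro compact_continuous_image continuous_on_subset[OF cB]) (auto simp: C_def)
  moreover have "z \<notin> B ` C"
    using Binj y0 \<delta> by (auto simp: z_def C_def dest: inj_onD)
  ultimately have "open (E ` ?S - B ` C)" "z \<in> E ` ?S - B ` C"
    using oE zE by (auto intro: open_Diff compact_imp_closed)
  then obtain \<rho> where \<rho>: "\<rho> > 0" "ball z \<rho> \<subseteq> E ` ?S - B ` C"
    using openE by blast
  \<comment> \<open>A third of the radius, since the square of half-side \<open>\<kappa>\<close>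
    lies in any ball of radius above \<open>2 * \<kappa>\<close>.\<close>
  define \<kappa> where "\<kappa> = \<rho> / 3"
  have \<kappa>: "\<kappa> > 0" using \<rho> by (simp add: \<kappa>_def)
  define Q where "Q = {x::real^2. \<bar>x $ 1 - z $ 1\<bar> \<le> \<kappa> \<and> \<bar>x $ 2 - z $ 2\<bar> \<le> \<kappa>}"
  have Qsub: "Q \<subseteq> E ` ?S - B ` C"
    using cbox_near_subset_ball[of \<kappa> \<rho> z] \<rho> by (auto simp: Q_def \<kappa>_def)
  let ?R1 = "\<lambda>x::real^2. ramp \<kappa> (z $ 1) (x $ 1)" and ?R2 = "\<lambda>x::real^2. ramp \<kappa> (z $ 2) (x $ 2)"
  let ?t1 = "\<lambda>x::real^2. tent \<kappa> (z $ 1) (x $ 1)" and ?t2 = "\<lambda>x::real^2. tent \<kappa> (z $ 2) (x $ 2)"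
  define g where "g x = ?t1 x * ?t2 x" for x
  note tb = tent_bounds[OF \<kappa>]
  have g0: "g x \<ge> 0" for x by (simp add: g_def tb)
  have gQ: "g x = 0" if "x \<notin> Q" for x
    using that tent_eq_0[OF \<kappa>] by (auto simp: g_def Q_def not_le dest!: less_imp_le)
  have cg: "continuous_on UNIV g" "continuous_on UNIV ?t2"
    unfolding g_def
    by (intro continuous_intros continuous_on_compose2[OF continuous_on_tent[OF \<kappa>, of UNIV]]; simp)+
  have ai: "F absolutely_integrable_on T" if cF: "continuous_on UNIV F" and bT: "bounded T" and mT: "T \<in> sets lebesgue" for F :: "real^2 \<Rightarrow> real" and T
  proof -
    obtain a where "T \<subseteq> cbox (-a) a" using bounded_subset_cbox_symmetric[OF bT] by metis
    moreover have "F absolutely_integrable_on cbox (-a) a"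
      by (rule absolutely_integrable_continuous) (use cF continuous_on_subset in blast)
    ultimately show ?thesis using mT set_integrable_subset by blast
  qed
  have bB: "bounded (B ` ?S)" and bE: "bounded (E ` ?S)"
    using compact_continuous_image[OF cB] compact_continuous_image[OF cE]
    by (meson bounded_subset compact_cball compact_imp_bounded image_mono SC)+
  have mB: "B ` ?S \<in> sets lebesgue" and mE: "E ` ?S \<in> sets lebesgue"
    using oB oE by auto
  have Qm: "Q \<in> lmeasurable" unfolding Q_def using \<kappa> by (intro measure_rectangle) auto
  then have Qs: "Q \<in> sets lebesgue" by auto
  have Qb: "bounded Q" using Qsub bE by (meson bounded_subset Diff_subset subset_trans)
  define J where "J = integral Q g"
  have Qg: "integral Q g = integral UNIV g" "g integrable_on UNIV"
  proof -
    have "(\<lambda>x. if x \<in> Q then g x else 0) = g" using gQ by auto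
    then show "integral Q g = integral UNIV g" using integral_restrict_UNIV[of Q g] by simp
    have "g integrable_on Q" using ai[OF cg(1) Qb Qs] by (rule absolutely_integrable_on_def[THEN iffD1, THEN conjunct1])
    then show "g integrable_on UNIV" using integrable_restrict_UNIV[of Q g] \<open>(\<lambda>x. if x \<in> Q then g x else 0) = g\<close> by simp
  qed
  have JE: "integral (E ` ?S) g = J"
  proof -
    have "(\<lambda>x. if x \<in> E ` ?S then g x else 0) = g" using gQ Qsub by (intro ext) (metis DiffD1 subsetD)
    then show ?thesis using integral_restrict_UNIV[of "E ` ?S" g] Qg by (simp add: J_def)
  qed
  \<comment> \<open>An inequality suffices for the image of \<open>B\<close>, because this integral
    enters the error term only.\<close>
  have JB: "integral (B ` ?S) g \<le> J"
    unfolding J_def Qg(1)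
    by (rule integral_subset_le) (use ai[OF cg(1) bB mB] Qg g0 in \<open>auto simp: absolutely_integrable_on_def\<close>)
  \<comment> \<open>On the inner square of area \<open>\<kappa>\<^sup>2\<close> both factors of
    \<open>g\<close> are at least \<open>1 / (2 * \<kappa>)\<close>; this is the origin of
    1/4.\<close>
  have J14: "1 / 4 \<le> J"
  proof -
    let ?H = "{x::real^2. \<bar>x $ 1 - z $ 1\<bar> \<le> \<kappa> / 2 \<and> \<bar>x $ 2 - z $ 2\<bar> \<le> \<kappa> / 2}"
    have H: "?H \<in> lmeasurable" "measure lebesgue ?H = 4 * (\<kappa>/2) * (\<kappa>/2)" using measure_rectangle[of "\<kappa>/2" "\<kappa>/2" z] \<kappa> by auto
    have "1 / 4 = (1 / (2 * \<kappa>)\<^sup>2) * measure lebesgue ?H"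
      unfolding H(2) using \<kappa> by (simp add: power2_eq_square)
    also have "\<dots> = integral ?H (\<lambda>x. 1 / (2 * \<kappa>)\<^sup>2 * 1)"
      by (simp only: lmeasure_integral[OF H(1)] integral_mult_right)
    also have "\<dots> \<le> integral ?H g"
    proof (rule integral_le)
      show "(\<lambda>x. 1 / (2 * \<kappa>)\<^sup>2 * 1) integrable_on ?H"
        by (rule integrable_on_const[OF H(1)])
      have "?H \<in> sets lebesgue" "bounded ?H" using H(1) Qb \<kappa> by (auto simp: Q_def elim!: bounded_subset)
      then show "g integrable_on ?H" using ai[OF cg(1)] by (auto simp: absolutely_integrable_on_def)
      fix x assume "x \<in> ?H"
      then have "1 / (2 * \<kappa>) * (1 / (2 * \<kappa>)) \<le> g x"
        unfolding g_def using \<kappa> tb by (intro mult_mono tent_ge) auto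
      then show "1 / (2 * \<kappa>)\<^sup>2 * 1 \<le> g x" by (simp add: power2_eq_square)
    qed
    also have "\<dots> \<le> J"
      unfolding J_def
    proof (rule integral_subset_le)
      have "?H \<in> sets lebesgue" "bounded ?H" using H(1) Qb \<kappa> by (auto simp: Q_def elim!: bounded_subset)
      then show "g integrable_on ?H" using ai[OF cg(1)] by (auto simp: absolutely_integrable_on_def)
      show "g integrable_on Q" using ai[OF cg(1) Qb Qs] by (auto simp: absolutely_integrable_on_def)
    qed (use g0 \<kappa> in \<open>auto simp: Q_def\<close>)
    finally show ?thesis .
  qed
  \<comment> \<open>The image of \<open>B\<close> lies in the unit disc, so \<open>?t2\<close>,
    which is at most \<open>1 / \<kappa>\<close>, lives there on a strip of width 2 and height
    \<open>2 * \<kappa>\<close>.\<close>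
  have J4: "integral (B ` ?S) ?t2 \<le> 4"
  proof -
    let ?H = "{x::real^2. \<bar>x $ 1 - (vector [0, z $ 2] :: real^2) $ 1\<bar> \<le> 1 \<and> \<bar>x $ 2 - (vector [0, z $ 2] :: real^2) $ 2\<bar> \<le> \<kappa>}"
    have H: "?H \<in> lmeasurable" "measure lebesgue ?H = 4 * 1 * \<kappa>" using measure_rectangle[of 1 \<kappa> "vector [0, z $ 2]"] \<kappa> by auto
    have i: "(\<lambda>x::real^2. 1 / \<kappa> * 1) integrable_on ?H"
      by (rule integrable_on_const[OF H(1)])
    have "integral (B ` ?S) ?t2 = integral UNIV (\<lambda>x. if x \<in> B ` ?S then ?t2 x else 0)"
      by (simp only: integral_restrict_UNIV)
    also have "\<dots> \<le> integral UNIV (\<lambda>x. if x \<in> ?H then 1 / \<kappa> * 1 else 0)"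
    proof (rule integral_le)
      show "(\<lambda>x. if x \<in> B ` ?S then ?t2 x else 0) integrable_on UNIV"
        unfolding integrable_restrict_UNIV using ai[OF cg(2) bB mB] by (auto simp: absolutely_integrable_on_def)
      show "(\<lambda>x. if x \<in> ?H then 1 / \<kappa> * 1 else 0) integrable_on UNIV"
        unfolding integrable_restrict_UNIV by (rule i)
      fix x
      show "(if x \<in> B ` ?S then ?t2 x else 0) \<le> (if x \<in> ?H then 1 / \<kappa> * 1 else 0)"
      proof (cases "x \<in> B ` ?S \<and> ?t2 x \<noteq> 0")
        case True
        then have "x \<in> cball 0 1" using B1 SC by blast
        then have "\<bar>x $ 1\<bar> \<le> 1" using component_le_norm_cart[of x 1] by (simp add: dist_norm)
        moreover have "\<bar>x $ 2 - z $ 2\<bar> \<le> \<kappa>" using True tent_eq_0[OF \<kappa>, of "x $ 2" "z $ 2"] by linarith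
        ultimately show ?thesis using tb(2) \<kappa> by simp
      qed (use tb \<kappa> in auto)
    qed
    also have "\<dots> = 1 / \<kappa> * measure lebesgue ?H"
      by (simp only: integral_restrict_UNIV integral_mult_right lmeasure_integral[OF H(1)])
    also have "\<dots> = 4" unfolding H(2) using \<kappa> by simp
    finally show ?thesis .
  qed
  define D where "D y = Omega (B' y ?e1) (B' y ?e2)" for y
  define DE where "DE y = Omega (E' y ?e1) (E' y ?e2)" for y
  have area: "(\<lambda>y. \<bar>D y\<bar> * F (B y)) absolutely_integrable_on ?S"
      "integral ?S (\<lambda>y. \<bar>D y\<bar> * F (B y)) = integral (B ` ?S) F" if "continuous_on UNIV F" for F :: "real^2 \<Rightarrow> real"
    unfolding D_def
    by (rule area_formula[of ?S B B' F]; use has_derivative_at_withinI[OF B'] inj_on_subset[OF Binj SC] ai[OF that bB mB] in auto)+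
  have areaE: "((\<lambda>y. DE y * g (E y)) has_integral J) ?S"
  proof -
    have "(\<lambda>y. \<bar>DE y\<bar> * g (E y)) absolutely_integrable_on ?S"
      "integral ?S (\<lambda>y. \<bar>DE y\<bar> * g (E y)) = integral (E ` ?S) g"
      unfolding DE_def
      by (rule area_formula[of ?S E E' g]; use has_derivative_at_withinI[OF E'] inj_on_subset[OF Einj SC] ai[OF cg(1) bE mE] in auto)+
    then have "((\<lambda>y. \<bar>DE y\<bar> * g (E y)) has_integral J) ?S"
      unfolding JE by (metis absolutely_integrable_on_def integrable_integral)
    then show ?thesis
      by (rule has_integral_eq[rotated]) (use detE in \<open>auto simp: DE_def\<close>)
  qed
  have comp: "K-lipschitz_on UNIV (\<lambda>x::real^2. x $ i)" if "K = 1" for K i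
    using that by (auto intro!: lipschitz_onI simp: dist_norm simp flip: vector_minus_component intro: component_le_norm_cart)
  have RL: "(L / \<kappa>)-lipschitz_on (cball 0 1) (\<lambda>y. ramp \<kappa> c (X y $ i))" if "L-lipschitz_on (cball 0 1) X" for X :: "real^2 \<Rightarrow> real^2" and i c
    using lipschitz_on_compose2[OF that lipschitz_on_subset[OF comp[OF refl, of i] subset_UNIV], THEN lipschitz_on_compose2,
      OF lipschitz_on_subset[OF ramp_lipschitz[OF \<kappa>, of c] subset_UNIV]] by (simp add: mult.commute)
  have Rd: "((\<lambda>y. ramp \<kappa> c (X y $ i)) has_derivative (\<lambda>v. X' v $ i * tent \<kappa> c (X y $ i))) (at y)"
    if "(X has_derivative X') (at y)" for X :: "real^2 \<Rightarrow> real^2" and X' y i c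
  proof -
    have "((\<lambda>y. X y $ i) has_derivative (\<lambda>v. X' v $ i)) (at y)"
      using bounded_linear.has_derivative[OF bounded_linear_vec_nth that] .
    from has_derivative_compose[OF this has_real_derivative_ramp[unfolded has_field_derivative_def]]
    show ?thesis by (simp add: mult.commute)
  qed
  have Rf: "\<exists>K. K-lipschitz_on (cball 0 1) (\<lambda>y. f y * ?R1 (B y))"
  proof -
    have "bounded (f ` cball 0 1)"
      by (intro compact_imp_bounded compact_continuous_image cf compact_cball)
    then obtain M where M: "\<And>y. y \<in> cball 0 1 \<Longrightarrow> \<bar>f y\<bar> \<le> M"
      unfolding bounded_iff by (metis real_norm_def imageI)
    have M0: "M \<ge> 0" using M[of 0] by simp
    have L0: "L \<ge> 0" using lipschitz_on_nonneg[OF fL] .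
    have "(L + M * (L / \<kappa>))-lipschitz_on (cball 0 1) (\<lambda>y. f y * ?R1 (B y))"
    proof (rule lipschitz_onI)
      fix x y :: "real^2" assume xy: "x \<in> cball 0 1" "y \<in> cball 0 1"
      have "f x * ?R1 (B x) - f y * ?R1 (B y) = (f x - f y) * ?R1 (B x) + f y * (?R1 (B x) - ?R1 (B y))"
        by (simp add: algebra_simps)
      then have "\<bar>f x * ?R1 (B x) - f y * ?R1 (B y)\<bar> \<le> \<bar>f x - f y\<bar> * \<bar>?R1 (B x)\<bar> + \<bar>f y\<bar> * \<bar>?R1 (B x) - ?R1 (B y)\<bar>"
        by (simp add: abs_mult[symmetric])
      also have "\<dots> \<le> (L * dist x y) * 1 + M * (L / \<kappa> * dist x y)"
        using lipschitz_onD[OF fL xy] lipschitz_onD[OF RL[OF BL] xy] M[OF xy(2)] M0 L0 ramp_bounds[OF \<kappa>]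
        by (intro add_mono mult_mono) (auto simp: dist_real_def)
      finally show "dist (f x * ?R1 (B x)) (f y * ?R1 (B y)) \<le> (L + M * (L / \<kappa>)) * dist x y"
        by (simp add: dist_real_def algebra_simps)
    qed (use L0 M0 \<kappa> in auto)
    then show ?thesis by blast
  qed
  then obtain K where K: "K-lipschitz_on (cball 0 1) (\<lambda>y. f y * ?R1 (B y))" by blast
  \<comment> \<open>Stokes for \<open>f * ?R1 (B y)\<close> and \<open>?R2 (B y)\<close>. Wedging
    with the differential of the second component of \<open>B\<close> removes the
    \<open>P y $ 2\<close> term of the differential of \<open>f\<close>, which is why only the first
    component of \<open>P\<close> has to be small.\<close>
  have w1: "((\<lambda>y. f y * g (B y) * D y + ?R1 (B y) * ?t2 (B y) * P y $ 1 * D y) has_integral 0) ?S"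
  proof (rule has_integral_eq[rotated])
    show "((\<lambda>y. (f y * (B' y ?e1 $ 1 * ?t1 (B y)) + (P y $ 1 * B' y ?e1 $ 1 + P y $ 2 * B' y ?e1 $ 2) * ?R1 (B y)) * (B' y ?e2 $ 2 * ?t2 (B y))
       - (f y * (B' y ?e2 $ 1 * ?t1 (B y)) + (P y $ 1 * B' y ?e2 $ 1 + P y $ 2 * B' y ?e2 $ 2) * ?R1 (B y)) * (B' y ?e1 $ 2 * ?t2 (B y))) has_integral 0) ?S"
      by (rule integral_wedge_ball_eq_0[OF K RL[OF BL, of "z $ 2" 2] r _ has_derivative_mult[OF f' Rd[OF B']] Rd[OF B']])
        (use f0 in auto)
  qed (simp add: D_def g_def Omega_def algebra_simps)
  \<comment> \<open>The signed mass is found by changing \<open>B\<close> into \<open>E\<close> one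
    component at a time, in \<open>a\<close> the first and in \<open>b\<close> the second; the
    changing factor vanishes near the boundary, so Stokes applies. The sign of \<open>D\<close> is
    unknown while that of \<open>DE\<close> is given, so the area formula yields a signed integral
    for \<open>E\<close> only.\<close>
  have w2: "((\<lambda>y. g (B y) * D y) has_integral J) ?S"
  proof -
    have a: "((\<lambda>y. (B' y ?e1 $ 1 * ?t1 (B y) - E' y ?e1 $ 1 * ?t1 (E y)) * (B' y ?e2 $ 2 * ?t2 (B y))
         - (B' y ?e2 $ 1 * ?t1 (B y) - E' y ?e2 $ 1 * ?t1 (E y)) * (B' y ?e1 $ 2 * ?t2 (B y))) has_integral 0) ?S"
      by (rule integral_wedge_ball_eq_0[OF lipschitz_on_diff[OF RL[OF BL, of "z $ 1" 1] RL[OF EL, of "z $ 1" 1]] RL[OF BL, of "z $ 2" 2] r _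
        has_derivative_diff[OF Rd[OF B'] Rd[OF E']] Rd[OF B']]) (use eq in auto)
    have b: "((\<lambda>y. (B' y ?e1 $ 2 * ?t2 (B y) - E' y ?e1 $ 2 * ?t2 (E y)) * (E' y ?e2 $ 1 * ?t1 (E y))
         - (B' y ?e2 $ 2 * ?t2 (B y) - E' y ?e2 $ 2 * ?t2 (E y)) * (E' y ?e1 $ 1 * ?t1 (E y))) has_integral 0) ?S"
      by (rule integral_wedge_ball_eq_0[OF lipschitz_on_diff[OF RL[OF BL, of "z $ 2" 2] RL[OF EL, of "z $ 2" 2]] RL[OF EL, of "z $ 1" 1] r _
        has_derivative_diff[OF Rd[OF B'] Rd[OF E']] Rd[OF E']]) (use eq in auto)
    show ?thesis
      by (rule has_integral_eq[rotated, OF has_integral_add[OF has_integral_diff[OF a b] areaE, simplified]])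
        (simp add: D_def DE_def g_def Omega_def algebra_simps)
  qed
  \<comment> \<open>Subtracting \<open>f y0\<close> times \<open>w2\<close> from \<open>w1\<close>
    isolates \<open>f y0 * J\<close> against one term carrying \<open>P\<close> and one carrying the
    deviation \<open>f y - f y0\<close>.\<close>
  define T where "T y = ?R1 (B y) * ?t2 (B y) * P y $ 1 * D y + (f y - f y0) * (g (B y) * D y)" for y
  have T: "(T has_integral - (f y0 * J)) ?S"
    by (rule has_integral_eq[rotated, OF has_integral_diff[OF w1 has_integral_mult_right[OF w2, of "f y0"], simplified]])
      (simp add: T_def algebra_simps)
  have \<epsilon>0: "\<epsilon> \<ge> 0" using P[of 0] by simp
  have bd: "norm (T y) \<le> \<epsilon> * (\<bar>D y\<bar> * ?t2 (B y)) + \<delta> * (\<bar>D y\<bar> * g (B y))" if y: "y \<in> ?S" for y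
  proof -
    have "\<bar>f y - f y0\<bar> * g (B y) \<le> \<delta> * g (B y)"
    proof (cases "B y \<in> Q")
      case True
      then have "y \<notin> C" using Qsub by auto
      then have "\<bar>f y - f y0\<bar> \<le> \<delta>" using y by (simp add: C_def)
      then show ?thesis by (rule mult_right_mono[OF _ g0])
    qed (simp add: gQ)
    then have "\<bar>f y - f y0\<bar> * g (B y) * \<bar>D y\<bar> \<le> \<delta> * g (B y) * \<bar>D y\<bar>"
      by (rule mult_right_mono) auto
    moreover have "?R1 (B y) * ?t2 (B y) * \<bar>P y $ 1\<bar> * \<bar>D y\<bar> \<le> 1 * ?t2 (B y) * \<epsilon> * \<bar>D y\<bar>"
      using ramp_bounds[OF \<kappa>] tb P[OF y] \<epsilon>0 by (intro mult_mono) auto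
    moreover have "\<bar>T y\<bar> \<le> ?R1 (B y) * ?t2 (B y) * \<bar>P y $ 1\<bar> * \<bar>D y\<bar> + \<bar>f y - f y0\<bar> * g (B y) * \<bar>D y\<bar>"
      unfolding T_def using abs_triangle_ineq[of "?R1 (B y) * ?t2 (B y) * P y $ 1 * D y" "(f y - f y0) * (g (B y) * D y)"]
        ramp_bounds[OF \<kappa>] tb g0 by (simp add: abs_mult)
    ultimately show ?thesis by (simp add: algebra_simps)
  qed
  \<comment> \<open>The area formula turns the integrals with \<open>\<bar>D y\<bar>\<close> into
    integrals over the image of \<open>B\<close>, so no bound on the derivative of \<open>B\<close>
    enters.\<close>
  have "norm (integral ?S T) \<le> integral ?S (\<lambda>y. \<epsilon> * (\<bar>D y\<bar> * ?t2 (B y)) + \<delta> * (\<bar>D y\<bar> * g (B y)))"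
    using area(1)[OF cg(1)] area(1)[OF cg(2)] T bd
    by (intro integral_norm_bound_integral integrable_add integrable_on_mult_right) (auto simp: absolutely_integrable_on_def)
  also have "\<dots> = \<epsilon> * integral (B ` ?S) ?t2 + \<delta> * integral (B ` ?S) g"
    using area[OF cg(1)] area[OF cg(2)]
    by (subst integral_add) (auto intro!: integrable_on_mult_right simp: absolutely_integrable_on_def)
  also have "\<dots> \<le> \<epsilon> * 4 + \<delta> * J"
    using J4 JB \<epsilon>0 \<delta> by (intro add_mono mult_left_mono) auto
  finally have "\<bar>f y0\<bar> * J \<le> \<epsilon> * 4 + \<delta> * J"
    using T J14 by (simp add: integral_unique abs_mult)
  \<comment> \<open>Since \<open>J\<close> is at least 1/4, this gives
    \<open>\<delta> \<le> 16 * \<epsilon>\<close>; as \<open>\<bar>f y0\<bar>\<close> is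
    \<open>2 * \<delta>\<close>, the constant becomes 32.\<close>
  then have "\<delta> * J \<le> 4 * \<epsilon>" by (simp add: \<delta>_def algebra_simps)
  moreover have "\<delta> * (1 / 4) \<le> \<delta> * J" using J14 \<delta> by (intro mult_left_mono) auto
  ultimately show ?thesis by (simp add: \<delta>_def)
qed

section \<open>Functions of class $C^k$\<close>

lemma Ck_on_cong:
  assumes "open S" "\<And>x. x \<in> S \<Longrightarrow> f x = g x"
  shows "Ck_on k S f \<longleftrightarrow> Ck_on k S g"
  using assms(2)
proof (induction k arbitrary: f g)
  case 0
  then show ?case by (simp cong: continuous_on_cong)
next
  case (Suc k)
  have imp: "g differentiable at x \<and> frechet_derivative g (at x) = frechet_derivative f (at x)"
    if "f differentiable at x" "x \<in> S" "\<And>x. x \<in> S \<Longrightarrow> f x = g x" for x f g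
  proof -
    have "(f has_derivative frechet_derivative f (at x)) (at x)"
      using that(1) by (simp add: frechet_derivative_works)
    then have "(g has_derivative frechet_derivative f (at x)) (at x)"
      by (rule has_derivative_transform_within_open[OF _ assms(1) that(2) that(3)])
    then have "frechet_derivative f (at x) = frechet_derivative g (at x)" "g differentiable at x"
      using frechet_derivative_at differentiableI by blast+
    then show ?thesis by simp
  qed
  have fg: "g differentiable at x" "frechet_derivative g (at x) = frechet_derivative f (at x)"
    if "f differentiable at x" "x \<in> S" for x
    using imp[of f x g, OF that Suc.prems] by auto
  have gf: "f differentiable at x" if "g differentiable at x" "x \<in> S" for x
    using imp[of g x f, OF that Suc.prems[symmetric]] by simp
  have d: "(\<forall>x\<in>S. f differentiable at x) \<longleftrightarrow> (\<forall>x\<in>S. g differentiable at x)"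
    using fg(1) gf by blast
  show ?case
  proof (cases "\<forall>x\<in>S. f differentiable at x")
    case True
    have "Ck_on k S (\<lambda>x. frechet_derivative f (at x) v) \<longleftrightarrow> Ck_on k S (\<lambda>x. frechet_derivative g (at x) v)" for v
      by (rule Suc.IH) (use fg(2) True in simp)
    then show ?thesis using d by simp
  qed (use d in auto)
qed

lemma Ck_on_SucI:
  assumes "open S" "\<And>x. x \<in> S \<Longrightarrow> (f has_derivative f' x) (at x)"
    and "\<And>v. Ck_on k S (\<lambda>x. f' x v)"
  shows "Ck_on (Suc k) S f"
proof -
  have "frechet_derivative f (at x) = f' x" if "x \<in> S" for x
    using assms(2)[OF that] frechet_derivative_at by metis
  then have "Ck_on k S (\<lambda>x. frechet_derivative f (at x) v)" for v
    using assms(3)[of v] Ck_on_cong[OF assms(1), of "\<lambda>x. f' x v" "\<lambda>x. frechet_derivative f (at x) v"] by auto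
  then show ?thesis using assms(2) by (auto simp: differentiable_def)
qed

lemma Ck_on_SucD:
  assumes "Ck_on (Suc k) S f"
  shows "x \<in> S \<Longrightarrow> (f has_derivative frechet_derivative f (at x)) (at x)"
    and "Ck_on k S (\<lambda>x. frechet_derivative f (at x) v)"
  using assms by (auto simp: frechet_derivative_works)

lemma Ck_on_imp_continuous_on: "Ck_on k S f \<Longrightarrow> continuous_on S f"
  by (cases k) (auto intro!: differentiable_imp_continuous_on
    simp: differentiable_on_def differentiable_at_withinI)

lemma Ck_on_subset: "Ck_on k S f \<Longrightarrow> T \<subseteq> S \<Longrightarrow> Ck_on k T f"
  by (induction k arbitrary: f) (auto intro: continuous_on_subset)

lemma Ck_on_Suc_imp: "Ck_on (Suc k) S f \<Longrightarrow> Ck_on k S f"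
proof (induction k arbitrary: f)
  case 0
  then show ?case using Ck_on_imp_continuous_on[OF 0] by simp
qed auto

lemma Ck_on_const: "Ck_on k S (\<lambda>x. c)"
proof (induction k arbitrary: c)
  case (Suc k)
  have "frechet_derivative (\<lambda>x. c) (at x) = (\<lambda>v. 0)" for x :: 'a
    by (metis frechet_derivative_at has_derivative_const)
  then show ?case using Suc[of 0] by simp
qed simp

lemma Ck_on_bounded_linear:
  assumes "bounded_linear f"
  shows "Ck_on k S f"
proof (cases k)
  case 0
  then show ?thesis using assms by (simp add: linear_continuous_on)
next
  case (Suc n)
  have "frechet_derivative f (at x) = f" for x
    using bounded_linear_imp_has_derivative[OF assms] frechet_derivative_at by metis
  then show ?thesis using Suc Ck_on_const[of n S] assms
    by (simp add: bounded_linear_imp_differentiable Ck_on_const)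
qed

lemma Ck_on_add:
  assumes "open S" "Ck_on k S f" "Ck_on k S g"
  shows "Ck_on k S (\<lambda>x. f x + g x)"
  using assms(2,3)
proof (induction k arbitrary: f g)
  case 0
  then show ?case by (simp add: continuous_on_add)
next
  case (Suc k)
  show ?case
    by (rule Ck_on_SucI[OF assms(1) has_derivative_add[OF Ck_on_SucD(1)[OF Suc.prems(1)] Ck_on_SucD(1)[OF Suc.prems(2)]]
        Suc.IH[OF Ck_on_SucD(2)[OF Suc.prems(1)] Ck_on_SucD(2)[OF Suc.prems(2)]]])
qed

lemma Ck_on_sum:
  assumes "open S" "\<And>i. i \<in> I \<Longrightarrow> Ck_on k S (f i)"
  shows "Ck_on k S (\<lambda>x. \<Sum>i\<in>I. f i x)"
  using assms(2) by (induction I rule: infinite_finite_induct) (auto intro: Ck_on_const Ck_on_add[OF assms(1)])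

lemma Ck_on_bilinear:
  assumes "open S" "bounded_bilinear p" "Ck_on k S f" "Ck_on k S g"
  shows "Ck_on k S (\<lambda>x. p (f x) (g x))"
  using assms(3,4)
proof (induction k arbitrary: f g)
  case 0
  then show ?case using assms(2) by (simp add: bounded_bilinear.continuous_on)
next
  case (Suc k)
  show ?case
  proof (rule Ck_on_SucI[OF assms(1) bounded_bilinear.FDERIV[OF assms(2) Ck_on_SucD(1)[OF Suc.prems(1)] Ck_on_SucD(1)[OF Suc.prems(2)]]])
    show "Ck_on k S (\<lambda>x. p (f x) (frechet_derivative g (at x) v) + p (frechet_derivative f (at x) v) (g x))" for v
      by (rule Ck_on_add[OF assms(1) Suc.IH[OF Ck_on_Suc_imp[OF Suc.prems(1)] Ck_on_SucD(2)[OF Suc.prems(2)]]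
            Suc.IH[OF Ck_on_SucD(2)[OF Suc.prems(1)] Ck_on_Suc_imp[OF Suc.prems(2)]]])
  qed
qed

lemma Ck_on_compose:
  fixes f :: "'a::euclidean_space \<Rightarrow> 'b::euclidean_space" and g :: "'b \<Rightarrow> 'c::real_normed_vector"
  assumes "open S" "f ` S \<subseteq> T" "Ck_on k S f" "Ck_on k T g"
  shows "Ck_on k S (\<lambda>x. g (f x))"
  using assms(3,4)
proof (induction k arbitrary: g)
  case 0
  then show ?case using assms(2) by (auto intro: continuous_on_compose2)
next
  case (Suc k)
  have d: "((\<lambda>x. g (f x)) has_derivative (\<lambda>v. frechet_derivative g (at (f x)) (frechet_derivative f (at x) v))) (at x)"
    if "x \<in> S" for x
    by (rule has_derivative_compose[OF Ck_on_SucD(1)[OF Suc.prems(1) that] Ck_on_SucD(1)[OF Suc.prems(2)]])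
      (use that assms(2) in auto)
  \<comment> \<open>The chain rule differentiates \<open>g\<close> in a direction that moves with
    \<open>x\<close>, whereas \<open>Ck_on\<close> controls fixed directions; expanding in the basis
    separates the two.\<close>
  have e: "frechet_derivative g (at (f x)) (frechet_derivative f (at x) v)
     = (\<Sum>i\<in>Basis. (frechet_derivative f (at x) v \<bullet> i) *\<^sub>R frechet_derivative g (at (f x)) i)" if "x \<in> S" for x v
  proof -
    have "linear (frechet_derivative g (at (f x)))"
      using Ck_on_SucD(1)[OF Suc.prems(2)] that assms(2) has_derivative_linear by blast
    then have "frechet_derivative g (at (f x)) (\<Sum>i\<in>Basis. (w \<bullet> i) *\<^sub>R i) = (\<Sum>i\<in>Basis. (w \<bullet> i) *\<^sub>R frechet_derivative g (at (f x)) i)" for w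
      by (simp add: linear_sum linear_cmul)
    from this[of "frechet_derivative f (at x) v"] show ?thesis unfolding euclidean_representation .
  qed
  show ?case
  proof (rule Ck_on_SucI[OF assms(1) d])
    fix v
    have "Ck_on k S (\<lambda>x. \<Sum>i\<in>Basis. (frechet_derivative f (at x) v \<bullet> i) *\<^sub>R frechet_derivative g (at (f x)) i)"
    proof (intro Ck_on_sum assms(1) Ck_on_bilinear[OF assms(1) bounded_bilinear_scaleR] Ck_on_bilinear[OF assms(1) bounded_bilinear_inner] Ck_on_const)
      show "Ck_on k S (\<lambda>x. frechet_derivative f (at x) v)"
        by (rule Ck_on_SucD(2)[OF Suc.prems(1)])
      show "Ck_on k S (\<lambda>x. frechet_derivative g (at (f x)) i)" for i
        by (rule Suc.IH[OF Ck_on_Suc_imp[OF Suc.prems(1)] Ck_on_SucD(2)[OF Suc.prems(2)]])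
    qed
    then show "Ck_on k S (\<lambda>x. frechet_derivative g (at (f x)) (frechet_derivative f (at x) v))"
    proof (rule Ck_on_cong[OF assms(1), THEN iffD2, rotated])
      show "x \<in> S \<Longrightarrow> frechet_derivative g (at (f x)) (frechet_derivative f (at x) v)
        = (\<Sum>i\<in>Basis. (frechet_derivative f (at x) v \<bullet> i) *\<^sub>R frechet_derivative g (at (f x)) i)" for x
        by (rule e)
    qed
  qed
qed

lemma Ck_on_local:
  assumes "open S" "\<And>x. x \<in> S \<Longrightarrow> \<exists>U. open U \<and> x \<in> U \<and> Ck_on k (U \<inter> S) f"
  shows "Ck_on k S f"
  using assms(2)
proof (induction k arbitrary: f)
  case 0
  have "continuous (at x) f" if xS: "x \<in> S" for x
  proof -
    obtain U where "open U" "x \<in> U" "continuous_on (U \<inter> S) f" using 0[OF xS] by auto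
    then show ?thesis using xS assms(1) by (metis IntI continuous_on_eq_continuous_at open_Int)
  qed
  then show ?case by (simp add: continuous_at_imp_continuous_on)
next
  case (Suc k)
  show ?case
    unfolding Ck_on.simps
  proof (intro conjI ballI allI)
    fix x assume "x \<in> S"
    from Suc.prems[OF this] obtain U where "x \<in> U" "Ck_on (Suc k) (U \<inter> S) f" by blast
    then show "f differentiable at x" using \<open>x \<in> S\<close> by simp
  next
    fix v
    show "Ck_on k S (\<lambda>x. frechet_derivative f (at x) v)"
    proof (rule Suc.IH)
      fix x assume "x \<in> S"
      from Suc.prems[OF this] obtain U where "open U" "x \<in> U" "Ck_on (Suc k) (U \<inter> S) f" by blast
      then show "\<exists>U. open U \<and> x \<in> U \<and> Ck_on k (U \<inter> S) (\<lambda>x. frechet_derivative f (at x) v)"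
        by (intro exI[of _ U]) simp
    qed
  qed
qed

section \<open>Symmetry of second derivatives\<close>

lemma Ck_on_inner_eq:
  fixes f :: "'a::euclidean_space \<Rightarrow> 'b::euclidean_space"
  assumes "(f has_derivative f') (at x)"
  shows "frechet_derivative (\<lambda>x. f x \<bullet> b) (at x) = (\<lambda>v. f' v \<bullet> b)"
  using assms by (intro frechet_derivative_at[symmetric]) (auto intro!: derivative_eq_intros)

text \<open>Two applications of the mean value theorem: along \<open>u\<close> to the difference of
  two parallel slices, then along \<open>v\<close> to the resulting derivative.\<close>

lemma second_difference:
  fixes f :: "'a::euclidean_space \<Rightarrow> real"
  assumes C: "Ck_on 2 (ball x \<rho>) f" and h: "h > 0" "h * (norm u + norm v) < \<rho>"
  shows "\<exists>y. dist y x \<le> h * (norm u + norm v) \<and>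
    f (x + h *\<^sub>R u + h *\<^sub>R v) - f (x + h *\<^sub>R u) - f (x + h *\<^sub>R v) + f x
     = h\<^sup>2 * frechet_derivative (\<lambda>x. frechet_derivative f (at x) u) (at y) v"
proof -
  let ?fu = "\<lambda>x. frechet_derivative f (at x) u"
  have C': "Ck_on (Suc (Suc 0)) (ball x \<rho>) f" using C by (simp add: numeral_2_eq_2)
  have inb: "dist (x + s *\<^sub>R u + t *\<^sub>R v) x \<le> h * (norm u + norm v)" if "0 \<le> s" "s \<le> h" "0 \<le> t" "t \<le> h" for s t
  proof -
    have "norm (s *\<^sub>R u + t *\<^sub>R v) \<le> s * norm u + t * norm v"
      using that norm_triangle_ineq[of "s *\<^sub>R u" "t *\<^sub>R v"] by simp
    also have "\<dots> \<le> h * norm u + h * norm v"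
      using that by (intro add_mono mult_right_mono) auto
    finally show ?thesis by (simp add: dist_norm algebra_simps)
  qed
  have mem: "x + s *\<^sub>R u + t *\<^sub>R v \<in> ball x \<rho>" if "0 \<le> s" "s \<le> h" "0 \<le> t" "t \<le> h" for s t
    using inb[OF that] h by (simp add: dist_commute)
  have ds: "((\<lambda>s. f (x + s *\<^sub>R u + t *\<^sub>R v)) has_real_derivative ?fu (x + s *\<^sub>R u + t *\<^sub>R v)) (at s)"
    if "0 \<le> s" "s \<le> h" "0 \<le> t" "t \<le> h" for s t
  proof -
    note d = Ck_on_SucD(1)[OF C' mem[OF that]]
    have "((\<lambda>s. f (x + s *\<^sub>R u + t *\<^sub>R v)) has_derivative (\<lambda>\<sigma>. frechet_derivative f (at (x + s *\<^sub>R u + t *\<^sub>R v)) (\<sigma> *\<^sub>R u))) (at s)"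
      by (rule has_derivative_compose[of "\<lambda>s. x + s *\<^sub>R u + t *\<^sub>R v" "\<lambda>\<sigma>. \<sigma> *\<^sub>R u" s UNIV, OF _ d]) (auto intro!: derivative_eq_intros)
    then show ?thesis
      by (simp add: has_field_derivative_def linear_cmul[OF has_derivative_linear[OF d]] mult_commute_abs)
  qed
  have dt: "((\<lambda>t. ?fu (x + s *\<^sub>R u + t *\<^sub>R v)) has_real_derivative frechet_derivative ?fu (at (x + s *\<^sub>R u + t *\<^sub>R v)) v) (at t)"
    if "0 \<le> s" "s \<le> h" "0 \<le> t" "t \<le> h" for s t
  proof -
    note d = Ck_on_SucD(1)[OF Ck_on_SucD(2)[OF C', of u] mem[OF that]]
    have "((\<lambda>t. ?fu (x + s *\<^sub>R u + t *\<^sub>R v)) has_derivative (\<lambda>\<tau>. frechet_derivative ?fu (at (x + s *\<^sub>R u + t *\<^sub>R v)) (\<tau> *\<^sub>R v))) (at t)"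
      by (rule has_derivative_compose[of "\<lambda>t. x + s *\<^sub>R u + t *\<^sub>R v" "\<lambda>\<tau>. \<tau> *\<^sub>R v" t UNIV, OF _ d]) (auto intro!: derivative_eq_intros)
    then show ?thesis
      by (simp add: has_field_derivative_def linear_cmul[OF has_derivative_linear[OF d]] mult_commute_abs)
  qed
  have "\<exists>\<xi>. 0 < \<xi> \<and> \<xi> < h \<and> (f (x + h *\<^sub>R u + h *\<^sub>R v) - f (x + h *\<^sub>R u + 0 *\<^sub>R v)) - (f (x + 0 *\<^sub>R u + h *\<^sub>R v) - f (x + 0 *\<^sub>R u + 0 *\<^sub>R v))
     = (h - 0) * (?fu (x + \<xi> *\<^sub>R u + h *\<^sub>R v) - ?fu (x + \<xi> *\<^sub>R u + 0 *\<^sub>R v))"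
    by (rule MVT2[OF h(1)]) (use h in \<open>intro DERIV_diff ds; simp\<close>)
  then obtain \<xi> where \<xi>: "0 < \<xi>" "\<xi> < h" "f (x + h *\<^sub>R u + h *\<^sub>R v) - f (x + h *\<^sub>R u) - f (x + h *\<^sub>R v) + f x
     = h * (?fu (x + \<xi> *\<^sub>R u + h *\<^sub>R v) - ?fu (x + \<xi> *\<^sub>R u + 0 *\<^sub>R v))"
    by (auto simp: algebra_simps)
  have "\<exists>\<eta>. 0 < \<eta> \<and> \<eta> < h \<and> ?fu (x + \<xi> *\<^sub>R u + h *\<^sub>R v) - ?fu (x + \<xi> *\<^sub>R u + 0 *\<^sub>R v)
     = (h - 0) * frechet_derivative ?fu (at (x + \<xi> *\<^sub>R u + \<eta> *\<^sub>R v)) v"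
    by (rule MVT2[OF h(1)]) (use \<xi> in \<open>intro dt; simp\<close>)
  then obtain \<eta> where \<eta>: "0 < \<eta>" "\<eta> < h" "?fu (x + \<xi> *\<^sub>R u + h *\<^sub>R v) - ?fu (x + \<xi> *\<^sub>R u + 0 *\<^sub>R v)
     = h * frechet_derivative ?fu (at (x + \<xi> *\<^sub>R u + \<eta> *\<^sub>R v)) v"
    by auto
  show ?thesis
    using inb[of \<xi> \<eta>] \<xi> \<eta> by (intro exI[of _ "x + \<xi> *\<^sub>R u + \<eta> *\<^sub>R v"]) (simp add: power2_eq_square)
qed

text \<open>The second difference is unchanged when \<open>u\<close> and \<open>v\<close> are
  exchanged, so the two mixed derivatives coincide when taken at suitable, possibly different,
  points near \<open>x\<close>; continuity brings both points to \<open>x\<close>.\<close>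

lemma symmetric_second_derivative_real:
  fixes f :: "'a::euclidean_space \<Rightarrow> real"
  assumes S: "open S" "x \<in> S" and C: "Ck_on 2 S f"
  shows "frechet_derivative (\<lambda>x. frechet_derivative f (at x) u) (at x) v
    = frechet_derivative (\<lambda>x. frechet_derivative f (at x) v) (at x) u"
proof (rule ccontr)
  let ?D = "\<lambda>u v y. frechet_derivative (\<lambda>x. frechet_derivative f (at x) u) (at y) v"
  assume "?D u v x \<noteq> ?D v u x"
  then have e: "\<bar>?D u v x - ?D v u x\<bar> / 2 > 0" (is "?e > 0") by simp
  obtain \<rho> where \<rho>: "\<rho> > 0" "ball x \<rho> \<subseteq> S" using S openE by blast
  have C\<rho>: "Ck_on 2 (ball x \<rho>) f" using C \<rho>(2) by (rule Ck_on_subset)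
  have cont: "isCont (?D a b) x" for a b
  proof -
    have "continuous_on S (?D a b)" using C by (simp add: numeral_2_eq_2)
    then show ?thesis using S continuous_on_eq_continuous_at by blast
  qed
  obtain d where d: "d > 0" "\<And>y. dist y x < d \<Longrightarrow> \<bar>?D u v y - ?D u v x\<bar> < ?e"
    using cont[of u v] e unfolding continuous_at_eps_delta dist_real_def by blast
  obtain d' where d': "d' > 0" "\<And>y. dist y x < d' \<Longrightarrow> \<bar>?D v u y - ?D v u x\<bar> < ?e"
    using cont[of v u] e unfolding continuous_at_eps_delta dist_real_def by blast
  define m where "m = min \<rho> (min d d')"
  define N where "N = norm u + norm v + 1"
  define h where "h = m / N / 2"
  have m: "m > 0" using \<rho> d d' by (simp add: m_def)
  have n: "N > 0" using norm_ge_zero[of u] norm_ge_zero[of v] unfolding N_def by linarith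
  have h: "h > 0" using m n by (simp add: h_def)
  have hm: "h * (norm u + norm v) < m"
  proof -
    have "h * (norm u + norm v) \<le> h * N" unfolding N_def using h by (intro mult_left_mono) auto
    also have "\<dots> = m / 2" using n by (simp add: h_def)
    finally show ?thesis using m by simp
  qed
  have h\<rho>: "h * (norm u + norm v) < \<rho>" "h * (norm v + norm u) < \<rho>" using hm by (auto simp: m_def add.commute)
  obtain y where y: "dist y x < m" 
    "f (x + h *\<^sub>R u + h *\<^sub>R v) - f (x + h *\<^sub>R u) - f (x + h *\<^sub>R v) + f x = h\<^sup>2 * ?D u v y"
    using second_difference[OF C\<rho> h h\<rho>(1)] hm by (meson le_less_trans)
  obtain y' where y': "dist y' x < m" 
    "f (x + h *\<^sub>R v + h *\<^sub>R u) - f (x + h *\<^sub>R v) - f (x + h *\<^sub>R u) + f x = h\<^sup>2 * ?D v u y'"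
    using second_difference[OF C\<rho> h h\<rho>(2)] hm by (metis (no_types, lifting) add.commute le_less_trans)
  have "h\<^sup>2 * ?D u v y = h\<^sup>2 * ?D v u y'" using y(2) y'(2) by (simp add: algebra_simps)
  then have "?D u v y = ?D v u y'" using h by simp
  moreover have "\<bar>?D u v y - ?D u v x\<bar> < ?e" "\<bar>?D v u y' - ?D v u x\<bar> < ?e"
    using d(2)[of y] d'(2)[of y'] y y' by (auto simp: m_def)
  ultimately have "\<bar>?D u v y - ?D u v x\<bar> < ?e" "\<bar>?D u v y - ?D v u x\<bar> < ?e" by simp_all
  then have "\<bar>?D u v x - ?D v u x\<bar> < ?e + ?e"
    using abs_triangle_ineq4[of "?D u v y - ?D v u x" "?D u v y - ?D u v x"] by simp
  then show False by simp
qed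

lemma symmetric_second_derivative:
  fixes f :: "'a::euclidean_space \<Rightarrow> 'b::euclidean_space"
  assumes S: "open S" "x \<in> S" and C: "Ck_on 2 S f"
  shows "frechet_derivative (\<lambda>x. frechet_derivative f (at x) u) (at x) v
    = frechet_derivative (\<lambda>x. frechet_derivative f (at x) v) (at x) u"
proof (rule euclidean_eqI)
  fix b :: 'b
  have C': "Ck_on (Suc (Suc 0)) S f" using C by (simp add: numeral_2_eq_2)
  have e: "frechet_derivative (\<lambda>x. frechet_derivative (\<lambda>x. f x \<bullet> b) (at x) u) (at x) v
    = frechet_derivative (\<lambda>x. frechet_derivative f (at x) u) (at x) v \<bullet> b" for u v
  proof -
    have "((\<lambda>y. frechet_derivative f (at y) u \<bullet> b) has_derivative
       (\<lambda>v. frechet_derivative (\<lambda>x. frechet_derivative f (at x) u) (at x) v \<bullet> b)) (at x)"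
      using Ck_on_SucD(1)[OF Ck_on_SucD(2)[OF C'] S(2)] by (auto intro!: derivative_eq_intros)
    then have "((\<lambda>y. frechet_derivative (\<lambda>x. f x \<bullet> b) (at y) u) has_derivative
       (\<lambda>v. frechet_derivative (\<lambda>x. frechet_derivative f (at x) u) (at x) v \<bullet> b)) (at x)"
      by (rule has_derivative_transform_within_open[OF _ S])
        (simp add: Ck_on_inner_eq[OF Ck_on_SucD(1)[OF C']])
    from frechet_derivative_at[OF this] show ?thesis by metis
  qed
  have "Ck_on 2 S (\<lambda>x. f x \<bullet> b)"
    by (intro Ck_on_bilinear[OF S(1) bounded_bilinear_inner C] Ck_on_const)
  from symmetric_second_derivative_real[OF S this, of u v]
  show "frechet_derivative (\<lambda>x. frechet_derivative f (at x) u) (at x) v \<bullet> b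
    = frechet_derivative (\<lambda>x. frechet_derivative f (at x) v) (at x) u \<bullet> b"
    by (simp add: e)
qed

section \<open>Lipschitz bounds for smooth maps, and the Poincare lemma\<close>

lemma Ck_on_1_lipschitz_on:
  assumes g: "Ck_on (Suc 0) U g" and K: "compact K" "convex K" "K \<subseteq> U"
  shows "\<exists>L. L-lipschitz_on K g"
proof -
  let ?g' = "\<lambda>x. frechet_derivative g (at x)"
  have "\<exists>M. \<forall>x\<in>K. norm (?g' x i) \<le> M" for i
  proof -
    have "continuous_on K (\<lambda>x. ?g' x i)"
      using g K(3) by (auto intro: continuous_on_subset)
    then have "bounded ((\<lambda>x. ?g' x i) ` K)"
      using K(1) compact_continuous_image compact_imp_bounded by blast
    then show ?thesis unfolding bounded_iff by auto
  qed
  then obtain M where M: "\<And>i x. x \<in> K \<Longrightarrow> norm (?g' x i) \<le> M i" by metis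
  have on: "onorm (?g' x) \<le> (\<Sum>i\<in>Basis. \<bar>M i\<bar>)" if "x \<in> K" for x
  proof (rule onorm_le)
    fix v
    have l: "linear (?g' x)" using Ck_on_SucD(1)[OF g] that K(3) has_derivative_linear by blast
    have "?g' x v = ?g' x (\<Sum>i\<in>Basis. (v \<bullet> i) *\<^sub>R i)" by (simp add: euclidean_representation)
    also have "\<dots> = (\<Sum>i\<in>Basis. (v \<bullet> i) *\<^sub>R ?g' x i)"
      using l by (simp add: linear_sum linear_cmul)
    also have "norm \<dots> \<le> (\<Sum>i\<in>Basis. \<bar>M i\<bar> * norm v)"
    proof (rule sum_norm_le)
      fix i :: 'a assume "i \<in> Basis"
      have "\<bar>v \<bullet> i\<bar> * norm (?g' x i) \<le> norm v * \<bar>M i\<bar>"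
        using M[OF that, of i] Basis_le_norm[OF \<open>i \<in> Basis\<close>, of v] by (intro mult_mono) auto
      then show "norm ((v \<bullet> i) *\<^sub>R ?g' x i) \<le> \<bar>M i\<bar> * norm v" by (simp add: mult.commute)
    qed
    finally show "norm (?g' x v) \<le> (\<Sum>i\<in>Basis. \<bar>M i\<bar>) * norm v"
      by (simp add: sum_distrib_right)
  qed
  have "(\<Sum>i\<in>Basis. \<bar>M i\<bar>)-lipschitz_on K g"
  proof (rule lipschitz_onI)
    fix x y assume xy: "x \<in> K" "y \<in> K"
    have "(g has_derivative ?g' x) (at x within K)" if "x \<in> K" for x
      using Ck_on_SucD(1)[OF g, of x] that K(3) has_derivative_at_withinI by blast
    from differentiable_bound[OF K(2) this on xy]
    show "dist (g x) (g y) \<le> (\<Sum>i\<in>Basis. \<bar>M i\<bar>) * dist x y"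
      by (simp add: dist_norm)
  qed (simp add: sum_nonneg)
  then show ?thesis by blast
qed

lemma smooth_onE:
  assumes "smooth_on S f" "x \<in> S"
  obtains U g where "open U" "x \<in> U" "\<forall>k. Ck_on k U g" "\<forall>y\<in>U \<inter> S. g y = f y"
proof -
  from bspec[OF assms(1)[unfolded smooth_on_def] assms(2)]
  obtain U g where "open U \<and> x \<in> U \<and> (\<forall>k. Ck_on k U g) \<and> (\<forall>y\<in>U \<inter> S. g y = f y)"
    by (elim exE) (rule that)
  then show ?thesis by (intro that[of U g]) simp_all
qed

lemma smooth_on_lipschitz_on:
  fixes f :: "'a::euclidean_space \<Rightarrow> 'b::real_normed_vector"
  assumes f: "smooth_on S f" and T: "compact T" "T \<subseteq> S"
  shows "\<exists>L. L-lipschitz_on T f"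
proof -
  have "\<exists>u>0. \<exists>L. L-lipschitz_on (cball x u \<inter> T) f" if x: "x \<in> T" for x
  proof -
    obtain U g where U: "open U" "x \<in> U" "\<forall>k. Ck_on k U g" "\<forall>y\<in>U \<inter> S. g y = f y"
      by (rule smooth_onE[OF f subsetD[OF T(2) x]]) (rule that)
    obtain u where u: "u > 0" "cball x u \<subseteq> U" using U(1,2) open_contains_cball by blast
    obtain L where "L-lipschitz_on (cball x u) g"
      using Ck_on_1_lipschitz_on[OF U(3)[rule_format] compact_cball convex_cball u(2)] by blast
    then have "L-lipschitz_on (cball x u \<inter> T) g" by (rule lipschitz_on_subset) simp
    then have "L-lipschitz_on (cball x u \<inter> T) f"
      by (rule lipschitz_on_transform) (use U(4) u(2) T(2) in \<open>auto simp: subset_iff\<close>)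
    then show ?thesis using u(1) by blast
  qed
  \<comment> \<open>\<open>T\<close> need not be convex, so the local extensions give Lipschitz
    constants only on small balls, and compactness makes them global. The one-point time set
    \<open>{0}\<close> is a dummy parameter.\<close>
  then have "local_lipschitz {0::real} T (\<lambda>_. f)"
    by (intro local_lipschitzI) blast
  then show ?thesis
    using local_lipschitz_compact_implies_lipschitz[OF _ T(1) compact_sing[of "0::real"], of "\<lambda>_. f"] by auto
qed

lemma smooth_on_imp_continuous_on:
  assumes "smooth_on S f"
  shows "continuous_on S f"
  unfolding continuous_on_eq_continuous_within
proof
  fix x assume x: "x \<in> S"
  obtain U g where U: "open U" "x \<in> U" "\<forall>k. Ck_on k U g" "\<forall>y\<in>U \<inter> S. g y = f y"
    by (rule smooth_onE[OF assms x]) (rule that)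
  have "continuous (at x) g" using U(1,2) U(3)[rule_format, of 0] by (simp add: continuous_on_eq_continuous_at)
  then have "(g \<longlongrightarrow> g x) (at x within S)"
    using continuous_at_imp_continuous_at_within continuous_within by blast
  moreover have "\<forall>\<^sub>F y in at x within S. g y = f y"
    unfolding eventually_at_topological using U(1,2,4) by blast
  ultimately have "(f \<longlongrightarrow> g x) (at x within S)"
    using tendsto_cong by metis
  then show "continuous (at x within S) f"
    using U(2,4) x by (simp add: continuous_within)
qed

lemma smooth_on_imp_Ck_on:
  assumes f: "smooth_on S f" and O: "open W" "W \<subseteq> S"
  shows "Ck_on k W f"
proof (rule Ck_on_local[OF O(1)])
  fix x assume x: "x \<in> W"
  obtain U g where U: "open U" "x \<in> U" "\<forall>k. Ck_on k U g" "\<forall>y\<in>U \<inter> S. g y = f y"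
    by (rule smooth_onE[OF f subsetD[OF O(2) x]]) (rule that)
  have "Ck_on k (U \<inter> W) g" using U(3)[rule_format] by (rule Ck_on_subset) simp
  moreover have "Ck_on k (U \<inter> W) g \<longleftrightarrow> Ck_on k (U \<inter> W) f"
    by (rule Ck_on_cong) (use U O in auto)
  ultimately show "\<exists>U. open U \<and> x \<in> U \<and> Ck_on k (U \<inter> W) f" using U by blast
qed

text \<open>The primitive at \<open>z\<close> is the integral of
  \<open>\<beta> (t *\<^sub>R z) z\<close> over \<open>t\<close> in the unit interval; convexity of
  \<open>N\<close> keeps the segment from 0 inside.\<close>

lemma Poincare_one_forms:
  fixes \<beta> :: "'a::euclidean_space \<Rightarrow> 'a \<Rightarrow> real"
  assumes N: "open N" "convex N" "0 \<in> N"
    and lin: "\<And>z. z \<in> N \<Longrightarrow> linear (\<beta> z)"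
    and C1: "\<And>\<zeta>. Ck_on (Suc 0) N (\<lambda>z. \<beta> z \<zeta>)"
    and closed: "\<And>z \<zeta> \<zeta>'. z \<in> N \<Longrightarrow> frechet_derivative (\<lambda>z. \<beta> z \<zeta>) (at z) \<zeta>' = frechet_derivative (\<lambda>z. \<beta> z \<zeta>') (at z) \<zeta>"
  obtains R where "\<And>z. z \<in> N \<Longrightarrow> (R has_derivative \<beta> z) (at z)"
proof -
  let ?D = "\<lambda>z \<zeta>. frechet_derivative (\<lambda>z. \<beta> z \<zeta>) (at z)"
  have tN: "t *\<^sub>R z \<in> N" if "z \<in> N" "0 \<le> t" "t \<le> 1" for z t
    using convexD[OF N(2,3) that(1), of "1 - t" t] that by simp
  have rep: "\<beta> z \<zeta> = (\<Sum>i\<in>Basis. (\<zeta> \<bullet> i) * \<beta> z i)" if "z \<in> N" for z \<zeta>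
  proof -
    have "\<beta> z \<zeta> = \<beta> z (\<Sum>i\<in>Basis. (\<zeta> \<bullet> i) *\<^sub>R i)" by (simp add: euclidean_representation)
    also have "\<dots> = (\<Sum>i\<in>Basis. (\<zeta> \<bullet> i) * \<beta> z i)"
      using lin[OF that] by (simp add: linear_sum linear_cmul)
    finally show ?thesis .
  qed
  have D: "((\<lambda>z. \<beta> z \<zeta>) has_derivative ?D z \<zeta>) (at z)" if "z \<in> N" for z \<zeta>
    using Ck_on_SucD(1)[OF C1 that] .
  have contD: "continuous_on N (\<lambda>z. ?D z \<zeta> \<zeta>')" for \<zeta> \<zeta>' using C1[of \<zeta>] by simp
  have cont\<beta>: "continuous_on N (\<lambda>z. \<beta> z \<zeta>)" for \<zeta> using C1[of \<zeta>] by (rule Ck_on_imp_continuous_on)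
  define F where "F z t = (\<Sum>i\<in>Basis. (z \<bullet> i) * \<beta> (t *\<^sub>R z) i)" for z t
  define F' where "F' z t \<zeta> = (\<Sum>i\<in>Basis. (z \<bullet> i) * ?D (t *\<^sub>R z) i (t *\<^sub>R \<zeta>) + (\<zeta> \<bullet> i) * \<beta> (t *\<^sub>R z) i)" for z t \<zeta>
  have dF: "((\<lambda>z. F z t) has_derivative F' z t) (at z within N)" if "z \<in> N" "t \<in> cbox 0 1" for z t
  proof -
    have "((\<lambda>z. \<beta> (t *\<^sub>R z) i) has_derivative (\<lambda>\<zeta>. ?D (t *\<^sub>R z) i (t *\<^sub>R \<zeta>))) (at z within N)" for i
      by (rule has_derivative_compose[of "\<lambda>z. t *\<^sub>R z" "\<lambda>\<zeta>. t *\<^sub>R \<zeta>" z N, OF _ D])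
        (use that tN in \<open>auto intro!: derivative_eq_intros\<close>)
    then show ?thesis
      unfolding F_def F'_def by (auto intro!: derivative_eq_intros)
  qed
  have bl: "bounded_linear (F' z t)" if "z \<in> N" "t \<in> cbox 0 1" for z t
    using dF[OF that] by (rule has_derivative_bounded_linear)
  have ap: "blinfun_apply (Blinfun (F' z t)) = F' z t" if "z \<in> N" "t \<in> cbox 0 1" for z t
    using bounded_linear_Blinfun_apply[OF bl[OF that]] .
  have contT: "continuous_on (N \<times> cbox 0 1) (\<lambda>p. g (snd p *\<^sub>R fst p))" if "continuous_on N g" for g :: "'a \<Rightarrow> real"
    by (rule continuous_on_compose2[OF that]) (use tN in \<open>auto intro!: continuous_intros\<close>)
  have "continuous_on (N \<times> cbox 0 1) (\<lambda>p. blinfun_apply (Blinfun (F' (fst p) (snd p))) j)" for j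
  proof -
    have "?D (t *\<^sub>R z) i (t *\<^sub>R j) = t * ?D (t *\<^sub>R z) i j" if "z \<in> N" "t \<in> cbox 0 1" for z t i
      using linear_cmul[OF has_derivative_linear[OF D[OF tN[OF that(1)]]]] that(2) by simp
    then have eq: "blinfun_apply (Blinfun (F' (fst p) (snd p))) j =
      (\<Sum>i\<in>Basis. (fst p \<bullet> i) * (snd p * ?D (snd p *\<^sub>R fst p) i j) + (j \<bullet> i) * \<beta> (snd p *\<^sub>R fst p) i)"
      if "p \<in> N \<times> cbox 0 1" for p
      using that ap by (auto simp: F'_def)
    have "continuous_on (N \<times> cbox 0 1) (\<lambda>p. \<Sum>i\<in>Basis. (fst p \<bullet> i) * (snd p * ?D (snd p *\<^sub>R fst p) i j) + (j \<bullet> i) * \<beta> (snd p *\<^sub>R fst p) i)"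
      by (intro continuous_intros contT contD cont\<beta>)
    then show ?thesis using eq by (simp cong: continuous_on_cong)
  qed
  then have "continuous_on (N \<times> cbox 0 1) (\<lambda>p. Blinfun (F' (fst p) (snd p)))"
    by (intro continuous_on_blinfun_componentwise) simp
  then have cF': "continuous_on (N \<times> cbox 0 1) (\<lambda>(z, t). Blinfun (F' z t))"
    by (simp add: case_prod_beta)
  have Fint: "F z integrable_on cbox 0 1" if "z \<in> N" for z
  proof (rule integrable_continuous)
    have "continuous_on (cbox 0 1) (\<lambda>t. \<beta> (t *\<^sub>R z) i)" for i
      by (rule continuous_on_compose2[OF cont\<beta>[of i]]) (use tN that in \<open>auto intro!: continuous_intros\<close>)
    then show "continuous_on (cbox 0 1) (F z)"
      unfolding F_def by (intro continuous_intros)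
  qed
  have "((\<lambda>z. integral (cbox 0 1) (F z)) has_derivative \<beta> z) (at z)" if z: "z \<in> N" for z
  proof -
    have "((\<lambda>z. integral (cbox 0 1) (F z)) has_derivative integral (cbox 0 1) (\<lambda>t. Blinfun (F' z t))) (at z within N)"
      by (rule leibniz_rule[where fx = "\<lambda>z t. Blinfun (F' z t)", OF _ Fint cF' z N(2)]) (use dF ap in simp)
    moreover have "blinfun_apply (integral (cbox 0 1) (\<lambda>t. Blinfun (F' z t))) = \<beta> z"
    proof
      fix \<zeta>
      have ci: "continuous_on (cbox 0 1) (\<lambda>t. Blinfun (F' z t))"
      proof -
        have "continuous_on (cbox 0 1) (\<lambda>t. (\<lambda>(z, t). Blinfun (F' z t)) (z, t))"
          by (rule continuous_on_compose2[OF cF']) (use z in \<open>auto intro!: continuous_intros\<close>)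
        then show ?thesis by simp
      qed
      have "blinfun_apply (integral (cbox 0 1) (\<lambda>t. Blinfun (F' z t))) \<zeta> = integral (cbox 0 1) (\<lambda>t. blinfun_apply (Blinfun (F' z t)) \<zeta>)"
        using integral_linear[OF integrable_continuous[OF ci] blinfun.bounded_linear_left[of \<zeta>]]
        by (simp add: o_def)
      also have "\<dots> = integral {0..1} (\<lambda>t. F' z t \<zeta>)"
        unfolding cbox_interval by (rule integral_cong) (simp add: ap[OF z])
      \<comment> \<open>Closedness exchanges the two slots of the derivative of
        \<open>\<beta>\<close>, which makes the integrand the exact derivative of
        \<open>t * \<beta> (t *\<^sub>R z) \<zeta>\<close>.\<close>
      also have "\<dots> = 1 * \<beta> (1 *\<^sub>R z) \<zeta> - 0 * \<beta> (0 *\<^sub>R z) \<zeta>"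
      proof (rule integral_unique[OF fundamental_theorem_of_calculus])
        fix t :: real assume t: "t \<in> {0..1}"
        have tz: "t *\<^sub>R z \<in> N" using tN[OF z] t by simp
        have "((\<lambda>t. \<beta> (t *\<^sub>R z) \<zeta>) has_derivative (\<lambda>s. ?D (t *\<^sub>R z) \<zeta> (s *\<^sub>R z))) (at t within {0..1})"
          by (rule has_derivative_compose[of "\<lambda>t. t *\<^sub>R z" "\<lambda>s. s *\<^sub>R z" t, OF _ D[OF tz]]) (auto intro!: derivative_eq_intros)
        then have "((\<lambda>t. t * \<beta> (t *\<^sub>R z) \<zeta>) has_derivative (\<lambda>s. t * ?D (t *\<^sub>R z) \<zeta> (s *\<^sub>R z) + s * \<beta> (t *\<^sub>R z) \<zeta>)) (at t within {0..1})"
          by (auto intro!: derivative_eq_intros)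
        moreover have "t * ?D (t *\<^sub>R z) \<zeta> (s *\<^sub>R z) + s * \<beta> (t *\<^sub>R z) \<zeta> = s * F' z t \<zeta>" for s
        proof -
          have lD: "linear (?D (t *\<^sub>R z) i)" for i using has_derivative_linear[OF D[OF tz]] .
          have "?D (t *\<^sub>R z) \<zeta> z = ?D (t *\<^sub>R z) \<zeta> (\<Sum>i\<in>Basis. (z \<bullet> i) *\<^sub>R i)"
            by (simp add: euclidean_representation)
          also have "\<dots> = (\<Sum>i\<in>Basis. (z \<bullet> i) * ?D (t *\<^sub>R z) \<zeta> i)"
            using lD by (simp add: linear_sum linear_cmul)
          also have "\<dots> = (\<Sum>i\<in>Basis. (z \<bullet> i) * ?D (t *\<^sub>R z) i \<zeta>)"
            using closed[OF tz] by simp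
          finally have "?D (t *\<^sub>R z) \<zeta> z = (\<Sum>i\<in>Basis. (z \<bullet> i) * ?D (t *\<^sub>R z) i \<zeta>)" .
          moreover have "F' z t \<zeta> = t * (\<Sum>i\<in>Basis. (z \<bullet> i) * ?D (t *\<^sub>R z) i \<zeta>) + \<beta> (t *\<^sub>R z) \<zeta>"
            unfolding F'_def rep[OF tz, of \<zeta>] using lD
            by (simp add: linear_cmul sum.distrib sum_distrib_left mult.left_commute)
          ultimately show ?thesis using lD[of \<zeta>] by (simp add: linear_cmul algebra_simps)
        qed
        ultimately show "((\<lambda>t. t * \<beta> (t *\<^sub>R z) \<zeta>) has_vector_derivative F' z t \<zeta>) (at t within {0..1})"
          by (simp add: has_vector_derivative_def)
      qed simp
      finally show "blinfun_apply (integral (cbox 0 1) (\<lambda>t. Blinfun (F' z t))) \<zeta> = \<beta> z \<zeta>" by simp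
    qed
    ultimately show ?thesis using at_within_open[OF z N(1)] by simp
  qed
  then show ?thesis using that by blast
qed

section \<open>Hamiltonian flows on the disc and the action\<close>

lemma Omega_le: "\<bar>Omega u v\<bar> \<le> norm u * norm v"
proof -
  have "\<bar>Omega u v\<bar> = \<bar>u \<bullet> vector [v $ 2, - v $ 1]\<bar>"
    by (simp add: Omega_def inner_vec_def sum_2)
  also have "\<dots> \<le> norm u * norm (vector [v $ 2, - v $ 1] :: real^2)"
    by (rule Cauchy_Schwarz_ineq2)
  also have "norm (vector [v $ 2, - v $ 1] :: real^2) = norm v"
    by (simp add: norm_vec_def L2_set_def sum_2 add.commute)
  finally show ?thesis .
qed

lemma bounded_bilinear_Omega: "bounded_bilinear Omega"
proof
  show "\<exists>K. \<forall>a b. norm (Omega a b) \<le> norm a * norm b * K"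
    using Omega_le by (intro exI[of _ 1]) auto
qed (auto simp: Omega_def algebra_simps)

lemma Omega_axis: "Omega (axis 1 1) (axis 2 1) = 1"
  by (simp add: Omega_def axis_def)

text \<open>With \<open>k = 2 * C + 1\<close> the function
  \<open>exp (- k * t) * (norm (u t))\<^sup>2 - e\<^sup>2 * t\<close> does not increase; the extra 1
  absorbs the cross term \<open>2 * norm (u t) * e\<close>. Squared norms are used because the norm
  is not differentiable at 0.\<close>

lemma gronwall:
  fixes u :: "real \<Rightarrow> 'a::real_inner"
  assumes T: "0 \<le> T"
    and u': "\<And>t. t \<in> {0..T} \<Longrightarrow> (u has_vector_derivative u' t) (at t within {0..T})"
    and bd: "\<And>t. t \<in> {0..T} \<Longrightarrow> norm (u' t) \<le> C * norm (u t) + e"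
    and C: "0 \<le> C"
  shows "(norm (u T))\<^sup>2 \<le> ((norm (u 0))\<^sup>2 + e\<^sup>2 * T) * exp ((2 * C + 1) * T)"
proof (cases "T = 0")
  case False
  then have T0: "0 < T" using T by simp
  define k where "k = 2 * C + 1"
  have k0: "0 < k" using C by (simp add: k_def)
  define g where "g t = exp (- k * t) * (u t \<bullet> u t) - e\<^sup>2 * t" for t
  define g' where "g' t = exp (- k * t) * (u t \<bullet> u' t + u' t \<bullet> u t) + (- k * exp (- k * t)) * (u t \<bullet> u t) - e\<^sup>2" for t
  have d: "(g has_derivative (\<lambda>h. h * g' t)) (at t within {0..T})" if "0 \<le> t" "t \<le> T" for t
  proof -
    have 1: "((\<lambda>t. u t \<bullet> u t) has_vector_derivative u t \<bullet> u' t + u' t \<bullet> u t) (at t within {0..T})"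
      using u'[of t] that bounded_bilinear.has_vector_derivative[OF bounded_bilinear_inner] by auto
    have 2: "((\<lambda>t. exp (- k * t)) has_vector_derivative - k * exp (- k * t)) (at t within {0..T})"
      unfolding has_real_derivative_iff_has_vector_derivative[symmetric]
      by (auto intro!: derivative_eq_intros)
    have 3: "((\<lambda>t. e\<^sup>2 * t) has_vector_derivative e\<^sup>2) (at t within {0..T})"
      unfolding has_real_derivative_iff_has_vector_derivative[symmetric]
      by (auto intro!: derivative_eq_intros)
    have "(g has_vector_derivative g' t) (at t within {0..T})"
      unfolding g_def g'_def
      using has_vector_derivative_diff[OF bounded_bilinear.has_vector_derivative[OF bounded_bilinear_mult 2 1] 3] by simp
    then show ?thesis by (simp add: has_vector_derivative_def)
  qed
  have neg: "g' t \<le> 0" if "t \<in> {0..T}" for t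
  proof -
    have "u t \<bullet> u' t \<le> norm (u t) * (C * norm (u t) + e)"
      using norm_cauchy_schwarz[of "u t" "u' t"] mult_left_mono[OF bd[OF that], of "norm (u t)"] by simp
    then have "2 * (u t \<bullet> u' t) \<le> 2 * C * (norm (u t))\<^sup>2 + 2 * norm (u t) * e"
      by (simp add: algebra_simps power2_eq_square)
    also have "\<dots> \<le> k * (norm (u t))\<^sup>2 + e\<^sup>2"
      using sum_squares_bound[of "norm (u t)" e] by (simp add: k_def algebra_simps)
    finally have "2 * (u t \<bullet> u' t) - k * (u t \<bullet> u t) \<le> e\<^sup>2"
      by (simp add: power2_norm_eq_inner)
    then have "exp (- k * t) * (2 * (u t \<bullet> u' t) - k * (u t \<bullet> u t)) \<le> exp (- k * t) * e\<^sup>2"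
      by (intro mult_left_mono) auto
    also have "\<dots> \<le> 1 * e\<^sup>2"
      using that k0 by (intro mult_right_mono) auto
    finally show ?thesis
      by (simp add: g'_def inner_commute algebra_simps)
  qed
  obtain t where "t \<in> {0<..<T}" "g T - g 0 = (T - 0) * g' t"
    using mvt_simple[OF T0 d] by auto
  then have "g T \<le> g 0"
    using neg[of t] T0 mult_nonneg_nonpos[of T "g' t"] by auto
  then have "exp (- k * T) * (norm (u T))\<^sup>2 \<le> (norm (u 0))\<^sup>2 + e\<^sup>2 * T"
    by (simp add: g_def power2_norm_eq_inner)
  then have "exp (k * T) * (exp (- k * T) * (norm (u T))\<^sup>2) \<le> exp (k * T) * ((norm (u 0))\<^sup>2 + e\<^sup>2 * T)"
    by (intro mult_left_mono) auto
  moreover have "exp (k * T) * (exp (- k * T) * (norm (u T))\<^sup>2) = (norm (u T))\<^sup>2"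
    by (simp add: mult.assoc[symmetric] exp_add[symmetric])
  ultimately show ?thesis unfolding k_def[symmetric] by (simp only: mult.commute)
qed simp

lemma gronwall_unit_interval:
  fixes u :: "real \<Rightarrow> 'a::real_inner"
  assumes u': "\<And>t. t \<in> {0..1} \<Longrightarrow> (u has_vector_derivative u' t) (at t within {0..1})"
    and bd: "\<And>t. t \<in> {0..1} \<Longrightarrow> norm (u' t) \<le> C * norm (u t) + e"
    and C: "0 \<le> C" and e: "0 \<le> e" and t: "t \<in> {0..1}"
  shows "norm (u t) \<le> (norm (u 0) + e) * exp (2 * C + 1)"
proof (rule power2_le_imp_le)
  have "(norm (u t))\<^sup>2 \<le> ((norm (u 0))\<^sup>2 + e\<^sup>2 * t) * exp ((2 * C + 1) * t)"
  proof (rule gronwall)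
    show "(u has_vector_derivative u' s) (at s within {0..t})" if "s \<in> {0..t}" for s
      by (rule has_vector_derivative_within_subset[OF u']) (use that t in auto)
  qed (use t bd C in auto)
  also have "\<dots> \<le> (norm (u 0) + e)\<^sup>2 * (exp (2 * C + 1))\<^sup>2"
  proof (rule mult_mono)
    have "e\<^sup>2 * t \<le> e\<^sup>2" using t by (simp add: mult_left_le)
    moreover have "0 \<le> norm (u 0) * e" using e by simp
    ultimately show "(norm (u 0))\<^sup>2 + e\<^sup>2 * t \<le> (norm (u 0) + e)\<^sup>2"
      unfolding power2_sum by linarith
    have "(2 * C + 1) * t \<le> (2 * C + 1) * 2" using t C by (intro mult_left_mono) auto
    then show "exp ((2 * C + 1) * t) \<le> (exp (2 * C + 1))\<^sup>2"
      by (simp add: exp_double[symmetric] mult.commute)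
  qed auto
  finally show "(norm (u t))\<^sup>2 \<le> ((norm (u 0) + e) * exp (2 * C + 1))\<^sup>2"
    by (simp add: power_mult_distrib)
qed (use e in auto)

text \<open>Reversing time turns the zero at \<open>T\<close> into a zero initial value. This gives
  injectivity of the flow maps without constructing an inverse flow.\<close>

lemma gronwall_backward:
  fixes u :: "real \<Rightarrow> 'a::real_inner"
  assumes u': "\<And>t. t \<in> {0..1} \<Longrightarrow> (u has_vector_derivative u' t) (at t within {0..1})"
    and bd: "\<And>t. t \<in> {0..1} \<Longrightarrow> norm (u' t) \<le> C * norm (u t)"
    and C: "0 \<le> C" and T: "T \<in> {0..1}" and uT: "u T = 0"
  shows "u 0 = 0"
proof -
  have "(norm (u (T - T)))\<^sup>2 \<le> ((norm (u (T - 0)))\<^sup>2 + 0\<^sup>2 * T) * exp ((2 * C + 1) * T)"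
  proof (rule gronwall[where u = "\<lambda>s. u (T - s)" and u' = "\<lambda>s. - u' (T - s)"])
    fix s assume s: "s \<in> {0..T}"
    have "(u has_vector_derivative u' (T - s)) (at (T - s) within (\<lambda>s. T - s) ` {0..T})"
      by (rule has_vector_derivative_within_subset[OF u']) (use s T in auto)
    moreover have "((\<lambda>s. T - s) has_vector_derivative - 1) (at s within {0..T})"
      by (auto intro!: derivative_eq_intros)
    ultimately show "((\<lambda>s. u (T - s)) has_vector_derivative - u' (T - s)) (at s within {0..T})"
      using vector_diff_chain_within[of "\<lambda>s. T - s" "-1" s "{0..T}" u "u' (T - s)"] by (simp add: o_def)
    show "norm (- u' (T - s)) \<le> C * norm (u (T - s)) + 0"
      using bd[of "T - s"] s T by simp
  qed (use T C in auto)
  then show ?thesis using uT by simp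
qed

text \<open>What the analysis uses of a compactly supported Hamiltonian flow, with constants uniform
  in time. \<open>X'\<close> plays the role of the spatial derivative of \<open>X\<close>; the
  Taylor remainders \<open>X_diff\<close> and \<open>H_diff\<close> are uniform up to the boundary
  of the disc. \<open>H_diff\<close> encodes \<open>dH = \<Omega>(X, .)\<close>, and
  \<open>Omega_X'\<close> says that the linearised field is infinitesimally symplectic.\<close>

locale disc_flow =
  fixes X :: "real \<Rightarrow> real^2 \<Rightarrow> real^2" and X' :: "real \<Rightarrow> real^2 \<Rightarrow> real^2 \<Rightarrow> real^2"
    and H :: "real \<Rightarrow> real^2 \<Rightarrow> real" and \<Phi> :: "real \<Rightarrow> real^2 \<Rightarrow> real^2" and C r :: real
  assumes r: "0 \<le> r" "r < 1" and C: "0 \<le> C"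
    and X_lipschitz: "\<And>t x y. t \<in> {0..1} \<Longrightarrow> x \<in> D2 \<Longrightarrow> y \<in> D2 \<Longrightarrow> norm (X t x - X t y) \<le> C * norm (x - y)"
    and H_lipschitz: "\<And>t x y. t \<in> {0..1} \<Longrightarrow> x \<in> D2 \<Longrightarrow> y \<in> D2 \<Longrightarrow> \<bar>H t x - H t y\<bar> \<le> C * norm (x - y)"
    and linear_X': "\<And>t x. t \<in> {0..1} \<Longrightarrow> x \<in> D2 \<Longrightarrow> linear (X' t x)"
    and X'_le: "\<And>t x v. t \<in> {0..1} \<Longrightarrow> x \<in> D2 \<Longrightarrow> norm (X' t x v) \<le> C * norm v"
    and X_diff: "\<And>e. 0 < e \<Longrightarrow> \<exists>d>0. \<forall>t\<in>{0..1}. \<forall>x\<in>D2. \<forall>y\<in>D2. norm (y - x) < d \<longrightarrow>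
       norm (X t y - X t x - X' t x (y - x)) \<le> e * norm (y - x)"
    and H_diff: "\<And>e. 0 < e \<Longrightarrow> \<exists>d>0. \<forall>t\<in>{0..1}. \<forall>x\<in>D2. \<forall>y\<in>D2. norm (y - x) < d \<longrightarrow>
       \<bar>H t y - H t x - Omega (X t x) (y - x)\<bar> \<le> e * norm (y - x)"
    and Omega_X': "\<And>t x u v. t \<in> {0..1} \<Longrightarrow> x \<in> D2 \<Longrightarrow> Omega (X' t x u) v + Omega u (X' t x v) = 0"
    and X_supp: "\<And>t x. t \<in> {0..1} \<Longrightarrow> x \<in> D2 \<Longrightarrow> r < norm x \<Longrightarrow> X t x = 0"
    and H_supp: "\<And>t x. t \<in> {0..1} \<Longrightarrow> x \<in> D2 \<Longrightarrow> r < norm x \<Longrightarrow> H t x = 0"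
    and X_cont: "continuous_on ({0..1} \<times> D2) (\<lambda>(t, x). X t x)"
    and H_cont: "continuous_on ({0..1} \<times> D2) (\<lambda>(t, x). H t x)"
    and \<Phi>_0: "\<And>x. x \<in> D2 \<Longrightarrow> \<Phi> 0 x = x"
    and \<Phi>_D2: "\<And>t x. t \<in> {0..1} \<Longrightarrow> x \<in> D2 \<Longrightarrow> \<Phi> t x \<in> D2"
    and \<Phi>_deriv: "\<And>t x. t \<in> {0..1} \<Longrightarrow> x \<in> D2 \<Longrightarrow>
       ((\<lambda>s. \<Phi> s x) has_vector_derivative X t (\<Phi> t x)) (at t within {0..1})"
begin

abbreviation "K \<equiv> exp (2 * C + 1)"

lemma \<Phi>_lipschitz:
  assumes "t \<in> {0..1}" "x \<in> D2" "y \<in> D2"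
  shows "norm (\<Phi> t x - \<Phi> t y) \<le> K * norm (x - y)"
  using gronwall_unit_interval[OF has_vector_derivative_diff[OF \<Phi>_deriv[OF _ assms(2)] \<Phi>_deriv[OF _ assms(3)]], of C 0 t]
    X_lipschitz \<Phi>_D2 assms C by (simp add: \<Phi>_0 mult.commute)

lemma \<Phi>_inj: "t \<in> {0..1} \<Longrightarrow> inj_on (\<Phi> t) D2"
proof (rule inj_onI)
  fix x y assume t: "t \<in> {0..1}" and xy: "x \<in> D2" "y \<in> D2" "\<Phi> t x = \<Phi> t y"
  have "\<Phi> 0 x - \<Phi> 0 y = 0"
    using gronwall_backward[OF has_vector_derivative_diff[OF \<Phi>_deriv[OF _ xy(1)] \<Phi>_deriv[OF _ xy(2)]], of C t]
      X_lipschitz \<Phi>_D2 xy t C by simp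
  then show "x = y" using xy by (simp add: \<Phi>_0)
qed

lemma \<Phi>_outside:
  assumes "x \<in> D2" "r < norm x" "t \<in> {0..1}"
  shows "\<Phi> t x = x"
proof -
  have "norm (\<Phi> t x - x) \<le> (norm (\<Phi> 0 x - x) + 0) * K"
  proof (rule gronwall_unit_interval[where u = "\<lambda>t. \<Phi> t x - x" and u' = "\<lambda>t. X t (\<Phi> t x)"])
    fix s :: real assume s: "s \<in> {0..1}"
    show "((\<lambda>t. \<Phi> t x - x) has_vector_derivative X s (\<Phi> s x)) (at s within {0..1})"
      using has_vector_derivative_diff[OF \<Phi>_deriv[OF s assms(1)] has_vector_derivative_const[of x]] by simp
    show "norm (X s (\<Phi> s x)) \<le> C * norm (\<Phi> s x - x) + 0"
      using X_lipschitz[OF s \<Phi>_D2[OF s assms(1)] assms(1)] X_supp[OF s assms(1,2)] by simp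
  qed (use C assms in auto)
  then show ?thesis using \<Phi>_0 assms(1) by simp
qed

lemma \<Phi>_t_cont: "x \<in> D2 \<Longrightarrow> continuous_on {0..1} (\<lambda>t. \<Phi> t x)"
  using \<Phi>_deriv has_vector_derivative_continuous by (fastforce simp: continuous_on_eq_continuous_within)

lemma \<Phi>_cont: "continuous_on ({0..1} \<times> D2) (\<lambda>(t, x). \<Phi> t x)"
proof (rule continuous_on_TimesI)
  show "local_lipschitz {0..1} D2 \<Phi>"
  proof (rule local_lipschitzI)
    fix t :: real and x :: "real^2" assume "t \<in> {0..1}" "x \<in> D2"
    have "K-lipschitz_on (cball x 1 \<inter> D2) (\<Phi> s)" if "s \<in> cball t 1 \<inter> {0..1}" for s
      using \<Phi>_lipschitz that by (intro lipschitz_onI) (auto simp: dist_norm)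
    then show "\<exists>u>0. \<exists>L. \<forall>s\<in>cball t u \<inter> {0..1}. L-lipschitz_on (cball x u \<inter> D2) (\<Phi> s)"
      by (intro exI[of _ 1] conjI exI[of _ K]) auto
  qed
qed (rule \<Phi>_t_cont)

text \<open>The variational equation along a trajectory is solved by the limit of the difference
  quotients of the flow, which form a uniform Cauchy sequence by Gronwall's inequality.\<close>

lemma variational_solution:
  assumes x: "x \<in> ball 0 1"
  shows "\<exists>m. m 0 = v \<and> (\<forall>t\<in>{0..1}. (m has_vector_derivative X' t (\<Phi> t x) (m t)) (at t within {0..1}))"
proof -
  have xD: "x \<in> D2" using x by (simp add: D2_def)
  \<comment> \<open>This scale keeps \<open>x + h n *\<^sub>R v\<close> in the disc for every
    \<open>n\<close>; the summand 1 covers \<open>v = 0\<close>.\<close>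
  define c where "c = (1 - norm x) / (norm v + 1)"
  have c: "c > 0" using x by (simp add: c_def add_nonneg_pos)
  have cv: "c * norm v \<le> 1 - norm x"
  proof -
    have "c * norm v \<le> c * (norm v + 1)" using c by simp
    also have "\<dots> = 1 - norm x" using norm_ge_zero[of v] by (simp add: c_def add_nonneg_eq_0_iff)
    finally show ?thesis .
  qed
  define h where "h n = c / real (Suc n)" for n
  have h0: "h n > 0" and hc: "h n \<le> c" for n
    using c by (auto simp: h_def divide_le_eq)
  have hlim: "h \<longlonglongrightarrow> 0" unfolding h_def
    using tendsto_mult_left[OF LIMSEQ_inverse_real_of_nat, of c] by (simp add: divide_inverse)
  have yD: "x + h n *\<^sub>R v \<in> D2" for n
  proof -
    have "norm (x + h n *\<^sub>R v) \<le> norm x + h n * norm v"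
      using norm_triangle_ineq[of x "h n *\<^sub>R v"] h0[of n] by simp
    also have "\<dots> \<le> norm x + c * norm v" using hc[of n] by (simp add: mult_right_mono)
    finally show ?thesis using cv by (simp add: D2_def)
  qed
  define L where "L t = X' t (\<Phi> t x)" for t
  define D where "D n t = (\<Phi> t (x + h n *\<^sub>R v) - \<Phi> t x) /\<^sub>R h n" for n t
  define D' where "D' n t = (X t (\<Phi> t (x + h n *\<^sub>R v)) - X t (\<Phi> t x)) /\<^sub>R h n" for n t
  have lL: "linear (L t)" and Lb: "norm (L t w) \<le> C * norm w" if "t \<in> {0..1}" for t w
    unfolding L_def using linear_X'[OF that \<Phi>_D2[OF that xD]] X'_le[OF that \<Phi>_D2[OF that xD]] by auto
  have dD: "(D n has_vector_derivative D' n t) (at t within {0..1})" if "t \<in> {0..1}" for n t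
    unfolding D_def D'_def
    by (rule bounded_linear.has_vector_derivative[OF bounded_linear_scaleR_right has_vector_derivative_diff[OF \<Phi>_deriv[OF that yD] \<Phi>_deriv[OF that xD]]])
  have D0: "D n 0 = v" for n
    using h0[of n] by (simp add: D_def \<Phi>_0 xD yD)
  \<comment> \<open>The difference quotients solve the variational equation up to an error that is
    small uniformly in \<open>t\<close>: the remainder of \<open>X\<close> is uniform, and
    trajectories started \<open>h n * norm v\<close> apart stay within \<open>K\<close> times that
    distance.\<close>
  have quot: "\<exists>N. \<forall>n\<ge>N. \<forall>t\<in>{0..1}. norm (D' n t - L t (D n t)) \<le> e" if e: "e > 0" for e
  proof -
    define e' where "e' = e / (K * (norm v + 1))"
    have nv: "norm v + 1 > 0" by (simp add: add_nonneg_pos)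
    then have p: "K * (norm v + 1) > 0" by simp
    have e': "e' > 0" using e p by (simp add: e'_def)
    obtain d where d: "d > 0" "\<And>t x y. t \<in> {0..1} \<Longrightarrow> x \<in> D2 \<Longrightarrow> y \<in> D2 \<Longrightarrow> norm (y - x) < d \<Longrightarrow>
       norm (X t y - X t x - X' t x (y - x)) \<le> e' * norm (y - x)"
      using X_diff[OF e'] by blast
    have "(\<lambda>n. K * (h n * norm v)) \<longlonglongrightarrow> K * (0 * norm v)" by (intro tendsto_intros hlim)
    then have "\<forall>\<^sub>F n in sequentially. K * (h n * norm v) < d"
      by (rule order_tendstoD(2)) (use d(1) in simp)
    then obtain N where N: "\<And>n. n \<ge> N \<Longrightarrow> K * (h n * norm v) < d"
      by (auto simp: eventually_sequentially)
    have "norm (D' n t - L t (D n t)) \<le> e" if n: "n \<ge> N" and t: "t \<in> {0..1}" for n t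
    proof -
      let ?y = "\<Phi> t (x + h n *\<^sub>R v)" and ?x = "\<Phi> t x"
      have l: "norm (?y - ?x) \<le> K * (h n * norm v)"
        using \<Phi>_lipschitz[OF t yD xD, of n] h0[of n] by simp
      have "norm (X t ?y - X t ?x - L t (?y - ?x)) \<le> e' * norm (?y - ?x)"
        unfolding L_def using d(2)[OF t \<Phi>_D2[OF t xD] \<Phi>_D2[OF t yD]] l N[OF n] by simp
      also have "\<dots> \<le> e' * (K * (h n * norm v))" using l e' by (intro mult_left_mono) auto
      also have "\<dots> \<le> h n * (e' * (K * (norm v + 1)))" using e' h0[of n] by (simp add: algebra_simps)
      also have "\<dots> = h n * e" unfolding e'_def using nv by simp
      finally have "norm (X t ?y - X t ?x - L t (?y - ?x)) / h n \<le> e"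
        using h0[of n] by (simp add: divide_le_eq mult.commute)
      moreover have "D' n t - L t (D n t) = (X t ?y - X t ?x - L t (?y - ?x)) /\<^sub>R h n"
        unfolding D'_def D_def linear_cmul[OF lL[OF t]] by (simp add: scaleR_diff_right)
      ultimately show ?thesis using h0[of n] by (simp add: divide_inverse mult.commute)
    qed
    then show ?thesis by blast
  qed
  have "uniformly_Cauchy_on {0..1} D"
    unfolding uniformly_Cauchy_on_def
  proof (intro allI impI)
    fix e :: real assume e: "e > 0"
    define e' where "e' = e / (4 * K)"
    have e': "e' > 0" using e by (simp add: e'_def)
    obtain N where N: "\<And>n t. n \<ge> N \<Longrightarrow> t \<in> {0..1} \<Longrightarrow> norm (D' n t - L t (D n t)) \<le> e'"
      using quot[OF e'] by blast
    have "dist (D m t) (D n t) < e" if t: "t \<in> {0..1}" and m: "m \<ge> N" and n: "n \<ge> N" for t m n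
    proof -
      have "norm (D m t - D n t) \<le> (norm (D m 0 - D n 0) + 2 * e') * K"
      proof (rule gronwall_unit_interval[OF has_vector_derivative_diff[OF dD dD] _ C])
        fix s :: real assume s: "s \<in> {0..1}"
        have "D' m s - D' n s = L s (D m s - D n s) + ((D' m s - L s (D m s)) - (D' n s - L s (D n s)))"
          using lL[OF s] by (simp add: linear_diff)
        then have "norm (D' m s - D' n s) \<le> norm (L s (D m s - D n s)) + (norm (D' m s - L s (D m s)) + norm (D' n s - L s (D n s)))"
          by (metis norm_triangle_le norm_triangle_ineq4 add_left_mono)
        then show "norm (D' m s - D' n s) \<le> C * norm (D m s - D n s) + 2 * e'"
          using Lb[OF s, of "D m s - D n s"] N[OF m s] N[OF n s] by linarith
      qed (use e' t in auto)
      also have "\<dots> = e / 2" by (simp add: D0 e'_def)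
      finally show ?thesis using e by (simp add: dist_norm)
    qed
    then show "\<exists>M. \<forall>x\<in>{0..1}. \<forall>m\<ge>M. \<forall>n\<ge>M. dist (D m x) (D n x) < e" by blast
  qed
  then obtain m where m: "uniform_limit {0..1} D m sequentially"
    using Cauchy_uniformly_convergent uniformly_convergent_on_def by blast
  have nle: "\<forall>\<^sub>F n in sequentially. \<forall>t\<in>{0..1}. \<forall>s. norm (s *\<^sub>R D' n t - s *\<^sub>R L t (m t)) \<le> e * norm s" if e: "e > 0" for e
  proof -
    have e2: "e / 2 > 0" and e3: "e / (2 * (C + 1)) > 0" using e C by auto
    have "\<forall>\<^sub>F n in sequentially. \<forall>t\<in>{0..1}. norm (D' n t - L t (D n t)) \<le> e / 2"
      using quot[OF e2] by (auto simp: eventually_sequentially)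
    moreover have "\<forall>\<^sub>F n in sequentially. \<forall>t\<in>{0..1}. dist (D n t) (m t) < e / (2 * (C + 1))"
      using uniform_limitD[OF m e3] .
    ultimately show ?thesis
    proof eventually_elim
      case (elim n)
      show ?case
      proof (intro ballI allI)
        fix t s :: real assume t: "t \<in> {0..1}"
        have "norm (L t (D n t - m t)) \<le> C * (e / (2 * (C + 1)))"
          using Lb[OF t, of "D n t - m t"] elim(2) t C
          by (smt (verit, best) dist_norm mult_left_mono)
        also have "\<dots> \<le> e / 2" using C e by (simp add: field_simps)
        finally have a: "norm (L t (D n t - m t)) \<le> e / 2" .
        have "D' n t - L t (m t) = (D' n t - L t (D n t)) + L t (D n t - m t)"
          using lL[OF t] by (simp add: linear_diff)
        then have "norm (D' n t - L t (m t)) \<le> e / 2 + e / 2"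
          using elim(1) t a by (metis norm_triangle_mono)
        then have "\<bar>s\<bar> * norm (D' n t - L t (m t)) \<le> \<bar>s\<bar> * e" by (intro mult_left_mono) auto
        then show "norm (s *\<^sub>R D' n t - s *\<^sub>R L t (m t)) \<le> e * norm s"
          by (simp add: scaleR_diff_right[symmetric] mult.commute)
      qed
    qed
  qed
  \<comment> \<open>The derivatives of \<open>D n\<close> converge uniformly to
    \<open>L t (m t)\<close>, so the limit of \<open>D n\<close> has this derivative. That limit is
    \<open>m\<close> itself, which closes the equation.\<close>
  have "\<exists>g. \<forall>t\<in>{0..1}. (\<lambda>n. D n t) \<longlonglongrightarrow> g t \<and> (g has_derivative (\<lambda>s. s *\<^sub>R L t (m t))) (at t within {0..1})"
    by (rule has_derivative_sequence[where ?x0.0 = 0 and l = v and f = D and f' = "\<lambda>n t s. s *\<^sub>R D' n t", OF _ _ nle])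
      (use dD D0 in \<open>auto simp: has_vector_derivative_def\<close>)
  then obtain g where g: "\<And>t. t \<in> {0..1} \<Longrightarrow> (\<lambda>n. D n t) \<longlonglongrightarrow> g t"
    "\<And>t. t \<in> {0..1} \<Longrightarrow> (g has_derivative (\<lambda>s. s *\<^sub>R L t (m t))) (at t within {0..1})" by blast
  have gm: "g t = m t" if "t \<in> {0..1}" for t
    using g(1)[OF that] tendsto_uniform_limitI[OF m that] LIMSEQ_unique by blast
  have "(\<lambda>n. D n 0) \<longlonglongrightarrow> g 0" by (rule g(1)) simp
  then have "g 0 = v" by (simp add: D0 LIMSEQ_const_iff)
  then show ?thesis
    using g(2) gm by (intro exI[of _ g]) (auto simp: has_vector_derivative_def L_def)
qed

end

section \<open>The derivative of the flow and of the action\<close>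

lemma abs_half_add_le:
  fixes p q s :: real
  assumes "\<bar>p\<bar> \<le> a" "\<bar>q\<bar> \<le> b" "\<bar>s\<bar> \<le> c"
  shows "\<bar>(p + q) / 2 + s\<bar> \<le> (a + b) / 2 + c"
  using assms unfolding abs_le_iff by (auto simp: field_simps)

context disc_flow
begin

text \<open>Combining the two solutions that start at the coordinate vectors makes linearity in
  \<open>v\<close> hold by construction.\<close>

lemma linearized_flow_exists:
  assumes x: "x \<in> ball 0 1"
  shows "\<exists>M. (\<forall>t. linear (M t)) \<and> (\<forall>v. M 0 v = v) \<and>
    (\<forall>v. \<forall>t\<in>{0..1}. ((\<lambda>t. M t v) has_vector_derivative X' t (\<Phi> t x) (M t v)) (at t within {0..1}))"
proof -
  obtain m1 where m1: "m1 0 = axis 1 1" "\<And>t. t \<in> {0..1} \<Longrightarrow> (m1 has_vector_derivative X' t (\<Phi> t x) (m1 t)) (at t within {0..1})"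
    using variational_solution[OF x, of "axis 1 1"] by blast
  obtain m2 where m2: "m2 0 = axis 2 1" "\<And>t. t \<in> {0..1} \<Longrightarrow> (m2 has_vector_derivative X' t (\<Phi> t x) (m2 t)) (at t within {0..1})"
    using variational_solution[OF x, of "axis 2 1"] by blast
  let ?M = "\<lambda>t v::real^2. v $ 1 *\<^sub>R m1 t + v $ 2 *\<^sub>R m2 t"
  have "x \<in> D2" using x by (simp add: D2_def)
  have "((\<lambda>t. ?M t v) has_vector_derivative X' t (\<Phi> t x) (?M t v)) (at t within {0..1})" if t: "t \<in> {0..1}" for t v
  proof -
    have "X' t (\<Phi> t x) (?M t v) = v $ 1 *\<^sub>R X' t (\<Phi> t x) (m1 t) + v $ 2 *\<^sub>R X' t (\<Phi> t x) (m2 t)"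
      using linear_X'[OF t \<Phi>_D2[OF t \<open>x \<in> D2\<close>]] by (simp add: linear_add linear_cmul)
    then show ?thesis
      using has_vector_derivative_add[OF bounded_linear.has_vector_derivative[OF bounded_linear_scaleR_right m1(2)[OF t]] bounded_linear.has_vector_derivative[OF bounded_linear_scaleR_right m2(2)[OF t]]]
      by simp
  qed
  moreover have "linear (?M t)" for t
    by (rule linearI) (auto simp: algebra_simps)
  moreover have "?M 0 v = v" for v
    by (simp add: m1 m2 vec_eq_iff forall_2 axis_def)
  ultimately show ?thesis by (intro exI[of _ ?M]) blast
qed

text \<open>The fundamental solution of the variational equation along the trajectory of
  \<open>x\<close>, later identified with the derivative of the flow. The choice is known to be a
  good one for \<open>x\<close> in the open ball.\<close>

definition M :: "real^2 \<Rightarrow> real \<Rightarrow> real^2 \<Rightarrow> real^2" where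
  "M x = (SOME M. (\<forall>t. linear (M t)) \<and> (\<forall>v. M 0 v = v) \<and>
    (\<forall>v. \<forall>t\<in>{0..1}. ((\<lambda>t. M t v) has_vector_derivative X' t (\<Phi> t x) (M t v)) (at t within {0..1})))"

lemma M:
  assumes "x \<in> ball 0 1"
  shows linear_M: "linear (M x t)" and M_0: "M x 0 v = v"
    and M_deriv: "t \<in> {0..1} \<Longrightarrow> ((\<lambda>t. M x t v) has_vector_derivative X' t (\<Phi> t x) (M x t v)) (at t within {0..1})"
  using someI_ex[OF linearized_flow_exists[OF assms]] unfolding M_def[symmetric] by blast+

lemma ball_subset_D2: "x \<in> ball 0 1 \<Longrightarrow> x \<in> D2"
  by (simp add: D2_def)

text \<open>The remainder starts at 0 and solves the variational equation up to a small multiple of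
  \<open>norm w\<close>, so Gronwall's inequality bounds it. Uniformity in \<open>t\<close> is what
  differentiating the action under the integral requires.\<close>

lemma \<Phi>_remainder:
  assumes x: "x \<in> ball 0 1" and e: "0 < e"
  shows "\<exists>d>0. \<forall>w. norm w < d \<longrightarrow> x + w \<in> D2 \<and> (\<forall>t\<in>{0..1}. norm (\<Phi> t (x + w) - \<Phi> t x - M x t w) \<le> e * norm w)"
proof -
  note xD = ball_subset_D2[OF x]
  \<comment> \<open>One factor \<open>K\<close> comes from the Lipschitz bound on the flow, the
    other from Gronwall's inequality.\<close>
  define e' where "e' = e / (K * K)"
  have e': "e' > 0" using e by (simp add: e'_def)
  obtain d where d: "d > 0" "\<And>t x y. t \<in> {0..1} \<Longrightarrow> x \<in> D2 \<Longrightarrow> y \<in> D2 \<Longrightarrow> norm (y - x) < d \<Longrightarrow>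
     norm (X t y - X t x - X' t x (y - x)) \<le> e' * norm (y - x)"
    using X_diff[OF e'] by blast
  define d' where "d' = min (1 - norm x) (d / K)"
  have "d' > 0" using d x by (simp add: d'_def)
  moreover have "x + w \<in> D2 \<and> (\<forall>t\<in>{0..1}. norm (\<Phi> t (x + w) - \<Phi> t x - M x t w) \<le> e * norm w)" if w: "norm w < d'" for w
  proof -
    have yD: "x + w \<in> D2" using w norm_triangle_ineq[of x w] by (simp add: D2_def d'_def)
    have wd: "K * norm w < d" using w by (simp add: d'_def pos_less_divide_eq mult.commute)
    have "norm (\<Phi> t (x + w) - \<Phi> t x - M x t w) \<le> e * norm w" if t: "t \<in> {0..1}" for t
    proof -
      have "norm (\<Phi> t (x + w) - \<Phi> t x - M x t w) \<le> (norm (\<Phi> 0 (x + w) - \<Phi> 0 x - M x 0 w) + e' * (K * norm w)) * K"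
      proof (rule gronwall_unit_interval[OF has_vector_derivative_diff[OF has_vector_derivative_diff[OF \<Phi>_deriv[OF _ yD] \<Phi>_deriv[OF _ xD]] M_deriv[OF x]] _ C])
        fix s :: real assume s: "s \<in> {0..1}"
        let ?y = "\<Phi> s (x + w)" and ?x = "\<Phi> s x"
        have l: "linear (X' s ?x)" using linear_X'[OF s \<Phi>_D2[OF s xD]] .
        have yx: "norm (?y - ?x) \<le> K * norm w" using \<Phi>_lipschitz[OF s yD xD] by simp
        have "norm (X s ?y - X s ?x - X' s ?x (?y - ?x)) \<le> e' * norm (?y - ?x)"
          using d(2)[OF s \<Phi>_D2[OF s xD] \<Phi>_D2[OF s yD]] yx wd by simp
        also have "\<dots> \<le> e' * (K * norm w)" using yx e' by (intro mult_left_mono) auto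
        finally have a: "norm (X s ?y - X s ?x - X' s ?x (?y - ?x)) \<le> e' * (K * norm w)" .
        have "X s ?y - X s ?x - X' s ?x (M x s w) = X' s ?x (?y - ?x - M x s w) + (X s ?y - X s ?x - X' s ?x (?y - ?x))"
          using l by (simp add: linear_diff)
        then have "norm (X s ?y - X s ?x - X' s ?x (M x s w)) \<le> norm (X' s ?x (?y - ?x - M x s w)) + norm (X s ?y - X s ?x - X' s ?x (?y - ?x))"
          by (metis norm_triangle_ineq)
        then show "norm (X s ?y - X s ?x - X' s ?x (M x s w)) \<le> C * norm (?y - ?x - M x s w) + e' * (K * norm w)"
          using X'_le[OF s \<Phi>_D2[OF s xD], of "?y - ?x - M x s w"] a by linarith
      qed (use e' t in auto)
      also have "\<dots> = e * norm w"
        using \<Phi>_0[OF yD] \<Phi>_0[OF xD] M_0[OF x] by (simp add: e'_def)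
      finally show ?thesis .
    qed
    then show ?thesis using yD by blast
  qed
  ultimately show ?thesis by blast
qed

lemma has_derivative_\<Phi>:
  assumes x: "x \<in> ball 0 1" and t: "t \<in> {0..1}"
  shows "(\<Phi> t has_derivative M x t) (at x)"
  unfolding has_derivative_at_alt
proof (intro conjI allI impI)
  show "bounded_linear (M x t)" using linear_M[OF x] by (rule linear_conv_bounded_linear[THEN iffD1])
  fix e :: real assume "0 < e"
  from \<Phi>_remainder[OF x this] obtain d where d: "d > 0" "\<And>w. norm w < d \<Longrightarrow> norm (\<Phi> t (x + w) - \<Phi> t x - M x t w) \<le> e * norm w"
    using t by blast
  show "\<exists>d>0. \<forall>y. norm (y - x) < d \<longrightarrow> norm (\<Phi> t y - \<Phi> t x - M x t (y - x)) \<le> e * norm (y - x)"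
    using d(1) d(2)[of "y - x" for y] by (intro exI[of _ d]) auto
qed

text \<open>The time derivative of the left-hand side vanishes by \<open>Omega_X'\<close>. In
  dimension two the conclusion says that the flow has Jacobian 1.\<close>

lemma Omega_M:
  assumes x: "x \<in> ball 0 1" and t: "t \<in> {0..1}"
  shows "Omega (M x t u) (M x t v) = Omega u v"
proof -
  have "((\<lambda>t. Omega (M x t u) (M x t v)) has_derivative (\<lambda>h. 0)) (at s within {0..1})" if s: "s \<in> {0..1}" for s
    using bounded_bilinear.has_vector_derivative[OF bounded_bilinear_Omega M_deriv[OF x s] M_deriv[OF x s], of u v]
      Omega_X'[OF s \<Phi>_D2[OF s ball_subset_D2[OF x]], of "M x s u" "M x s v"]
    by (simp add: has_vector_derivative_def add.commute)
  from has_derivative_zero_constant[OF _ this]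
  obtain c where "\<And>s. s \<in> {0..1} \<Longrightarrow> Omega (M x s u) (M x s v) = c" by auto
  from this[of 0] this[of t] show ?thesis using t by (simp add: M_0[OF x])
qed

text \<open>The integrand \<open>\<lambda>(X) + H\<close> of the classical action functional, for
  the rotationally symmetric primitive \<open>\<lambda>(v) = \<Omega>(x, v) / 2\<close> of the area
  form.\<close>

definition lagrangian :: "real \<Rightarrow> real^2 \<Rightarrow> real" where
  "lagrangian t x = Omega x (X t x) / 2 + H t x"

definition action :: "real^2 \<Rightarrow> real" where
  "action x = integral {0..1} (\<lambda>t. lagrangian t (\<Phi> t x))"

lemma X_le: "t \<in> {0..1} \<Longrightarrow> x \<in> D2 \<Longrightarrow> norm (X t x) \<le> 2 * C"
proof -
  assume t: "t \<in> {0..1}" and x: "x \<in> D2"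
  \<comment> \<open>A point of the unit circle, where \<open>X\<close> vanishes; no point of the
    disc is farther than 2 from it.\<close>
  have a: "axis 1 1 \<in> D2" "norm (axis 1 1 :: real^2) = 1" by (auto simp: D2_def)
  have "norm (X t x) \<le> C * norm (x - axis 1 1)"
    using X_lipschitz[OF t x a(1)] X_supp[OF t a(1)] a(2) r by simp
  also have "\<dots> \<le> C * 2"
    using norm_triangle_ineq4[of x "axis 1 1"] x a C by (intro mult_left_mono) (auto simp: D2_def)
  finally show ?thesis by simp
qed

lemma lagrangian_lipschitz:
  assumes t: "t \<in> {0..1}" and xy: "x \<in> D2" "y \<in> D2"
  shows "\<bar>lagrangian t x - lagrangian t y\<bar> \<le> 3 * C * norm (x - y)"
proof -
  interpret O: bounded_bilinear Omega by (rule bounded_bilinear_Omega)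
  have "Omega x (X t x) - Omega y (X t y) = Omega (x - y) (X t x) + Omega y (X t x - X t y)"
    by (simp add: O.diff_left O.diff_right)
  also have "\<bar>\<dots>\<bar> \<le> norm (x - y) * norm (X t x) + norm y * norm (X t x - X t y)"
    using Omega_le[of "x - y" "X t x"] Omega_le[of y "X t x - X t y"] by linarith
  also have "\<dots> \<le> norm (x - y) * (2 * C) + 1 * (C * norm (x - y))"
    using X_le[OF t xy(1)] X_lipschitz[OF t xy] xy by (intro add_mono mult_mono) (auto simp: D2_def)
  finally have 1: "\<bar>Omega x (X t x) - Omega y (X t y)\<bar> \<le> 3 * (C * norm (x - y))" by (simp add: algebra_simps)
  have eq: "lagrangian t x - lagrangian t y = ((Omega x (X t x) - Omega y (X t y)) + 0) / 2 + (H t x - H t y)"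
    by (simp add: lagrangian_def diff_divide_distrib)
  have "\<bar>lagrangian t x - lagrangian t y\<bar> \<le> (3 * (C * norm (x - y)) + 0) / 2 + C * norm (x - y)"
    unfolding eq by (rule abs_half_add_le[OF 1 _ H_lipschitz[OF t xy]]) simp
  also have "\<dots> \<le> 3 * (C * norm (x - y))" using C by (simp add: field_simps)
  finally show ?thesis by simp
qed

lemma lagrangian_cont: "continuous_on ({0..1} \<times> D2) (\<lambda>(t, x). lagrangian t x)"
proof -
  have "continuous_on ({0..1} \<times> D2) (\<lambda>p. Omega (snd p) (X (fst p) (snd p)) / 2 + H (fst p) (snd p))"
    using X_cont H_cont
    by (intro continuous_intros bounded_bilinear.continuous_on[OF bounded_bilinear_Omega]) (auto simp: case_prod_beta)
  then show ?thesis by (simp add: lagrangian_def case_prod_beta)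
qed

lemma lagrangian_flow_cont: "continuous_on ({0..1} \<times> D2) (\<lambda>(t, x). lagrangian t (\<Phi> t x))"
proof -
  have "continuous_on ({0..1} \<times> D2) (\<lambda>p. (\<lambda>(t, x). lagrangian t x) (fst p, \<Phi> (fst p) (snd p)))"
    by (rule continuous_on_compose2[OF lagrangian_cont])
      (use \<Phi>_cont \<Phi>_D2 in \<open>auto intro!: continuous_intros simp: case_prod_beta\<close>)
  then show ?thesis by (simp add: case_prod_beta)
qed

lemma lagrangian_flow_t_cont:
  assumes "x \<in> D2"
  shows "continuous_on {0..1} (\<lambda>t. lagrangian t (\<Phi> t x))"
proof -
  have "continuous_on {0..1} (\<lambda>t. (\<lambda>(t, x). lagrangian t (\<Phi> t x)) (t, x))"
    by (rule continuous_on_compose2[OF lagrangian_flow_cont]) (use assms in \<open>auto intro!: continuous_intros\<close>)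
  then show ?thesis by simp
qed

lemma lagrangian_outside: "t \<in> {0..1} \<Longrightarrow> x \<in> D2 \<Longrightarrow> r < norm x \<Longrightarrow> lagrangian t x = 0"
  by (simp add: lagrangian_def X_supp H_supp Omega_def)

lemma action_outside:
  assumes "x \<in> D2" "r < norm x"
  shows "action x = 0"
proof -
  have "action x = integral {0..1} (\<lambda>t::real. 0)"
    unfolding action_def by (rule integral_cong) (simp add: \<Phi>_outside[OF assms] lagrangian_outside[OF _ assms])
  then show ?thesis by simp
qed

lemma action_lipschitz: "(3 * C * K)-lipschitz_on D2 action"
proof (rule lipschitz_onI)
  fix x y assume xy: "x \<in> D2" "y \<in> D2"
  have "norm (integral {0..1} (\<lambda>t. lagrangian t (\<Phi> t x) - lagrangian t (\<Phi> t y))) \<le> 3 * C * K * norm (x - y) * (1 - 0)"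
  proof (rule integral_bound)
    show "continuous_on {0..1} (\<lambda>t. lagrangian t (\<Phi> t x) - lagrangian t (\<Phi> t y))"
      by (intro continuous_intros lagrangian_flow_t_cont xy)
    fix t :: real assume t: "t \<in> {0..1}"
    have "\<bar>lagrangian t (\<Phi> t x) - lagrangian t (\<Phi> t y)\<bar> \<le> 3 * C * norm (\<Phi> t x - \<Phi> t y)"
      by (rule lagrangian_lipschitz[OF t \<Phi>_D2[OF t xy(1)] \<Phi>_D2[OF t xy(2)]])
    also have "\<dots> \<le> 3 * C * (K * norm (x - y))"
      using \<Phi>_lipschitz[OF t xy] C by (intro mult_left_mono) auto
    finally show "norm (lagrangian t (\<Phi> t x) - lagrangian t (\<Phi> t y)) \<le> 3 * C * K * norm (x - y)" by simp
  qed simp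
  moreover have "integral {0..1} (\<lambda>t. lagrangian t (\<Phi> t x) - lagrangian t (\<Phi> t y)) = action x - action y"
    unfolding action_def by (intro integral_diff integrable_continuous_interval lagrangian_flow_t_cont xy)
  ultimately show "dist (action x) (action y) \<le> 3 * C * K * dist x y" by (simp add: dist_norm)
qed (use C in auto)

text \<open>Differentiating \<open>\<lambda>(X)\<close> contributes
  \<open>\<Omega>(v, X) / 2\<close>, which cancels half of \<open>dH(v) = \<Omega>(X, v)\<close>.
  What is left is the expression that becomes a total time derivative along the flow.\<close>

lemma lagrangian_remainder:
  assumes e: "0 < e"
  shows "\<exists>d>0. \<forall>t\<in>{0..1}. \<forall>x\<in>D2. \<forall>y\<in>D2. norm (y - x) < d \<longrightarrow>
    \<bar>lagrangian t y - lagrangian t x - (Omega (X t x) (y - x) + Omega x (X' t x (y - x))) / 2\<bar> \<le> e * norm (y - x)"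
proof -
  interpret O: bounded_bilinear Omega by (rule bounded_bilinear_Omega)
  have e3: "e / 3 > 0" using e by simp
  obtain d1 where d1: "d1 > 0" "\<And>t x y. t \<in> {0..1} \<Longrightarrow> x \<in> D2 \<Longrightarrow> y \<in> D2 \<Longrightarrow> norm (y - x) < d1 \<Longrightarrow>
     norm (X t y - X t x - X' t x (y - x)) \<le> e / 3 * norm (y - x)"
    using X_diff[OF e3] by blast
  obtain d2 where d2: "d2 > 0" "\<And>t x y. t \<in> {0..1} \<Longrightarrow> x \<in> D2 \<Longrightarrow> y \<in> D2 \<Longrightarrow> norm (y - x) < d2 \<Longrightarrow>
     \<bar>H t y - H t x - Omega (X t x) (y - x)\<bar> \<le> e / 3 * norm (y - x)"
    using H_diff[OF e3] by blast
  define d where "d = min (min d1 d2) (e / (3 * (C + 1)))"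
  have "d > 0" using d1 d2 e C by (simp add: d_def)
  moreover have "\<bar>lagrangian t y - lagrangian t x - (Omega (X t x) (y - x) + Omega x (X' t x (y - x))) / 2\<bar> \<le> e * norm (y - x)"
    if t: "t \<in> {0..1}" and x: "x \<in> D2" and y: "y \<in> D2" and yx: "norm (y - x) < d" for t x y
  proof -
    let ?w = "y - x" and ?R = "X t y - X t x - X' t x (y - x)"
    have id: "lagrangian t y - lagrangian t x - (Omega (X t x) ?w + Omega x (X' t x ?w)) / 2
      = (Omega ?w (X t y - X t x) + Omega x ?R) / 2 + (H t y - H t x - Omega (X t x) ?w)"
      by (simp add: lagrangian_def Omega_def field_simps)
    have b1: "\<bar>Omega ?w (X t y - X t x)\<bar> \<le> e / 3 * norm ?w"
    proof -
      have "\<bar>Omega ?w (X t y - X t x)\<bar> \<le> norm ?w * (C * norm ?w)"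
        using Omega_le[of ?w "X t y - X t x"] X_lipschitz[OF t y x] by (meson mult_left_mono norm_ge_zero order_trans)
      moreover have "C * norm ?w \<le> e / 3"
      proof -
        have "C * norm ?w \<le> C * (e / (3 * (C + 1)))" using yx C by (intro mult_left_mono) (auto simp: d_def)
        also have "\<dots> \<le> e / 3" using C e by (simp add: field_simps)
        finally show ?thesis .
      qed
      ultimately show ?thesis by (smt (verit) mult.commute mult_left_mono norm_ge_zero)
    qed
    have b2: "\<bar>Omega x ?R\<bar> \<le> e / 3 * norm ?w"
    proof -
      have "\<bar>Omega x ?R\<bar> \<le> norm x * norm ?R" by (rule Omega_le)
      also have "\<dots> \<le> 1 * (e / 3 * norm ?w)"
        using d1(2)[OF t x y] yx x by (intro mult_mono) (auto simp: d_def D2_def)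
      finally show ?thesis by simp
    qed
    have b3: "\<bar>H t y - H t x - Omega (X t x) ?w\<bar> \<le> e / 3 * norm ?w"
      using d2(2)[OF t x y] yx by (simp add: d_def)
    have "0 \<le> e * norm ?w" using e by simp
    then show ?thesis unfolding id using abs_half_add_le[OF b1 b2 b3] by (simp add: field_simps)
  qed
  ultimately show ?thesis by blast
qed

text \<open>Along a trajectory the differential of the integrand is the time derivative of
  \<open>\<Omega>(\<Phi> t x, M x t v) / 2\<close>, so its integral is a difference of endpoint
  values. This is Cartan's formula in integrated form.\<close>

lemma has_derivative_action:
  assumes x: "x \<in> ball 0 1"
  shows "(action has_derivative (\<lambda>v. (Omega (\<Phi> 1 x) (M x 1 v) - Omega x v) / 2)) (at x)"
  unfolding has_derivative_at_alt
proof (intro conjI allI impI)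
  interpret O: bounded_bilinear Omega by (rule bounded_bilinear_Omega)
  note xD = ball_subset_D2[OF x]
  have blM: "bounded_linear (M x 1)" using linear_M[OF x] by (rule linear_conv_bounded_linear[THEN iffD1])
  show "bounded_linear (\<lambda>v. (Omega (\<Phi> 1 x) (M x 1 v) - Omega x v) / 2)"
    by (intro bounded_linear_intros bounded_linear_compose[OF O.bounded_linear_right blM] O.bounded_linear_right
        bounded_linear_compose[OF bounded_linear_divide])
  fix e :: real assume e: "0 < e"
  define q where "q t w = (Omega (X t (\<Phi> t x)) (M x t w) + Omega (\<Phi> t x) (X' t (\<Phi> t x) (M x t w))) / 2" for t w
  have q: "((\<lambda>t. q t w) has_integral (Omega (\<Phi> 1 x) (M x 1 w) - Omega x w) / 2) {0..1}" for w
  proof -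
    have "((\<lambda>t. Omega (X t (\<Phi> t x)) (M x t w) + Omega (\<Phi> t x) (X' t (\<Phi> t x) (M x t w))) has_integral
       (Omega (\<Phi> 1 x) (M x 1 w) - Omega (\<Phi> 0 x) (M x 0 w))) {0..1}"
    proof (rule fundamental_theorem_of_calculus)
      fix t :: real assume t: "t \<in> {0..1}"
      show "((\<lambda>t. Omega (\<Phi> t x) (M x t w)) has_vector_derivative
         Omega (X t (\<Phi> t x)) (M x t w) + Omega (\<Phi> t x) (X' t (\<Phi> t x) (M x t w))) (at t within {0..1})"
        using O.has_vector_derivative[OF \<Phi>_deriv[OF t xD] M_deriv[OF x t]] by (simp add: add.commute)
    qed simp
    from has_integral_divide[OF this, of 2] show ?thesis
      by (simp add: q_def \<Phi>_0[OF xD] M_0[OF x])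
  qed
  \<comment> \<open>The sum of the error constants, rounded up: \<open>K\<close> from the Taylor
    remainder of the integrand at distance \<open>K * norm w\<close>, and \<open>3 * C\<close> from
    applying its differential to the remainder of the flow.\<close>
  define c where "c = 2 * K + 3 * C"
  have c: "c > 0" using C by (simp add: c_def add_pos_nonneg)
  define e' where "e' = e / c"
  have e': "e' > 0" using e c by (simp add: e'_def)
  obtain d1 where d1: "d1 > 0" "\<And>w. norm w < d1 \<Longrightarrow> x + w \<in> D2"
      "\<And>w t. norm w < d1 \<Longrightarrow> t \<in> {0..1} \<Longrightarrow> norm (\<Phi> t (x + w) - \<Phi> t x - M x t w) \<le> e' * norm w"
    using \<Phi>_remainder[OF x e'] by blast
  obtain d2 where d2: "d2 > 0" "\<And>t x y. t \<in> {0..1} \<Longrightarrow> x \<in> D2 \<Longrightarrow> y \<in> D2 \<Longrightarrow> norm (y - x) < d2 \<Longrightarrow>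
    \<bar>lagrangian t y - lagrangian t x - (Omega (X t x) (y - x) + Omega x (X' t x (y - x))) / 2\<bar> \<le> e' * norm (y - x)"
    using lagrangian_remainder[OF e'] by blast
  define d where "d = min d1 (d2 / K)"
  have "norm (action (x + w) - action x - (Omega (\<Phi> 1 x) (M x 1 w) - Omega x w) / 2) \<le> e * norm w" if w: "norm w < d" for w
  proof -
    have yD: "x + w \<in> D2" using d1(2) w by (simp add: d_def)
    have wd2: "K * norm w < d2" using w by (simp add: d_def pos_less_divide_eq mult.commute)
    define F where "F t = lagrangian t (\<Phi> t (x + w)) - lagrangian t (\<Phi> t x) - q t w" for t
    have "(F has_integral (action (x + w) - action x - (Omega (\<Phi> 1 x) (M x 1 w) - Omega x w) / 2)) {0..1}"
      unfolding F_def action_def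
      by (intro has_integral_diff q integrable_integral integrable_continuous_interval lagrangian_flow_t_cont xD yD)
    moreover have "norm (F t) \<le> e * norm w" if t: "t \<in> {0..1}" for t
    proof -
      let ?y = "\<Phi> t (x + w)" and ?x = "\<Phi> t x"
      let ?z = "?y - ?x - M x t w"
      have l: "linear (X' t ?x)" using linear_X'[OF t \<Phi>_D2[OF t xD]] .
      have xx: "norm ?x \<le> 1" using \<Phi>_D2[OF t xD] by (simp add: D2_def)
      have yx: "norm (?y - ?x) \<le> K * norm w" using \<Phi>_lipschitz[OF t yD xD] by simp
      have z: "norm ?z \<le> e' * norm w" using d1(3)[OF _ t] w by (simp add: d_def)
      have "X' t ?x ?z = X' t ?x (?y - ?x) - X' t ?x (M x t w)" using l by (rule linear_diff)
      then have id: "F t = (Omega (X t ?x) ?z + Omega ?x (X' t ?x ?z)) / 2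
        + (lagrangian t ?y - lagrangian t ?x - (Omega (X t ?x) (?y - ?x) + Omega ?x (X' t ?x (?y - ?x))) / 2)"
        unfolding F_def q_def by (simp add: O.diff_right diff_divide_distrib add_divide_distrib)
      have "\<bar>lagrangian t ?y - lagrangian t ?x - (Omega (X t ?x) (?y - ?x) + Omega ?x (X' t ?x (?y - ?x))) / 2\<bar> \<le> e' * norm (?y - ?x)"
        using d2(2)[OF t \<Phi>_D2[OF t xD] \<Phi>_D2[OF t yD]] yx wd2 by simp
      also have "\<dots> \<le> e' * (K * norm w)" using yx e' by (intro mult_left_mono) auto
      finally have b1: "\<bar>lagrangian t ?y - lagrangian t ?x - (Omega (X t ?x) (?y - ?x) + Omega ?x (X' t ?x (?y - ?x))) / 2\<bar> \<le> e' * (K * norm w)" .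
      have "\<bar>Omega (X t ?x) ?z\<bar> \<le> norm (X t ?x) * norm ?z" by (rule Omega_le)
      also have "\<dots> \<le> 2 * C * (e' * norm w)"
        using X_le[OF t \<Phi>_D2[OF t xD]] z C by (intro mult_mono) auto
      finally have b2: "\<bar>Omega (X t ?x) ?z\<bar> \<le> 2 * C * (e' * norm w)" .
      have "\<bar>Omega ?x (X' t ?x ?z)\<bar> \<le> norm ?x * norm (X' t ?x ?z)" by (rule Omega_le)
      also have "\<dots> \<le> 1 * (C * norm ?z)"
        using xx X'_le[OF t \<Phi>_D2[OF t xD]] by (intro mult_mono) auto
      also have "\<dots> \<le> C * (e' * norm w)" using z C by (simp add: mult_left_mono)
      finally have b3: "\<bar>Omega ?x (X' t ?x ?z)\<bar> \<le> C * (e' * norm w)" .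
      have "\<bar>F t\<bar> \<le> e' * (K * norm w) + (2 * C * (e' * norm w) + C * (e' * norm w)) / 2"
        unfolding id using abs_half_add_le[OF b2 b3 b1] by simp
      also have "\<dots> \<le> e' * (K * norm w) + e' * (K * norm w) + (2 * C * (e' * norm w) + C * (e' * norm w))"
        using e' C by (simp add: field_simps)
      also have "\<dots> = (e' * c) * norm w" by (simp add: c_def algebra_simps)
      also have "\<dots> = e * norm w" using c by (simp add: e'_def)
      finally show ?thesis by simp
    qed
    ultimately have "norm (action (x + w) - action x - (Omega (\<Phi> 1 x) (M x 1 w) - Omega x w) / 2) \<le> e * norm w * measure lborel (cbox (0::real) 1)"
      using e by (intro has_integral_bound[of _ F]) auto
    then show ?thesis by simp
  qed
  moreover have "d > 0" using d1 d2 by (simp add: d_def)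
  ultimately show "\<exists>d>0. \<forall>y. norm (y - x) < d \<longrightarrow>
     norm (action y - action x - (Omega (\<Phi> 1 x) (M x 1 (y - x)) - Omega x (y - x)) / 2) \<le> e * norm (y - x)"
    by (metis add.commute diff_add_cancel)
qed

end

section \<open>Area preservation and the integral of the action\<close>

lemma integrable_on_D2:
  fixes F :: "real^2 \<Rightarrow> real"
  assumes "continuous_on D2 F"
  shows "set_integrable lborel D2 F" "F absolutely_integrable_on D2"
proof -
  show 1: "set_integrable lborel D2 F"
    unfolding set_integrable_def by (rule borel_integrable_compact[OF _ assms]) (simp add: D2_def)
  then show "F absolutely_integrable_on D2"
    unfolding set_integrable_def using integrable_completion[of "\<lambda>x. indicator D2 x *\<^sub>R F x" lborel] by auto
qed

lemma integral_D2_eq_ball: "integral D2 F = integral (ball 0 1) F" for F :: "real^2 \<Rightarrow> real"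
proof (rule integral_spike_set)
  have "{x \<in> D2 - ball 0 1. F x \<noteq> 0} \<subseteq> sphere 0 1" by (auto simp: D2_def)
  then show "negligible {x \<in> D2 - ball 0 1. F x \<noteq> 0}"
    using negligible_subset negligible_sphere by blast
  have "{x \<in> ball 0 1 - D2. F x \<noteq> 0} = {}" by (auto simp: D2_def)
  then show "negligible {x \<in> ball 0 1 - D2. F x \<noteq> 0}" by (simp only: negligible_empty)
qed

text \<open>As \<open>G\<close> vanishes on the unit circle, its extension by zero is continuous on
  a box around the disc, where integrals of continuous functions may be exchanged.\<close>

lemma integrals_over_unit_interval_and_D2:
  fixes G :: "real \<Rightarrow> real^2 \<Rightarrow> real"
  assumes G: "continuous_on ({0..1} \<times> D2) (\<lambda>(t, x). G t x)"
    and G0: "\<And>t x. t \<in> {0..1} \<Longrightarrow> norm x = 1 \<Longrightarrow> G t x = 0"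
  shows "continuous_on {0..1} (\<lambda>t. integral D2 (G t))"
    and "integral {0..1} (\<lambda>t. integral D2 (G t)) = integral D2 (\<lambda>x. integral {0..1} (\<lambda>t. G t x))"
proof -
  obtain a :: "real^2" where a: "D2 \<subseteq> cbox (-a) a"
    using bounded_subset_cbox_symmetric[of D2] by (auto simp: D2_def)
  define E where "E t x = (if x \<in> D2 then G t x else 0)" for t x
  have "continuous_on ({0..1} \<times> D2 \<union> {0..1} \<times> {x. 1 \<le> norm x}) (\<lambda>p. if snd p \<in> D2 then (\<lambda>(t, x). G t x) p else 0)"
  proof (rule continuous_on_cases[OF _ _ G continuous_on_const])
    show "closed ({0..1::real} \<times> D2)" by (intro closed_Times) (auto simp: D2_def)
    show "closed ({0..1::real} \<times> {x::real^2. 1 \<le> norm x})"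
      by (intro closed_Times closed_Collect_le continuous_intros)
  qed (use G0 in \<open>auto simp: D2_def\<close>)
  then have "continuous_on ({0..1} \<times> D2 \<union> {0..1} \<times> {x. 1 \<le> norm x}) (\<lambda>(t, x). E t x)"
    by (simp add: E_def case_prod_beta cong: if_cong)
  then have E: "continuous_on ({0..1} \<times> cbox (-a) a) (\<lambda>(t, x). E t x)"
    by (rule continuous_on_subset) (auto simp: D2_def)
  have IE: "integral D2 (G t) = integral (cbox (-a) a) (E t)" for t
    using integral_restrict_Int[of "cbox (-a) a" D2 "G t"] a by (simp add: E_def[abs_def] Int_absorb2)
  show "continuous_on {0..1} (\<lambda>t. integral D2 (G t))"
    unfolding IE by (rule integral_continuous_on_param[OF E])
  have "integral {0..1} (\<lambda>t. integral D2 (G t)) = integral (cbox 0 1) (\<lambda>t. integral (cbox (-a) a) (E t))"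
    unfolding IE by simp
  also have "\<dots> = integral (cbox (-a) a) (\<lambda>x. integral (cbox 0 1) (\<lambda>t. E t x))"
    by (rule integral_swap_continuous) (use E in \<open>simp add: cbox_Pair_eq\<close>)
  also have "\<dots> = integral (cbox (-a) a) (\<lambda>x. if x \<in> D2 then integral {0..1} (\<lambda>t. G t x) else 0)"
    by (rule integral_cong) (simp add: E_def)
  also have "\<dots> = integral D2 (\<lambda>x. integral {0..1} (\<lambda>t. G t x))"
    using integral_restrict_Int[of "cbox (-a) a" D2 "\<lambda>x. integral {0..1} (\<lambda>t. G t x)"] a by (simp add: Int_absorb2)
  finally show "integral {0..1} (\<lambda>t. integral D2 (G t)) = integral D2 (\<lambda>x. integral {0..1} (\<lambda>t. G t x))" .
qed

context disc_flow
begin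

text \<open>Unit Jacobian reduces the left-hand side to an integral over the image of the open disc.
  The same formula with integrand 1 shows that this image has full measure, so a measure count takes
  the place of surjectivity.\<close>

lemma integral_\<Phi>:
  fixes F :: "real^2 \<Rightarrow> real"
  assumes t: "t \<in> {0..1}" and F: "continuous_on D2 F"
  shows "integral D2 (\<lambda>x. F (\<Phi> t x)) = integral D2 F"
proof -
  let ?S = "ball (0::real^2) 1"
  have SD: "?S \<subseteq> D2" by (auto simp: D2_def)
  have inj: "inj_on (\<Phi> t) ?S" using \<Phi>_inj[OF t] SD by (rule inj_on_subset)
  have cont: "continuous_on ?S (\<Phi> t)"
    using has_derivative_continuous[OF has_derivative_\<Phi>[OF _ t]]
    by (intro continuous_at_imp_continuous_on) auto
  have op: "open (\<Phi> t ` ?S)" by (rule invariance_of_domain[OF cont open_ball inj])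
  have sub: "\<Phi> t ` ?S \<subseteq> D2" using \<Phi>_D2[OF t] SD by auto
  have area: "integral ?S (\<lambda>x. g (\<Phi> t x)) = integral (\<Phi> t ` ?S) g" if g: "continuous_on D2 g" for g :: "real^2 \<Rightarrow> real"
  proof -
    have "g absolutely_integrable_on \<Phi> t ` ?S"
      using integrable_on_D2(2)[OF g] by (rule set_integrable_subset) (use op sub in auto)
    from area_formula(2)[OF _ has_derivative_at_withinI[OF has_derivative_\<Phi>[OF _ t]] inj this]
    have "integral ?S (\<lambda>x. \<bar>Omega (M x t (axis 1 1)) (M x t (axis 2 1))\<bar> * g (\<Phi> t x)) = integral (\<Phi> t ` ?S) g"
      by simp
    moreover have "integral ?S (\<lambda>x. \<bar>Omega (M x t (axis 1 1)) (M x t (axis 2 1))\<bar> * g (\<Phi> t x)) = integral ?S (\<lambda>x. g (\<Phi> t x))"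
      by (rule integral_cong) (simp add: Omega_M[OF _ t] Omega_axis)
    ultimately show ?thesis by simp
  qed
  have lm: "\<Phi> t ` ?S \<in> lmeasurable" and lD: "D2 \<in> lmeasurable"
    using lmeasurable_open[OF bounded_subset[OF _ sub] op] by (auto simp: D2_def)
  have "measure lebesgue (\<Phi> t ` ?S) = integral (\<Phi> t ` ?S) (\<lambda>x. 1)"
    by (rule lmeasure_integral[OF lm])
  also have "\<dots> = integral ?S (\<lambda>x. 1)" using area[of "\<lambda>x. 1"] by simp
  also have "\<dots> = measure lebesgue D2"
    by (simp add: integral_D2_eq_ball[symmetric] lmeasure_integral[OF lD])
  finally have "measure lebesgue (D2 - \<Phi> t ` ?S) = 0"
    using measurable_measure_Diff[OF lD _ sub] lm by simp
  then have neg: "negligible (D2 - \<Phi> t ` ?S)"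
    using lm lD by (simp add: negligible_iff_measure fmeasurable.Diff)
  have "integral D2 (\<lambda>x. F (\<Phi> t x)) = integral (\<Phi> t ` ?S) F"
    by (simp add: integral_D2_eq_ball area[OF F])
  also have "\<dots> = integral D2 F"
  proof (rule integral_spike_set)
    show "negligible {x \<in> \<Phi> t ` ?S - D2. F x \<noteq> 0}"
      using sub by (metis (no_types, lifting) Diff_eq_empty_iff empty_iff mem_Collect_eq negligible_empty negligible_subset subsetI)
    show "negligible {x \<in> D2 - \<Phi> t ` ?S. F x \<noteq> 0}"
      by (rule negligible_subset[OF neg]) auto
  qed
  finally show ?thesis .
qed

lemma has_derivative_H:
  assumes x: "x \<in> ball 0 1" and t: "t \<in> {0..1}"
  shows "(H t has_derivative Omega (X t x)) (at x)"
  unfolding has_derivative_at_alt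
proof (intro conjI allI impI)
  show "bounded_linear (Omega (X t x))"
    by (rule bounded_bilinear.bounded_linear_right[OF bounded_bilinear_Omega])
  fix e :: real assume "0 < e"
  from H_diff[OF this] obtain d where d: "d > 0" "\<And>y. y \<in> D2 \<Longrightarrow> norm (y - x) < d \<Longrightarrow>
      \<bar>H t y - H t x - Omega (X t x) (y - x)\<bar> \<le> e * norm (y - x)"
    using t ball_subset_D2[OF x] by blast
  have yD: "y \<in> D2" if "norm (y - x) < 1 - norm x" for y
    using that norm_triangle_ineq2[of y x] by (simp add: D2_def)
  show "\<exists>d>0. \<forall>y. norm (y - x) < d \<longrightarrow> norm (H t y - H t x - Omega (X t x) (y - x)) \<le> e * norm (y - x)"
    using d x yD by (intro exI[of _ "min d (1 - norm x)"]) auto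
qed

text \<open>Integration by parts: \<open>d(H q) \<and> dp\<close> and
  \<open>d(H p) \<and> dq\<close> have integral 0, so
  \<open>q \<partial>H/\<partial>q + p \<partial>H/\<partial>p\<close> integrates to
  \<open>-2\<close> times the integral of \<open>H\<close>. Since \<open>\<lambda>(X)\<close> is
  \<open>-1/2\<close> times this expression, it contributes one integral of \<open>H\<close>, and
  \<open>H\<close> itself the other.\<close>

lemma integral_lagrangian:
  assumes t: "t \<in> {0..1}"
  shows "integral D2 (lagrangian t) = 2 * integral D2 (H t)"
proof -
  let ?S = "ball (0::real^2) 1"
  let ?e1 = "axis 1 1 :: real^2" and ?e2 = "axis 2 1 :: real^2"
  have Hb: "\<bar>H t x\<bar> \<le> 2 * C" if "x \<in> D2" for x
  proof -
    have a: "?e1 \<in> D2" "norm ?e1 = 1" by (auto simp: D2_def)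
    have "\<bar>H t x\<bar> \<le> C * norm (x - ?e1)"
      using H_lipschitz[OF t that a(1)] H_supp[OF t a(1)] a(2) r by simp
    also have "\<dots> \<le> C * 2"
      using norm_triangle_ineq4[of x ?e1] that a C by (intro mult_left_mono) (auto simp: D2_def)
    finally show ?thesis by simp
  qed
  have lip: "(3 * C)-lipschitz_on (cball 0 1) (\<lambda>x. H t x * x $ i)" for i
  proof (rule lipschitz_onI)
    fix x y :: "real^2" assume "x \<in> cball 0 1" "y \<in> cball 0 1"
    then have xy: "x \<in> D2" "y \<in> D2" by (auto simp: D2_def)
    have yi: "\<bar>y $ i\<bar> \<le> 1" using component_le_norm_cart[of y i] xy by (simp add: D2_def)
    have "H t x * x $ i - H t y * y $ i = H t x * (x - y) $ i + (H t x - H t y) * y $ i" by (simp add: algebra_simps)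
    also have "\<bar>\<dots>\<bar> \<le> \<bar>H t x\<bar> * \<bar>(x - y) $ i\<bar> + \<bar>H t x - H t y\<bar> * \<bar>y $ i\<bar>"
      by (simp only: abs_mult[symmetric] abs_triangle_ineq)
    also have "\<dots> \<le> 2 * C * norm (x - y) + C * norm (x - y) * 1"
      using Hb[OF xy(1)] component_le_norm_cart[of "x - y" i] H_lipschitz[OF t xy] yi C
      by (intro add_mono mult_mono) auto
    finally show "dist (H t x * x $ i) (H t y * y $ i) \<le> 3 * C * dist x y"
      by (simp add: dist_norm algebra_simps)
  qed (use C in auto)
  have lc: "1-lipschitz_on (cball 0 1) (\<lambda>x::real^2. x $ i)" for i
    by (auto intro!: lipschitz_onI simp: dist_norm simp flip: vector_minus_component intro: component_le_norm_cart)
  have dc: "((\<lambda>x::real^2. x $ i) has_derivative (\<lambda>v. v $ i)) (at x)" for x i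
    by (rule bounded_linear_imp_has_derivative[OF bounded_linear_vec_nth])
  have supp: "H t x * x $ i = 0" if "r < norm x" "norm x \<le> 1" for x i
    using H_supp[OF t] that by (simp add: D2_def)
  note W = integral_wedge_ball_eq_0
  have 1: "((\<lambda>x. H t x + Omega (X t x) ?e1 * x $ 1) has_integral 0) ?S"
    by (rule has_integral_eq[rotated, OF W[OF lip[of 1] lc[of 2] r(2) supp has_derivative_mult[OF has_derivative_H[OF _ t] dc[of 1]] dc[of 2], where a = ?e1 and b = ?e2]]) (auto simp: axis_def)
  have 2: "((\<lambda>x. H t x + Omega (X t x) ?e2 * x $ 2) has_integral 0) ?S"
    by (rule has_integral_eq[rotated, OF W[OF lip[of 2] lc[of 1] r(2) supp has_derivative_mult[OF has_derivative_H[OF _ t] dc[of 2]] dc[of 1], where a = ?e2 and b = ?e1]]) (auto simp: axis_def)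
  have Hc: "continuous_on D2 (H t)" 
  proof -
    have "continuous_on D2 (\<lambda>x. (\<lambda>(t, x). H t x) (t, x))"
      by (rule continuous_on_compose2[OF H_cont]) (use t in \<open>auto intro!: continuous_intros\<close>)
    then show ?thesis by simp
  qed
  have "H t absolutely_integrable_on ?S"
    using integrable_on_D2(2)[OF Hc] by (rule set_integrable_subset) (auto simp: D2_def)
  then have "H t integrable_on ?S" by (simp add: absolutely_integrable_on_def)
  then have H: "(H t has_integral integral ?S (H t)) ?S" by (rule integrable_integral)
  have "((\<lambda>x. 2 * H t x - (H t x + Omega (X t x) ?e1 * x $ 1 + (H t x + Omega (X t x) ?e2 * x $ 2)) / 2) has_integral
     (2 * integral ?S (H t) - (0 + 0) / 2)) ?S"
    by (intro has_integral_diff has_integral_mult_right has_integral_divide has_integral_add H 1 2)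
  moreover have "2 * H t x - (H t x + Omega (X t x) ?e1 * x $ 1 + (H t x + Omega (X t x) ?e2 * x $ 2)) / 2 = lagrangian t x" for x
    by (simp add: lagrangian_def Omega_def axis_def field_simps)
  ultimately have "(lagrangian t has_integral 2 * integral ?S (H t)) ?S" by simp
  then show ?thesis by (simp add: integral_D2_eq_ball integral_unique)
qed

text \<open>Area preservation allows \<open>lagrangian t\<close> to be evaluated at
  \<open>\<Phi> t x\<close> under the space integral; exchanging the two integrals then produces the
  action.\<close>

lemma calabi_eq_action:
  "(LINT t:{0..1}|lborel. (LINT x:D2|lborel. H t x)) = integral D2 action / 2"
proof -
  have Hc: "continuous_on D2 (H t)" and Lc: "continuous_on D2 (lagrangian t)" if "t \<in> {0..1}" for t
  proof -
    have "continuous_on D2 (\<lambda>x. (\<lambda>(t, x). H t x) (t, x))" "continuous_on D2 (\<lambda>x. (\<lambda>(t, x). lagrangian t x) (t, x))"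
      by (rule continuous_on_compose2[OF H_cont] continuous_on_compose2[OF lagrangian_cont]; use that in \<open>auto intro!: continuous_intros\<close>)+
    then show "continuous_on D2 (H t)" "continuous_on D2 (lagrangian t)" by simp_all
  qed
  have bd: "x \<in> D2" "r < norm x" if "norm x = 1" for x :: "real^2"
    using that r by (auto simp: D2_def)
  have "(LINT t:{0..1}|lborel. (LINT x:D2|lborel. H t x)) = (LINT t:{0..1}|lborel. integral D2 (H t))"
    by (rule set_lebesgue_integral_cong) (auto simp: set_borel_integral_eq_integral(2)[OF integrable_on_D2(1)[OF Hc]])
  also have "\<dots> = integral {0..1} (\<lambda>t. integral D2 (H t))"
  proof (rule set_borel_integral_eq_integral(2))
    show "set_integrable lborel {0..1} (\<lambda>t. integral D2 (H t))"
      unfolding set_integrable_def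
      by (rule borel_integrable_compact[OF _ integrals_over_unit_interval_and_D2(1)[OF H_cont]]) (use bd H_supp in auto)
  qed
  also have "\<dots> = integral {0..1} (\<lambda>t. integral D2 (\<lambda>x. lagrangian t (\<Phi> t x)) / 2)"
    by (rule integral_cong) (simp add: integral_\<Phi> Lc integral_lagrangian)
  also have "\<dots> = integral {0..1} (\<lambda>t. integral D2 (\<lambda>x. lagrangian t (\<Phi> t x))) / 2"
    by simp
  also have "integral {0..1} (\<lambda>t. integral D2 (\<lambda>x. lagrangian t (\<Phi> t x))) = integral D2 action"
    unfolding action_def
    by (rule integrals_over_unit_interval_and_D2(2)[OF lagrangian_flow_cont])
      (use bd \<Phi>_outside lagrangian_outside in auto)
  finally show ?thesis .
qed

end

section \<open>From smooth Hamiltonians to uniform estimates\<close>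

lemma compact_family_estimates:
  fixes F :: "real \<Rightarrow> 'a::euclidean_space \<Rightarrow> 'b::real_normed_vector"
  assumes K: "compact K" "convex K"
    and F': "\<And>t x. t \<in> {0..1} \<Longrightarrow> x \<in> K \<Longrightarrow> (F t has_derivative F' t x) (at x)"
    and cont: "\<And>v. continuous_on ({0..1} \<times> K) (\<lambda>(t, x). F' t x v)"
  shows "\<exists>C\<ge>0. (\<forall>t\<in>{0..1}. \<forall>x\<in>K. \<forall>v. norm (F' t x v) \<le> C * norm v) \<and>
    (\<forall>t\<in>{0..1}. \<forall>x\<in>K. \<forall>y\<in>K. norm (F t x - F t y) \<le> C * norm (x - y)) \<and>
    (\<forall>e>0. \<exists>d>0. \<forall>t\<in>{0..1}. \<forall>x\<in>K. \<forall>y\<in>K. norm (y - x) < d \<longrightarrow>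
       norm (F t y - F t x - F' t x (y - x)) \<le> e * norm (y - x))"
proof -
  \<comment> \<open>As a continuous map from a compact set into the bounded linear maps, the
    derivative is bounded and uniformly continuous; the mean value inequality on segments converts
    this into the Lipschitz and remainder estimates.\<close>
  define B where "B p = Blinfun (F' (fst p) (snd p))" for p
  have ap: "blinfun_apply (B (t, x)) = F' t x" if "t \<in> {0..1}" "x \<in> K" for t x
    unfolding B_def using bounded_linear_Blinfun_apply[OF has_derivative_bounded_linear[OF F'[OF that]]] by simp
  have cB: "continuous_on ({0..1} \<times> K) B"
  proof (rule continuous_on_blinfun_componentwise)
    fix v
    have "continuous_on ({0..1} \<times> K) (\<lambda>p. F' (fst p) (snd p) v)"
      using cont[of v] by (simp add: case_prod_beta)
    then show "continuous_on ({0..1} \<times> K) (\<lambda>p. blinfun_apply (B p) v)"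
      by (rule continuous_on_eq) (use ap in auto)
  qed
  have cK: "compact ({0..1::real} \<times> K)" using K by (intro compact_Times) auto
  have "bounded (B ` ({0..1} \<times> K))"
    by (rule compact_imp_bounded[OF compact_continuous_image[OF cB cK]])
  then obtain C where "\<forall>p\<in>{0..1} \<times> K. norm (B p) \<le> C" unfolding bounded_iff by auto
  then have C: "norm (B (t, x)) \<le> max C 0" if "t \<in> {0..1}" "x \<in> K" for t x
    using that by (meson SigmaI max.coboundedI1)
  have lin: "norm (F' t x v) \<le> max C 0 * norm v" if "t \<in> {0..1}" "x \<in> K" for t x v
    using norm_blinfun[of "B (t, x)" v] mult_right_mono[OF C[OF that], of "norm v"] by (simp add: ap[OF that])
  have on: "onorm (F' t x) \<le> max C 0" if "t \<in> {0..1}" "x \<in> K" for t x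
    by (rule onorm_le) (use lin[OF that] in auto)
  have dw: "(F t has_derivative F' t x) (at x within S)" if "t \<in> {0..1}" "x \<in> K" for t x S
    by (rule has_derivative_at_withinI[OF F'[OF that]])
  have lip: "norm (F t x - F t y) \<le> max C 0 * norm (x - y)" if "t \<in> {0..1}" "x \<in> K" "y \<in> K" for t x y
    by (rule differentiable_bound[OF K(2) dw[OF that(1)] on[OF that(1)] that(2,3)])
  have unif: "\<exists>d>0. \<forall>t\<in>{0..1}. \<forall>x\<in>K. \<forall>y\<in>K. norm (y - x) < d \<longrightarrow>
       norm (F t y - F t x - F' t x (y - x)) \<le> e * norm (y - x)" if e: "0 < e" for e
  proof -
    have "uniformly_continuous_on ({0..1} \<times> K) B"
      by (rule compact_uniformly_continuous[OF cB cK])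
    then obtain d where d: "d > 0" "\<And>p q. p \<in> {0..1} \<times> K \<Longrightarrow> q \<in> {0..1} \<times> K \<Longrightarrow> dist q p < d \<Longrightarrow> dist (B q) (B p) < e"
      unfolding uniformly_continuous_on_def using e by metis
    have "norm (F t y - F t x - F' t x (y - x)) \<le> e * norm (y - x)"
      if t: "t \<in> {0..1}" and x: "x \<in> K" and y: "y \<in> K" and xy: "norm (y - x) < d" for t x y
    proof -
      let ?S = "closed_segment x y"
      have SK: "?S \<subseteq> K" using K(2) x y by (simp add: closed_segment_subset)
      have "norm (F t y - F t x - F' t x (y - x)) \<le> norm (y - x) * e"
      proof (rule differentiable_bound_linearization[of x y ?S "F t" "F' t" x])
        show "x + s *\<^sub>R (y - x) \<in> ?S" if "s \<in> {0..1}" for s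
          using that by (auto simp: in_segment algebra_simps intro!: exI[of _ s])
        show "(F t has_derivative F' t z) (at z within ?S)" if "z \<in> ?S" for z
          using dw[OF t] SK that by blast
        fix z assume z: "z \<in> ?S"
        then have zK: "z \<in> K" using SK by blast
        have "norm (z - x) \<le> norm (y - x)" using segment_bound(1)[OF z] by simp
        then have "dist (t, z) (t, x) < d" using xy by (simp add: dist_Pair_Pair dist_norm)
        then have "norm (B (t, z) - B (t, x)) \<le> e"
          using d(2)[of "(t, x)" "(t, z)"] t x zK by (simp add: dist_norm less_imp_le)
        moreover have "norm (F' t z v - F' t x v) \<le> norm (B (t, z) - B (t, x)) * norm v" for v
          using norm_blinfun[of "B (t, z) - B (t, x)" v] by (simp add: ap[OF t zK] ap[OF t x] blinfun.diff_left)
        ultimately show "onorm (F' t z - F' t x) \<le> e"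
          by (intro onorm_le) (metis fun_diff_def mult_right_mono norm_ge_zero order_trans)
      qed simp
      then show ?thesis by (simp add: mult.commute)
    qed
    then show ?thesis using d(1) by blast
  qed
  show ?thesis
    by (intro exI[of _ "max C 0"] conjI ballI allI impI lin lip unif) auto
qed

text \<open>Smoothness up to the ends of the time interval is available through local extensions
  \<open>g\<close> only. The spatial derivative of \<open>F\<close> does not depend on them, and
  near each point it is the derivative of \<open>g\<close> in the direction \<open>(0, v)\<close>,
  hence again smooth.\<close>

lemma smooth_on_slice_has_derivative:
  fixes F :: "real \<Rightarrow> 'a::euclidean_space \<Rightarrow> 'b::real_normed_vector"
  assumes F: "smooth_on ({0..1} \<times> UNIV) (\<lambda>(t, x). F t x)" and t: "t \<in> {0..1}"
  shows "(F t has_derivative frechet_derivative (F t) (at x)) (at x)"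
    and "\<exists>U g. open U \<and> (t, x) \<in> U \<and> (\<forall>k. Ck_on k U g) \<and> (\<forall>s y v. s \<in> {0..1} \<longrightarrow> (s, y) \<in> U \<longrightarrow>
        frechet_derivative (F s) (at y) v = frechet_derivative g (at (s, y)) (0, v))"
proof -
  have p: "(t, x) \<in> {0..1} \<times> UNIV" using t by simp
  obtain U g where U: "open U" "(t, x) \<in> U" "\<forall>k. Ck_on k U g" "\<forall>p\<in>U \<inter> {0..1} \<times> UNIV. g p = (\<lambda>(t, x). F t x) p"
    by (rule smooth_onE[OF F p]) (rule that)
  have d: "(F s has_derivative (\<lambda>v. frechet_derivative g (at (s, y)) (0, v))) (at y)" if s: "s \<in> {0..1}" and y: "(s, y) \<in> U" for s y
  proof -
    have g: "(g has_derivative frechet_derivative g (at (s, y))) (at (s, y))"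
      by (rule Ck_on_SucD(1)[OF U(3)[rule_format] y])
    have "((\<lambda>y. g (s, y)) has_derivative (\<lambda>v. frechet_derivative g (at (s, y)) (0, v))) (at y)"
      by (rule has_derivative_compose[of "\<lambda>y. (s, y)" "\<lambda>v. (0, v)" y UNIV, OF _ g]) (auto intro!: derivative_eq_intros)
    moreover have "open (Pair s -` U)"
      by (rule open_vimage[OF U(1)]) (auto intro!: continuous_intros)
    ultimately show ?thesis
      by (rule has_derivative_transform_within_open) (use s y U(4) in auto)
  qed
  have fr: "frechet_derivative (F s) (at y) v = frechet_derivative g (at (s, y)) (0, v)" if "s \<in> {0..1}" "(s, y) \<in> U" for s y v
    using frechet_derivative_at[OF d[OF that]] by metis
  show "(F t has_derivative frechet_derivative (F t) (at x)) (at x)"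
    using d[OF t U(2)] frechet_derivative_at by metis
  show "\<exists>U g. open U \<and> (t, x) \<in> U \<and> (\<forall>k. Ck_on k U g) \<and> (\<forall>s y v. s \<in> {0..1} \<longrightarrow> (s, y) \<in> U \<longrightarrow>
        frechet_derivative (F s) (at y) v = frechet_derivative g (at (s, y)) (0, v))"
    using U(1-3) fr by blast
qed

text \<open>The sum over \<open>I\<close> and the bilinear map \<open>p\<close> cover at once a
  single directional derivative and a vector field assembled from several of them.\<close>

lemma smooth_on_slice_derivative:
  fixes F :: "real \<Rightarrow> 'a::euclidean_space \<Rightarrow> 'b::real_normed_vector" and w :: "'i \<Rightarrow> 'c::real_normed_vector"
  assumes F: "smooth_on ({0..1} \<times> UNIV) (\<lambda>(t, x). F t x)" and p: "bounded_bilinear p"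
  shows "smooth_on ({0..1} \<times> UNIV) (\<lambda>(t, x). \<Sum>i\<in>I. p (frechet_derivative (F t) (at x) (v i)) (w i))"
  unfolding smooth_on_def
proof clarify
  fix t :: real and x :: 'a assume t: "t \<in> {0..1}"
  obtain U g where U: "open U" "(t, x) \<in> U" "\<forall>k. Ck_on k U g" "\<forall>s y v. s \<in> {0..1} \<longrightarrow> (s, y) \<in> U \<longrightarrow>
        frechet_derivative (F s) (at y) v = frechet_derivative g (at (s, y)) (0, v)"
    using smooth_on_slice_has_derivative(2)[OF F t, of x] by (elim exE conjE) (rule that)
  let ?g = "\<lambda>q. \<Sum>i\<in>I. p (frechet_derivative g (at q) (0, v i)) (w i)"
  have "Ck_on k U ?g" for k
    by (intro Ck_on_sum U(1) Ck_on_bilinear[OF U(1) p] Ck_on_const Ck_on_SucD(2)[OF U(3)[rule_format]])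
  moreover have "\<forall>q\<in>U \<inter> {0..1} \<times> UNIV. ?g q = (case q of (t, x) \<Rightarrow> \<Sum>i\<in>I. p (frechet_derivative (F t) (at x) (v i)) (w i))"
    using U(4) by (auto intro!: sum.cong)
  ultimately show "\<exists>U g. open U \<and> (t, x) \<in> U \<and> (\<forall>k. Ck_on k U g) \<and> (\<forall>q\<in>U \<inter> {0..1} \<times> UNIV. g q =
      (case q of (t, x) \<Rightarrow> \<Sum>i\<in>I. p (frechet_derivative (F t) (at x) (v i)) (w i)))"
    using U(1,2) by blast
qed

lemma smooth_on_slice_derivative_cont:
  fixes F :: "real \<Rightarrow> 'a::euclidean_space \<Rightarrow> 'b::real_normed_vector"
  assumes F: "smooth_on ({0..1} \<times> UNIV) (\<lambda>(t, x). F t x)"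
  shows "continuous_on ({0..1} \<times> K) (\<lambda>(t, x). frechet_derivative (F t) (at x) v)"
proof -
  have "smooth_on ({0..1} \<times> UNIV) (\<lambda>(t, x). \<Sum>i\<in>{()}. (\<lambda>u c. c *\<^sub>R u) (frechet_derivative (F t) (at x) v) (1::real))"
    by (rule smooth_on_slice_derivative[OF F bounded_bilinear.flip[OF bounded_bilinear_scaleR]])
  then have "continuous_on ({0..1} \<times> UNIV) (\<lambda>(t, x). frechet_derivative (F t) (at x) v)"
    by (simp add: smooth_on_imp_continuous_on)
  then show ?thesis by (rule continuous_on_subset) auto
qed

text \<open>At a boundary point only directions into the disc are tested. Segments to points
  \<open>z\<close> of the convex disc still determine the derivative on the vectors
  \<open>z - y\<close>, and these span the plane.\<close>

lemma has_derivative_within_D2_unique: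
  fixes f :: "real^2 \<Rightarrow> real"
  assumes L: "(f has_derivative L) (at y within D2)" "(f has_derivative L') (at y within D2)" and y: "y \<in> D2"
  shows "L = L'"
proof -
  have *: "L (z - y) = L' (z - y)" if z: "z \<in> D2" for z
  proof -
    have path: "y + s *\<^sub>R (z - y) \<in> D2" if "s \<in> {0..1}" for s
      using convexD_alt[of D2 y z s] y z that by (auto simp: D2_def algebra_simps)
    have dp: "((\<lambda>s. y + s *\<^sub>R (z - y)) has_derivative (\<lambda>s. s *\<^sub>R (z - y))) (at 0 within {0..1})"
      by (auto intro!: derivative_eq_intros)
    have "((\<lambda>s. f (y + s *\<^sub>R (z - y))) has_vector_derivative l (z - y)) (at 0 within {0..1})"
      if l: "(f has_derivative l) (at y within D2)" for l
    proof -
      have "((\<lambda>s. f (y + s *\<^sub>R (z - y))) has_derivative (\<lambda>s. l (s *\<^sub>R (z - y)))) (at 0 within {0..1})"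
      proof (rule has_derivative_in_compose[OF dp])
        have "(f has_derivative l) (at y within (\<lambda>s. y + s *\<^sub>R (z - y)) ` {0..1})"
          by (rule has_derivative_subset[OF l]) (use path in auto)
        then show "(f has_derivative l) (at (y + 0 *\<^sub>R (z - y)) within (\<lambda>s. y + s *\<^sub>R (z - y)) ` {0..1})"
          by simp
      qed
      then show ?thesis
        by (simp add: has_vector_derivative_def linear_cmul[OF has_derivative_linear[OF l]])
    qed
    from vector_derivative_unique_within_closed_interval[OF _ _ this[OF L(1), unfolded cbox_interval[symmetric]] this[OF L(2), unfolded cbox_interval[symmetric]]]
    show ?thesis by simp
  qed
  note l = has_derivative_linear[OF L(1)] and l' = has_derivative_linear[OF L(2)]
  have "0 \<in> D2" by (simp add: D2_def)
  from *[OF this] have y': "L y = L' y" using linear_neg[OF l, of y] linear_neg[OF l', of y] by simp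
  have a: "L (axis i 1) = L' (axis i 1)" for i
  proof -
    have "axis i 1 \<in> D2" by (simp add: D2_def)
    from *[OF this] show ?thesis using y' by (simp add: linear_diff[OF l] linear_diff[OF l'])
  qed
  show ?thesis
  proof
    fix v :: "real^2"
    have v: "v = v $ 1 *\<^sub>R axis 1 1 + v $ 2 *\<^sub>R axis 2 1"
      by (simp add: vec_eq_iff forall_2 axis_def)
    show "L v = L' v"
      by (subst (1 2) v) (simp add: linear_add[OF l] linear_add[OF l'] linear_cmul[OF l] linear_cmul[OF l'] a)
  qed
qed

text \<open>A Hamiltonian is extended by zero to the plane, where it stays smooth because it
  vanishes near the boundary circle.\<close>

lemma hamiltonian_imp_disc_flow:
  assumes H: "hamiltonian H" and \<phi>: "time_one_map H \<phi>"
  obtains X X' H' \<Phi> C r where "disc_flow X X' H' \<Phi> C r" "\<And>t x. x \<in> D2 \<Longrightarrow> H' t x = H t x"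
    "\<And>x. x \<in> D2 \<Longrightarrow> \<phi> x = \<Phi> 1 x"
proof -
  define S where "S = closure {(t, x). t \<in> {0..1} \<and> x \<in> D2 \<and> H t x \<noteq> 0}"
  have S: "S \<subseteq> {0..1} \<times> interior D2" and smH: "smooth_on ({0..1} \<times> D2) (\<lambda>(t, x). H t x)"
    using H by (auto simp: hamiltonian_def S_def)
  have intD: "interior D2 = ball 0 1" by (simp add: D2_def interior_cball)
  have clS: "closed S" by (simp add: S_def)
  have cS: "compact S"
  proof -
    have "bounded S"
      by (rule bounded_subset[OF _ S]) (auto intro!: bounded_Times simp: intD)
    then show ?thesis using clS by (simp add: compact_eq_bounded_closed)
  qed
  have inS: "(t, x) \<in> S" if "t \<in> {0..1}" "x \<in> D2" "H t x \<noteq> 0" for t x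
    unfolding S_def using that by (intro subsetD[OF closure_subset]) simp
  \<comment> \<open>The support is compact and its spatial part lies in the open disc, so the
    largest norm occurring in it is below 1.\<close>
  obtain r where r: "0 \<le> r" "r < 1" "\<And>t x. (t, x) \<in> S \<Longrightarrow> norm x \<le> r"
  proof (cases "S = {}")
    case True
    then show ?thesis using that[of 0] by simp
  next
    case False
    have "continuous_on S (\<lambda>p. norm (snd p))" by (intro continuous_intros)
    from continuous_attains_sup[OF cS False this] obtain p where p: "p \<in> S" "\<And>q. q \<in> S \<Longrightarrow> norm (snd q) \<le> norm (snd p)"
      by blast
    have "norm (snd p) < 1" using p(1) S intD by (cases p) auto
    then show ?thesis using that[of "norm (snd p)"] p(2) by auto
  qed
  define G where "G t x = (if x \<in> D2 then H t x else 0)" for t x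
  have GS: "G t x = 0" if "t \<in> {0..1}" "(t, x) \<notin> S" for t x
    using inS that by (auto simp: G_def)
  have smG: "smooth_on ({0..1} \<times> UNIV) (\<lambda>(t, x). G t x)"
    unfolding smooth_on_def
  proof clarify
    fix t :: real and x :: "real^2" assume t: "t \<in> {0..1}"
    show "\<exists>U g. open U \<and> (t, x) \<in> U \<and> (\<forall>k. Ck_on k U g) \<and> (\<forall>q\<in>U \<inter> {0..1} \<times> UNIV. g q = (case q of (t, x) \<Rightarrow> G t x))"
    proof (cases "(t, x) \<in> S")
      case True
      then have x: "x \<in> interior D2" using S by auto
      then have p: "(t, x) \<in> {0..1} \<times> D2" using t interior_subset by auto
      obtain U g where U: "open U" "(t, x) \<in> U" "\<forall>k. Ck_on k U g" "\<forall>q\<in>U \<inter> {0..1} \<times> D2. g q = (\<lambda>(t, x). H t x) q"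
        by (rule smooth_onE[OF smH p]) (rule that)
      let ?U = "U \<inter> UNIV \<times> interior D2"
      have "open ?U" using U(1) by (intro open_Int open_Times) auto
      moreover have "Ck_on k ?U g" for k using U(3)[rule_format] by (rule Ck_on_subset) simp
      moreover have "g q = (case q of (t, x) \<Rightarrow> G t x)" if "q \<in> ?U \<inter> {0..1} \<times> UNIV" for q
        using that U(4) interior_subset[of D2] by (auto simp: G_def)
      ultimately show ?thesis using U(2) x by (intro exI[of _ ?U] exI[of _ g]) auto
    next
      case False
      then show ?thesis
        using GS clS by (intro exI[of _ "- S"] exI[of _ "\<lambda>_. 0"]) (auto intro: Ck_on_const)
    qed
  qed
  define DG where "DG t x = frechet_derivative (G t) (at x)" for t x
  have DG: "(G t has_derivative DG t x) (at x)" if "t \<in> {0..1}" for t x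
    unfolding DG_def by (rule smooth_on_slice_has_derivative(1)[OF smG that])
  \<comment> \<open>These weights write the rotated gradient
    \<open>(\<partial>G/\<partial>p, - \<partial>G/\<partial>q)\<close> as a sum over coordinate
    directions, the shape in which smoothness of slice derivatives is stated.\<close>
  define w :: "2 \<Rightarrow> real^2" where "w i = (if i = 1 then - axis 2 1 else axis 1 1)" for i
  define X where "X t x = (\<Sum>i\<in>UNIV. DG t x (axis i 1) *\<^sub>R w i)" for t x
  have X_eq: "X t x = DG t x (axis 2 1) *\<^sub>R axis 1 1 - DG t x (axis 1 1) *\<^sub>R axis 2 1" for t x
    by (simp add: X_def sum_2 w_def)
  have smX: "smooth_on ({0..1} \<times> UNIV) (\<lambda>(t, x). X t x)"
    unfolding X_def DG_def by (rule smooth_on_slice_derivative[OF smG bounded_bilinear_scaleR])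
  define X' where "X' t x = frechet_derivative (X t) (at x)" for t x
  have X': "(X t has_derivative X' t x) (at x)" if "t \<in> {0..1}" for t x
    unfolding X'_def by (rule smooth_on_slice_has_derivative(1)[OF smX that])
  have OX: "Omega (X t x) = DG t x" if "t \<in> {0..1}" for t x
  proof
    fix v :: "real^2"
    have l: "linear (DG t x)" using has_derivative_linear[OF DG[OF that]] .
    have v: "v = v $ 1 *\<^sub>R axis 1 1 + v $ 2 *\<^sub>R axis 2 1"
      by (simp add: vec_eq_iff forall_2 axis_def)
    have "DG t x v = v $ 1 * DG t x (axis 1 1) + v $ 2 * DG t x (axis 2 1)"
      by (subst v) (simp add: linear_add[OF l] linear_cmul[OF l])
    then show "Omega (X t x) v = DG t x v"
      by (simp add: X_eq Omega_def axis_def algebra_simps)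
  qed
  have smD: "smooth_on ({0..1} \<times> UNIV) (\<lambda>(t, x). DG t x v)" for v
  proof -
    have "smooth_on ({0..1} \<times> UNIV) (\<lambda>(t, x). \<Sum>i\<in>{()}. frechet_derivative (G t) (at x) v * 1)"
      by (rule smooth_on_slice_derivative[OF smG bounded_bilinear_mult])
    then show ?thesis by (simp add: DG_def)
  qed
  have DDG: "((\<lambda>x. DG t x v) has_derivative frechet_derivative (\<lambda>x. DG t x v) (at x)) (at x)" if "t \<in> {0..1}" for t x v
    by (rule smooth_on_slice_has_derivative(1)[OF smD that])
  have X'_eq: "Omega (X' t x u) v = frechet_derivative (\<lambda>x. DG t x v) (at x) u" if "t \<in> {0..1}" for t x u v
  proof -
    have "((\<lambda>x. Omega (X t x) v) has_derivative (\<lambda>u. Omega (X' t x u) v)) (at x)"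
      by (rule bounded_linear.has_derivative[OF bounded_bilinear.bounded_linear_left[OF bounded_bilinear_Omega] X'[OF that]])
    from frechet_derivative_at[OF this] show ?thesis unfolding OX[OF that] by metis
  qed
  have C2: "Ck_on 2 UNIV (G t)" if t: "t \<in> {0..1}" for t
  proof -
    have "continuous_on UNIV (\<lambda>x. frechet_derivative (\<lambda>x. DG t x v) (at x) u)" for u v
    proof -
      have "continuous_on UNIV (\<lambda>x. (\<lambda>(t, x). frechet_derivative (\<lambda>x. DG t x v) (at x) u) (t, x))"
        by (rule continuous_on_compose2[OF smooth_on_slice_derivative_cont[OF smD, of UNIV]]) (use t in \<open>auto intro!: continuous_intros\<close>)
      then show ?thesis by simp
    qed
    then show ?thesis
      unfolding numeral_2_eq_2 using differentiableI[OF DG[OF t]] differentiableI[OF DDG[OF t]]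
      by (auto simp: DG_def[symmetric])
  qed
  have Gout: "DG t x = (\<lambda>_. 0)" "G t x = 0" if "t \<in> {0..1}" "r < norm x" for t x
  proof -
    have z: "G t y = 0" if "r < norm y" for y using GS[OF \<open>t \<in> {0..1}\<close>, of y] r(3)[of t y] that by auto
    have o: "open {x::real^2. r < norm x}" by (intro open_Collect_less continuous_intros)
    have "((\<lambda>_. 0::real) has_derivative (\<lambda>_. 0)) (at x)" by simp
    then have "(G t has_derivative (\<lambda>_. 0)) (at x)"
      by (rule has_derivative_transform_within_open[OF _ o]) (use z that in auto)
    then show "DG t x = (\<lambda>_. 0)" using DG[OF that(1)] has_derivative_unique by blast
    show "G t x = 0" using z that by simp
  qed
  have DGD: "(G t has_derivative DG t x) (at x)" and XD: "(X t has_derivative X' t x) (at x)" if "t \<in> {0..1}" "x \<in> D2" for t x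
    by (rule DG[OF that(1)] X'[OF that(1)])+
  have D2c: "compact D2" "convex D2" by (auto simp: D2_def)
  obtain C1 where C1: "0 \<le> C1"
    "\<And>t x v. t \<in> {0..1} \<Longrightarrow> x \<in> D2 \<Longrightarrow> norm (DG t x v) \<le> C1 * norm v"
    "\<And>t x y. t \<in> {0..1} \<Longrightarrow> x \<in> D2 \<Longrightarrow> y \<in> D2 \<Longrightarrow> norm (G t x - G t y) \<le> C1 * norm (x - y)"
    "\<And>e. 0 < e \<Longrightarrow> \<exists>d>0. \<forall>t\<in>{0..1}. \<forall>x\<in>D2. \<forall>y\<in>D2. norm (y - x) < d \<longrightarrow>
       norm (G t y - G t x - DG t x (y - x)) \<le> e * norm (y - x)"
    apply (rule exE[OF compact_family_estimates[OF D2c, of G "DG"]])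
    apply (erule (1) DGD)
    apply (rule smooth_on_slice_derivative_cont[OF smG, folded DG_def])
    apply (elim conjE)
    apply (rule that; blast)
    done
  obtain C2' where C2': "0 \<le> C2'"
    "\<And>t x v. t \<in> {0..1} \<Longrightarrow> x \<in> D2 \<Longrightarrow> norm (X' t x v) \<le> C2' * norm v"
    "\<And>t x y. t \<in> {0..1} \<Longrightarrow> x \<in> D2 \<Longrightarrow> y \<in> D2 \<Longrightarrow> norm (X t x - X t y) \<le> C2' * norm (x - y)"
    "\<And>e. 0 < e \<Longrightarrow> \<exists>d>0. \<forall>t\<in>{0..1}. \<forall>x\<in>D2. \<forall>y\<in>D2. norm (y - x) < d \<longrightarrow>
       norm (X t y - X t x - X' t x (y - x)) \<le> e * norm (y - x)"
    apply (rule exE[OF compact_family_estimates[OF D2c, of X "X'"]])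
    apply (erule (1) XD)
    apply (rule smooth_on_slice_derivative_cont[OF smX, folded X'_def])
    apply (elim conjE)
    apply (rule that; blast)
    done
  define C where "C = max C1 C2'"
  have CC: "C1 * norm v \<le> C * norm v" "C2' * norm v \<le> C * norm v" for v :: "real^2"
    by (auto simp: C_def intro!: mult_right_mono)
  obtain \<Phi> where \<Phi>: "hamiltonian_flow H \<Phi>" "\<And>x. x \<in> D2 \<Longrightarrow> \<phi> x = \<Phi> 1 x"
    using \<phi> unfolding time_one_map_def by blast
  \<comment> \<open>The flow equation supplies at each time some vector \<open>Y\<close> with the
    right contraction; nondegeneracy of \<open>Omega\<close> identifies it with
    \<open>X\<close>.\<close>
  have vel: "((\<lambda>s. \<Phi> s x) has_vector_derivative X t (\<Phi> t x)) (at t within {0..1})" if t: "t \<in> {0..1}" and x: "x \<in> D2" for t x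
  proof -
    obtain Y where Y: "(H t has_derivative (\<lambda>v. Omega Y v)) (at (\<Phi> t x) within D2)"
      "((\<lambda>s. \<Phi> s x) has_vector_derivative Y) (at t within {0..1})"
      using \<Phi>(1) t x unfolding hamiltonian_flow_def hamiltonian_vector_def by blast
    have yD: "\<Phi> t x \<in> D2" using \<Phi>(1) t x unfolding hamiltonian_flow_def by blast
    have "(H t has_derivative DG t (\<Phi> t x)) (at (\<Phi> t x) within D2)"
      by (rule has_derivative_transform[OF yD _ has_derivative_at_withinI[OF DG[OF t]]]) (simp add: G_def)
    from has_derivative_within_D2_unique[OF Y(1) this yD] have "(\<lambda>v. Omega Y v) = Omega (X t (\<Phi> t x))"
      by (simp add: OX[OF t])
    then have "Omega Y (axis i 1) = Omega (X t (\<Phi> t x)) (axis i 1)" for i by metis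
    from this[of 1] this[of 2] have "Y = X t (\<Phi> t x)"
      by (simp add: Omega_def axis_def vec_eq_iff forall_2)
    then show ?thesis using Y(2) by simp
  qed
  have "disc_flow X X' G \<Phi> C r"
  proof (rule disc_flow.intro)
    show "norm (X t x - X t y) \<le> C * norm (x - y)" if "t \<in> {0..1}" "x \<in> D2" "y \<in> D2" for t x y
      using C2'(3)[OF that] CC(2) by (rule order_trans)
    show "\<bar>G t x - G t y\<bar> \<le> C * norm (x - y)" if "t \<in> {0..1}" "x \<in> D2" "y \<in> D2" for t x y
      using order_trans[OF C1(3)[OF that] CC(1)] by simp
    show "linear (X' t x)" if "t \<in> {0..1}" "x \<in> D2" for t x
      using has_derivative_linear[OF X'[OF that(1)]] .
    show "norm (X' t x v) \<le> C * norm v" if "t \<in> {0..1}" "x \<in> D2" for t x v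
      using C2'(2)[OF that] CC(2) by (rule order_trans)
    show "\<exists>d>0. \<forall>t\<in>{0..1}. \<forall>x\<in>D2. \<forall>y\<in>D2. norm (y - x) < d \<longrightarrow>
       norm (X t y - X t x - X' t x (y - x)) \<le> e * norm (y - x)" if "0 < e" for e
      by (rule C2'(4)[OF that])
    show "\<exists>d>0. \<forall>t\<in>{0..1}. \<forall>x\<in>D2. \<forall>y\<in>D2. norm (y - x) < d \<longrightarrow>
       \<bar>G t y - G t x - Omega (X t x) (y - x)\<bar> \<le> e * norm (y - x)" if "0 < e" for e
      using C1(4)[OF that] by (auto simp: OX)
    \<comment> \<open>\<open>Omega (X' t x u) v\<close> is the Hessian of \<open>G t\<close> at
      \<open>u\<close> and \<open>v\<close>, and the claim is its symmetry.\<close>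
    show "Omega (X' t x u) v + Omega u (X' t x v) = 0" if "t \<in> {0..1}" "x \<in> D2" for t x u v
    proof -
      have "Omega u (X' t x v) = - Omega (X' t x v) u" by (simp add: Omega_def)
      moreover have "Omega (X' t x u) v = Omega (X' t x v) u"
        using symmetric_second_derivative_real[OF open_UNIV UNIV_I C2[OF that(1)], where x = x and u = v and v = u]
        by (simp add: X'_eq[OF that(1)] DG_def)
      ultimately show ?thesis by simp
    qed
    show "continuous_on ({0..1} \<times> D2) (\<lambda>(t, x). X t x)" "continuous_on ({0..1} \<times> D2) (\<lambda>(t, x). G t x)"
      using smooth_on_imp_continuous_on[OF smX] smooth_on_imp_continuous_on[OF smG]
      by (auto elim!: continuous_on_subset)
    show "\<Phi> 0 x = x" if "x \<in> D2" for x using \<Phi>(1) that unfolding hamiltonian_flow_def by blast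
    show "\<Phi> t x \<in> D2" if "t \<in> {0..1}" "x \<in> D2" for t x using \<Phi>(1) that unfolding hamiltonian_flow_def by blast
  qed (use r C1(1) Gout vel in \<open>auto simp: C_def X_eq\<close>)
  then show ?thesis
    by (rule that) (auto simp: G_def \<Phi>(2))
qed

section \<open>The Calabi invariant\<close>

text \<open>The action \<open>A\<close> of a disc map is the compactly supported primitive of
  \<open>\<phi>\<^sup>*\<lambda> - \<lambda>\<close>, where \<open>\<lambda> = (q dp - p dq) / 2\<close>.\<close>

definition is_action :: "(real^2 \<Rightarrow> real^2) \<Rightarrow> (real^2 \<Rightarrow> real) \<Rightarrow> bool" where
  "is_action \<phi> A \<longleftrightarrow> (\<exists>r<1. \<forall>x\<in>D2. r < norm x \<longrightarrow> A x = 0) \<and>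
    (\<forall>x\<in>ball 0 1. \<exists>\<phi>'. (\<phi> has_derivative \<phi>') (at x) \<and>
       (A has_derivative (\<lambda>v. (Omega (\<phi> x) (\<phi>' v) - Omega x v) / 2)) (at x))"

text \<open>The map determines the differential of its action, so two actions differ by a constant
  on the disc, and this constant vanishes near the boundary. Hence the Calabi invariant does not
  depend on the Hamiltonian.\<close>

lemma is_action_unique:
  assumes "is_action \<phi> A" "is_action \<phi> B" "x \<in> D2"
  shows "A x = B x"
proof -
  obtain r where r: "r < 1" "\<And>x. x \<in> D2 \<Longrightarrow> r < norm x \<Longrightarrow> A x = 0"
    using assms(1) unfolding is_action_def by blast
  obtain s where s: "s < 1" "\<And>x. x \<in> D2 \<Longrightarrow> s < norm x \<Longrightarrow> B x = 0"
    using assms(2) unfolding is_action_def by blast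
  have "((\<lambda>x. A x - B x) has_derivative (\<lambda>h. 0)) (at x within ball 0 1)" if x: "x \<in> ball 0 1" for x
  proof -
    obtain \<phi>' where 1: "(\<phi> has_derivative \<phi>') (at x)" "(A has_derivative (\<lambda>v. (Omega (\<phi> x) (\<phi>' v) - Omega x v) / 2)) (at x)"
      using assms(1) x unfolding is_action_def by blast
    obtain \<phi>'' where 2: "(\<phi> has_derivative \<phi>'') (at x)" "(B has_derivative (\<lambda>v. (Omega (\<phi> x) (\<phi>'' v) - Omega x v) / 2)) (at x)"
      using assms(2) x unfolding is_action_def by blast
    have "\<phi>' = \<phi>''" using has_derivative_unique[OF 1(1) 2(1)] .
    then have "((\<lambda>x. A x - B x) has_derivative (\<lambda>h. 0)) (at x)"
      using has_derivative_diff[OF 1(2) 2(2)] by simp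
    then show ?thesis by (rule has_derivative_at_withinI)
  qed
  from has_derivative_zero_constant[OF convex_ball this] obtain c where c: "\<And>x. x \<in> ball 0 1 \<Longrightarrow> A x - B x = c" by auto
  \<comment> \<open>A radius below 1 beyond both supports; the maximum with 0 keeps it
    nonnegative.\<close>
  define m where "m = (max (max r s) 0 + 1) / 2"
  have m: "r < m" "s < m" "0 \<le> m" "m < 1" using r(1) s(1) by (auto simp: m_def)
  have "c = 0"
    using c[of "m *\<^sub>R axis 1 1"] r(2)[of "m *\<^sub>R axis 1 1"] s(2)[of "m *\<^sub>R axis 1 1"] m by (simp add: D2_def)
  show ?thesis
  proof (cases "norm x < 1")
    case True
    then show ?thesis using c[of x] \<open>c = 0\<close> by simp
  next
    case False
    then show ?thesis using r s assms(3) by simp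
  qed
qed

lemma hamiltonian_action:
  assumes H: "hamiltonian H" and \<phi>: "time_one_map H \<phi>"
  obtains A L r where "0 \<le> r" "r < 1" "is_action \<phi> A"
    "L-lipschitz_on D2 A" "L-lipschitz_on D2 \<phi>" "inj_on \<phi> D2" "\<phi> ` D2 \<subseteq> D2"
    "\<And>x. x \<in> D2 \<Longrightarrow> r < norm x \<Longrightarrow> \<phi> x = x \<and> A x = 0"
    "(LINT t:{0..1}|lborel. (LINT x:D2|lborel. H t x)) = integral D2 A / 2"
proof -
  obtain X X' H' \<Phi> C r where fl: "disc_flow X X' H' \<Phi> C r" and H': "\<And>t x. x \<in> D2 \<Longrightarrow> H' t x = H t x"
    and \<Phi>: "\<And>x. x \<in> D2 \<Longrightarrow> \<phi> x = \<Phi> 1 x"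
    by (rule hamiltonian_imp_disc_flow[OF H \<phi>]) (erule that; simp)
  interpret disc_flow X X' H' \<Phi> C r by (rule fl)
  have one: "(1::real) \<in> {0..1}" by simp
  define L where "L = max (3 * C * K) K"
  have ia: "is_action \<phi> action"
    unfolding is_action_def
  proof (intro conjI ballI)
    show "\<exists>r<1. \<forall>x\<in>D2. r < norm x \<longrightarrow> action x = 0"
      using r(2) action_outside by blast
    fix x :: "real^2" assume x: "x \<in> ball 0 1"
    have "(\<phi> has_derivative M x 1) (at x)"
      by (rule has_derivative_transform_within_open[OF has_derivative_\<Phi>[OF x one] open_ball x])
        (use \<Phi> ball_subset_D2 in auto)
    moreover have "(action has_derivative (\<lambda>v. (Omega (\<phi> x) (M x 1 v) - Omega x v) / 2)) (at x)"
      using has_derivative_action[OF x] \<Phi>[OF ball_subset_D2[OF x]] by simp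
    ultimately show "\<exists>\<phi>'. (\<phi> has_derivative \<phi>') (at x) \<and>
       (action has_derivative (\<lambda>v. (Omega (\<phi> x) (\<phi>' v) - Omega x v) / 2)) (at x)" by blast
  qed
  have "L-lipschitz_on D2 action" by (rule lipschitz_on_le[OF action_lipschitz]) (simp add: L_def)
  moreover have "K-lipschitz_on D2 \<phi>"
    using \<Phi>_lipschitz[OF one] by (intro lipschitz_onI) (auto simp: \<Phi> dist_norm)
  then have "L-lipschitz_on D2 \<phi>" by (rule lipschitz_on_le) (simp add: L_def)
  moreover have "inj_on \<phi> D2" using \<Phi>_inj[OF one] \<Phi> by (simp cong: inj_on_cong)
  moreover have "\<phi> ` D2 \<subseteq> D2" using \<Phi>_D2[OF one] \<Phi> by auto
  moreover have "\<phi> x = x \<and> action x = 0" if "x \<in> D2" "r < norm x" for x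
    using \<Phi>_outside[OF that one] \<Phi>[OF that(1)] action_outside[OF that] by simp
  moreover have "(LINT t:{0..1}|lborel. (LINT x:D2|lborel. H t x)) = integral D2 action / 2"
  proof -
    have "(LINT x:D2|lborel. H t x) = (LINT x:D2|lborel. H' t x)" for t
      by (rule set_lebesgue_integral_cong) (auto simp: H' D2_def)
    then show ?thesis using calabi_eq_action by simp
  qed
  ultimately show ?thesis using that[OF r ia] by blast
qed

text \<open>All Hamiltonians generating \<open>\<phi>\<close> give the same number by uniqueness of
  the action, so the definite description in \<open>Cal\<close> denotes.\<close>

lemma Cal_eq_action:
  assumes \<phi>: "\<phi> \<in> Ham_D2" and A: "is_action \<phi> A"
  shows "Cal \<phi> = integral D2 A / 2"
proof -
  have eq: "(LINT t:{0..1}|lborel. (LINT x:D2|lborel. H t x)) = integral D2 A / 2"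
    if H: "hamiltonian H" "time_one_map H \<phi>" for H
  proof -
    obtain B L r where B: "is_action \<phi> B" "(LINT t:{0..1}|lborel. (LINT x:D2|lborel. H t x)) = integral D2 B / 2"
      by (rule hamiltonian_action[OF H]) (rule that, assumption+)
    have "integral D2 B = integral D2 A"
      by (rule integral_cong) (rule is_action_unique[OF B(1) A])
    then show ?thesis using B(2) by simp
  qed
  obtain H where H: "hamiltonian H" "time_one_map H \<phi>" using \<phi> unfolding Ham_D2_def by blast
  show ?thesis
    unfolding Cal_def
  proof (rule the_equality)
    show "\<exists>H. hamiltonian H \<and> time_one_map H \<phi> \<and>
      integral D2 A / 2 = (LINT t:{0..1}|lborel. (LINT x:D2|lborel. H t x))"
      using H eq[OF H] by (intro exI[of _ H]) simp
  qed (use eq in auto)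
qed

section \<open>Stereographic projection\<close>

text \<open>Projection from the south pole. The closed upper hemisphere corresponds to the closed
  unit disc, and the projection stays differentiable and Lipschitz up to the equator.\<close>

definition stereo :: "real^3 \<Rightarrow> real^2" where
  "stereo u = vector [u $ 1 / (1 + u $ 3), u $ 2 / (1 + u $ 3)]"

definition unstereo :: "real^2 \<Rightarrow> real^3" where
  "unstereo z = vector [2 * z $ 1 / (1 + (z $ 1)\<^sup>2 + (z $ 2)\<^sup>2), 2 * z $ 2 / (1 + (z $ 1)\<^sup>2 + (z $ 2)\<^sup>2),
     2 / (1 + (z $ 1)\<^sup>2 + (z $ 2)\<^sup>2) - 1]"

text \<open>The derivative of \<open>unstereo\<close> at \<open>z\<close>; \<open>k\<close> is the
  conformal factor of inverse stereographic projection and \<open>s\<close> the inner product of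
  \<open>z\<close> and \<open>w\<close>.\<close>

definition dunstereo :: "real^2 \<Rightarrow> real^2 \<Rightarrow> real^3" where
  "dunstereo z w = (let k = 2 / (1 + (z $ 1)\<^sup>2 + (z $ 2)\<^sup>2); s = z $ 1 * w $ 1 + z $ 2 * w $ 2 in
     vector [k * (w $ 1 - k * z $ 1 * s), k * (w $ 2 - k * z $ 2 * s), - k\<^sup>2 * s])"

lemma S2_iff: "u \<in> S2 \<longleftrightarrow> (u $ 1)\<^sup>2 + (u $ 2)\<^sup>2 + (u $ 3)\<^sup>2 = 1"
proof -
  have "norm u \<noteq> - 1" using norm_ge_zero[of u] by linarith
  then have "u \<in> S2 \<longleftrightarrow> (norm u)\<^sup>2 = 1" by (auto simp: S2_def power2_eq_1_iff)
  then show ?thesis by (simp add: norm_vec_def L2_set_def sum_3 sum_nonneg)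
qed

lemma norm_le_1_iff: "norm z \<le> 1 \<longleftrightarrow> (z $ 1)\<^sup>2 + (z $ 2)\<^sup>2 \<le> 1" for z :: "real^2"
  by (simp add: norm_vec_def L2_set_def sum_2)

lemma stereo_in_disc:
  assumes "u \<in> S2" "0 \<le> u $ 3"
  shows "norm (stereo u) \<le> 1"
proof -
  have "(u $ 1)\<^sup>2 + (u $ 2)\<^sup>2 = (1 - u $ 3) * (1 + u $ 3)"
    using assms(1) by (simp add: S2_iff algebra_simps power2_eq_square)
  also have "\<dots> \<le> (1 + u $ 3) * (1 + u $ 3)" using assms(2) by (intro mult_right_mono) auto
  finally have "((u $ 1)\<^sup>2 + (u $ 2)\<^sup>2) / (1 + u $ 3)\<^sup>2 \<le> 1"
    using assms(2) by (simp add: divide_le_eq power2_eq_square)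
  then show ?thesis
    by (simp add: norm_le_1_iff stereo_def power_divide add_divide_distrib)
qed

lemma unstereo_stereo:
  assumes "u \<in> S2" "0 \<le> u $ 3"
  shows "unstereo (stereo u) = u"
proof -
  have n: "1 + u $ 3 \<noteq> 0" using assms(2) by simp
  have "(u $ 1)\<^sup>2 + (u $ 2)\<^sup>2 = (1 - u $ 3) * (1 + u $ 3)"
    using assms(1) by (simp add: S2_iff algebra_simps power2_eq_square)
  then have "(u $ 1 / (1 + u $ 3))\<^sup>2 + (u $ 2 / (1 + u $ 3))\<^sup>2 = (1 - u $ 3) / (1 + u $ 3)"
    using n by (simp add: power_divide add_divide_distrib[symmetric] power2_eq_square)
  then have N: "1 + (stereo u $ 1)\<^sup>2 + (stereo u $ 2)\<^sup>2 = 2 / (1 + u $ 3)"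
    using n by (simp add: stereo_def field_simps)
  show ?thesis
    unfolding unstereo_def N using n by (simp add: stereo_def vec_eq_iff forall_3 add_divide_distrib)
qed

lemma unstereo_hemisphere:
  assumes "norm z \<le> 1"
  shows "unstereo z \<in> S2" "0 \<le> unstereo z $ 3" "stereo (unstereo z) = z"
proof -
  define N where "N = 1 + (z $ 1)\<^sup>2 + (z $ 2)\<^sup>2"
  have N: "N > 0" "N \<le> 2" using assms by (auto simp: N_def norm_le_1_iff add_pos_nonneg)
  have u: "unstereo z = vector [2 * z $ 1 / N, 2 * z $ 2 / N, 2 / N - 1]" by (simp add: unstereo_def N_def)
  have "(2 * z $ 1 / N)\<^sup>2 + (2 * z $ 2 / N)\<^sup>2 + (2 / N - 1)\<^sup>2 = 4 * (1 + (z $ 1)\<^sup>2 + (z $ 2)\<^sup>2) / N\<^sup>2 - 4 / N + 1"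
    using N by (simp add: field_simps power2_eq_square)
  also have "\<dots> = 1" unfolding N_def[symmetric] using N by (simp add: power2_eq_square)
  finally show "unstereo z \<in> S2" by (simp add: S2_iff u)
  show "0 \<le> unstereo z $ 3" using N by (simp add: u field_simps)
  show "stereo (unstereo z) = z" using N by (simp add: u stereo_def vec_eq_iff forall_2)
qed

lemma has_derivative_vector_3:
  assumes "(f1 has_derivative f1') F" "(f2 has_derivative f2') F" "(f3 has_derivative f3') F"
  shows "((\<lambda>x. vector [f1 x, f2 x, f3 x] :: real^3) has_derivative (\<lambda>v. vector [f1' v, f2' v, f3' v])) F"
proof -
  have "(vector [a, b, c] :: real^3) = a *\<^sub>R axis 1 1 + b *\<^sub>R axis 2 1 + c *\<^sub>R axis 3 1" for a b c :: real
    by (simp add: vec_eq_iff forall_3 axis_def)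
  then show ?thesis using assms by (auto intro!: derivative_eq_intros)
qed

lemma has_derivative_unstereo: "(unstereo has_derivative dunstereo z) (at z)"
proof -
  let ?N = "\<lambda>z::real^2. 1 + (z $ 1)\<^sup>2 + (z $ 2)\<^sup>2"
  have N: "?N z > 0" by (simp add: add_pos_nonneg)
  have c: "((\<lambda>z::real^2. z $ i) has_derivative (\<lambda>w. w $ i)) (at z)" for i
    by (rule bounded_linear_imp_has_derivative[OF bounded_linear_vec_nth])
  have dN: "(?N has_derivative (\<lambda>w. 2 * (z $ 1 * w $ 1 + z $ 2 * w $ 2))) (at z)"
    by (auto intro!: derivative_eq_intros c simp: algebra_simps)
  define k where "k = 2 / ?N z"
  have "((\<lambda>x. 2 / x) has_real_derivative - (2 / (?N z)\<^sup>2)) (at (?N z))"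
    using N by (auto intro!: derivative_eq_intros simp: power2_eq_square)
  from has_derivative_compose[OF dN this[unfolded has_field_derivative_def]]
  have inv: "((\<lambda>z. 2 / ?N z) has_derivative (\<lambda>w. - k\<^sup>2 * (z $ 1 * w $ 1 + z $ 2 * w $ 2))) (at z)"
    by (simp add: k_def power_divide)
  have "((\<lambda>z. vector [z $ 1 * (2 / ?N z), z $ 2 * (2 / ?N z), 2 / ?N z - 1] :: real^3) has_derivative
     (\<lambda>w. vector [z $ 1 * (- k\<^sup>2 * (z $ 1 * w $ 1 + z $ 2 * w $ 2)) + w $ 1 * (2 / ?N z),
        z $ 2 * (- k\<^sup>2 * (z $ 1 * w $ 1 + z $ 2 * w $ 2)) + w $ 2 * (2 / ?N z),
        - k\<^sup>2 * (z $ 1 * w $ 1 + z $ 2 * w $ 2) - 0])) (at z)"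
    by (intro has_derivative_vector_3 has_derivative_mult has_derivative_diff c inv has_derivative_const)
  moreover have "(\<lambda>z. vector [z $ 1 * (2 / ?N z), z $ 2 * (2 / ?N z), 2 / ?N z - 1] :: real^3) = unstereo"
    by (simp add: unstereo_def fun_eq_iff mult.commute)
  moreover have "vector [z $ 1 * (- k\<^sup>2 * (z $ 1 * w $ 1 + z $ 2 * w $ 2)) + w $ 1 * k,
        z $ 2 * (- k\<^sup>2 * (z $ 1 * w $ 1 + z $ 2 * w $ 2)) + w $ 2 * k,
        - k\<^sup>2 * (z $ 1 * w $ 1 + z $ 2 * w $ 2) - 0] = dunstereo z w" for w
    unfolding dunstereo_def Let_def k_def[symmetric]
    by (simp add: vec_eq_iff forall_3 algebra_simps power2_eq_square)
  ultimately show ?thesis by (simp add: k_def)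
qed

text \<open>A conformal map scales area by the square of its conformal factor; the 1/2 is the
  normalisation of \<open>omega\<close>. Later the sign of the factor is what counts.\<close>

lemma omega_dunstereo:
  "omega (unstereo z) (dunstereo z v) (dunstereo z w) = (2 / (1 + (z $ 1)\<^sup>2 + (z $ 2)\<^sup>2))\<^sup>2 / 2 * Omega v w"
proof -
  define k where "k = 2 / (1 + (z $ 1)\<^sup>2 + (z $ 2)\<^sup>2)"
  have k: "k * (1 + (z $ 1)\<^sup>2 + (z $ 2)\<^sup>2) = 2"
  proof -
    have "1 + (z $ 1)\<^sup>2 + (z $ 2)\<^sup>2 \<noteq> 0" by (simp add: add_pos_nonneg less_imp_neq[symmetric])
    then show ?thesis unfolding k_def by (metis nonzero_eq_divide_eq)
  qed
  have u: "unstereo z = vector [k * z $ 1, k * z $ 2, k - 1]"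
    by (simp add: unstereo_def k_def)
  have "unstereo z \<bullet> cross3 (dunstereo z v) (dunstereo z w)
    = k\<^sup>2 * Omega v w * (k * (1 + (z $ 1)\<^sup>2 + (z $ 2)\<^sup>2) - 1)"
    unfolding u dunstereo_def Let_def k_def[symmetric] Omega_def
    by (simp add: inner_vec_def sum_3 cross3_def) (simp add: algebra_simps power2_eq_square)
  also have "\<dots> = k\<^sup>2 * Omega v w" unfolding k by simp
  finally have "unstereo z \<bullet> cross3 (dunstereo z v) (dunstereo z w) = k\<^sup>2 * Omega v w" .
  then show ?thesis by (simp add: omega_def k_def)
qed

text \<open>The three components contribute 3, 3 and 2. The bound is crude, but it does not depend
  on \<open>z\<close>.\<close>

lemma norm_dunstereo_le: "norm (dunstereo z w) \<le> 8 * norm w"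
proof -
  define N where "N = 1 + (z $ 1)\<^sup>2 + (z $ 2)\<^sup>2"
  define k where "k = 2 / N"
  define s where "s = z $ 1 * w $ 1 + z $ 2 * w $ 2"
  have nz: "(norm z)\<^sup>2 = (z $ 1)\<^sup>2 + (z $ 2)\<^sup>2" by (simp add: norm_vec_def L2_set_def sum_2 sum_nonneg)
  have N: "N = 1 + (norm z)\<^sup>2" by (simp add: N_def nz)
  have N1: "N \<ge> 1" "N > 0" by (auto simp: N add_pos_nonneg)
  have k: "0 < k" "k \<le> 2" using N1 by (auto simp: k_def divide_le_eq)
  have kz: "k * norm z \<le> 1"
    using N1 sum_squares_bound[of 1 "norm z"] by (simp add: k_def N divide_le_eq)
  have s: "\<bar>s\<bar> \<le> norm z * norm w"
    using Cauchy_Schwarz_ineq2[of z w] by (simp add: s_def inner_vec_def sum_2)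
  have ks: "\<bar>k * s\<bar> \<le> norm w"
  proof -
    have "k * \<bar>s\<bar> \<le> k * (norm z * norm w)" using s k by (intro mult_left_mono) auto
    also have "\<dots> = (k * norm z) * norm w" by simp
    also have "\<dots> \<le> 1 * norm w" using kz by (intro mult_right_mono) auto
    finally show ?thesis using k by (simp add: abs_mult)
  qed
  have c: "\<bar>k * (w $ i - k * z $ i * s)\<bar> \<le> 3 * norm w" for i
  proof -
    have "\<bar>k * z $ i\<bar> \<le> 1"
      using component_le_norm_cart[of z i] kz k by (simp add: abs_mult) (meson mult_left_mono order_trans less_imp_le)
    then have "\<bar>k * z $ i\<bar> * \<bar>k * s\<bar> \<le> 1 * norm w" using ks by (intro mult_mono) auto
    moreover have "k * \<bar>w $ i\<bar> \<le> 2 * norm w" using component_le_norm_cart[of w i] k by (intro mult_mono) auto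
    moreover have "k * (w $ i - k * z $ i * s) = k * w $ i - (k * z $ i) * (k * s)" by (simp add: algebra_simps)
    ultimately show ?thesis
      using abs_triangle_ineq4[of "k * w $ i" "(k * z $ i) * (k * s)"] k by (simp add: abs_mult)
  qed
  have c3: "\<bar>- k\<^sup>2 * s\<bar> \<le> 2 * norm w"
  proof -
    have "\<bar>- k\<^sup>2 * s\<bar> = k * \<bar>k * s\<bar>" using k by (simp add: abs_mult power2_eq_square)
    also have "\<dots> \<le> 2 * norm w" using ks k by (intro mult_mono) auto
    finally show ?thesis .
  qed
  have "dunstereo z w = vector [k * (w $ 1 - k * z $ 1 * s), k * (w $ 2 - k * z $ 2 * s), - k\<^sup>2 * s]"
    by (simp add: dunstereo_def k_def s_def N_def Let_def)
  then have "norm (dunstereo z w) \<le> \<bar>k * (w $ 1 - k * z $ 1 * s)\<bar> + \<bar>k * (w $ 2 - k * z $ 2 * s)\<bar> + \<bar>- k\<^sup>2 * s\<bar>"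
    using norm_le_l1_cart[of "dunstereo z w"] by (simp add: sum_3)
  then show ?thesis using c[of 1] c[of 2] c3 by linarith
qed

lemma linear_dunstereo: "linear (dunstereo z)"
  using has_derivative_unstereo has_derivative_linear by blast

lemma stereo_eq: "stereo u = (u $ 1 / (1 + u $ 3)) *\<^sub>R axis 1 1 + (u $ 2 / (1 + u $ 3)) *\<^sub>R axis 2 1"
  by (simp add: stereo_def vec_eq_iff forall_2 axis_def)

lemma stereo_differentiable:
  assumes "0 \<le> u $ 3"
  shows "stereo differentiable (at u)"
proof -
  have c: "((\<lambda>u::real^3. u $ i) has_derivative (\<lambda>w. w $ i)) (at u)" for i
    by (rule bounded_linear_imp_has_derivative[OF bounded_linear_vec_nth])
  have "(\<lambda>u::real^3. u $ i) differentiable (at u)" for i using c by (rule differentiableI)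
  then have "(\<lambda>u::real^3. u $ i / (1 + u $ 3)) differentiable (at u)" for i
    using assms by (intro differentiable_divide differentiable_add differentiable_const) auto
  then have "(\<lambda>u. (u $ 1 / (1 + u $ 3)) *\<^sub>R axis 1 1 + (u $ 2 / (1 + u $ 3)) *\<^sub>R axis 2 1 :: real^2) differentiable (at u)"
    by (intro differentiable_add differentiable_scaleR differentiable_const)
  then show ?thesis by (simp add: stereo_eq[abs_def])
qed

text \<open>On the upper hemisphere the denominators are at least 1, and each of the two components
  has Lipschitz constant 3.\<close>

lemma stereo_lipschitz: "6-lipschitz_on {u \<in> S2. 0 \<le> u $ 3} stereo"
proof (rule lipschitz_onI)
  fix u v assume "u \<in> {u \<in> S2. 0 \<le> u $ 3}" "v \<in> {u \<in> S2. 0 \<le> u $ 3}"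
  then have u: "norm u = 1" "0 \<le> u $ 3" and v: "norm v = 1" "0 \<le> v $ 3" by (auto simp: S2_def)
  have c: "\<bar>u $ i / (1 + u $ 3) - v $ i / (1 + v $ 3)\<bar> \<le> 3 * norm (u - v)" for i
  proof -
    have d: "\<bar>u $ j - v $ j\<bar> \<le> norm (u - v)" for j using component_le_norm_cart[of "u - v" j] by simp
    have b: "\<bar>u $ j\<bar> \<le> 1" "\<bar>v $ j\<bar> \<le> 1" for j
      using component_le_norm_cart[of u j] component_le_norm_cart[of v j] u v by auto
    have "u $ i / (1 + u $ 3) - v $ i / (1 + v $ 3)
      = ((u $ i - v $ i) + u $ i * (v $ 3 - u $ 3) + u $ 3 * (u $ i - v $ i)) / ((1 + u $ 3) * (1 + v $ 3))"
      using u v by (simp add: diff_frac_eq) (simp add: algebra_simps)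
    also have "\<bar>\<dots>\<bar> \<le> \<bar>(u $ i - v $ i) + u $ i * (v $ 3 - u $ 3) + u $ 3 * (u $ i - v $ i)\<bar> / 1"
    proof -
      have "1 * 1 \<le> (1 + u $ 3) * (1 + v $ 3)" using u v by (intro mult_mono) auto
      then show ?thesis unfolding abs_divide by (intro divide_left_mono) auto
    qed
    also have "\<dots> \<le> \<bar>u $ i - v $ i\<bar> + \<bar>u $ i\<bar> * \<bar>v $ 3 - u $ 3\<bar> + \<bar>u $ 3\<bar> * \<bar>u $ i - v $ i\<bar>"
      unfolding abs_mult[symmetric] div_by_1 by (intro abs_triangle_ineq[THEN order_trans] add_right_mono abs_triangle_ineq)
    also have "\<dots> \<le> norm (u - v) + 1 * norm (u - v) + 1 * norm (u - v)"
      using d[of 3] by (intro add_mono mult_mono d b) (auto simp: abs_minus_commute)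
    finally show ?thesis by simp
  qed
  have "norm (stereo u - stereo v) \<le> \<bar>(stereo u - stereo v) $ 1\<bar> + \<bar>(stereo u - stereo v) $ 2\<bar>"
    using norm_le_l1_cart[of "stereo u - stereo v"] by (simp add: sum_2)
  also have "\<dots> \<le> 3 * norm (u - v) + 3 * norm (u - v)"
    using c[of 1] c[of 2] by (simp add: stereo_def)
  finally show "dist (stereo u) (stereo v) \<le> 6 * dist u v" by (simp add: dist_norm)
qed simp

section \<open>The Darboux--Weinstein chart\<close>

lemma Ck_on_bounded_linear_compose:
  fixes f :: "'a::euclidean_space \<Rightarrow> 'b::euclidean_space"
  assumes "open S" "bounded_linear l" "Ck_on k S f"
  shows "Ck_on k S (\<lambda>x. l (f x))"
  by (rule Ck_on_compose[OF assms(1) subset_UNIV assms(3) Ck_on_bounded_linear[OF assms(2)]])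

lemma has_derivative_lipschitz_le:
  fixes f :: "'a::real_normed_vector \<Rightarrow> 'b::real_normed_vector"
  assumes S: "open S" "x \<in> S" and L: "L-lipschitz_on S f" and f: "(f has_derivative f') (at x)"
  shows "norm (f' v) \<le> L * norm v"
proof (rule field_le_epsilon)
  fix \<epsilon> :: real assume \<epsilon>: "0 < \<epsilon>"
  define n where "n = norm v + 1"
  have n: "0 < n" "norm v \<le> n" by (auto simp: n_def add_nonneg_pos)
  define \<epsilon>' where "\<epsilon>' = \<epsilon> / n"
  have \<epsilon>': "0 < \<epsilon>'" using \<epsilon> n by (simp add: \<epsilon>'_def)
  obtain d where d: "0 < d" "\<And>y. norm (y - x) < d \<Longrightarrow> norm (f y - f x - f' (y - x)) \<le> \<epsilon>' * norm (y - x)"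
    using f \<epsilon>' unfolding has_derivative_at_alt by blast
  obtain \<rho> where \<rho>: "0 < \<rho>" "ball x \<rho> \<subseteq> S" using S openE by blast
  define m where "m = min d \<rho>"
  have m: "0 < m" using d(1) \<rho>(1) by (simp add: m_def)
  define t where "t = m / (2 * n)"
  have t: "0 < t" using m n by (simp add: t_def)
  have "t * norm v \<le> t * n" using t n by simp
  also have "\<dots> < m" using n m by (simp add: t_def)
  finally have tv: "t * norm v < d" "t * norm v < \<rho>" by (auto simp: m_def)
  then have xS: "x + t *\<^sub>R v \<in> S" using \<rho>(2) t by (auto simp: dist_norm subset_iff)
  have 1: "norm (f (x + t *\<^sub>R v) - f x) \<le> L * (t * norm v)"
    using lipschitz_onD[OF L xS S(2)] t by (simp add: dist_norm)
  have 2: "norm (f (x + t *\<^sub>R v) - f x - f' (t *\<^sub>R v)) \<le> \<epsilon>' * (t * norm v)"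
    using d(2)[of "x + t *\<^sub>R v"] tv t by simp
  have "t * norm (f' v) = norm (f' (t *\<^sub>R v))"
    using t by (simp add: linear_cmul[OF has_derivative_linear[OF f]])
  also have "\<dots> \<le> norm (f (x + t *\<^sub>R v) - f x) + norm (f (x + t *\<^sub>R v) - f x - f' (t *\<^sub>R v))"
    by (metis norm_minus_commute norm_triangle_sub)
  also have "\<dots> \<le> L * (t * norm v) + \<epsilon>' * (t * norm v)" using 1 2 by (rule add_mono)
  also have "\<dots> = t * (L * norm v + \<epsilon>' * norm v)" by (simp add: algebra_simps)
  finally have "norm (f' v) \<le> L * norm v + \<epsilon>' * norm v" using t by simp
  also have "\<epsilon>' * norm v \<le> \<epsilon>' * n" using n \<epsilon>' by (intro mult_left_mono) auto
  also have "\<epsilon>' * n = \<epsilon>" using n by (simp add: \<epsilon>'_def)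
  finally show "norm (f' v) \<le> L * norm v + \<epsilon>" by simp
qed

locale disc_chart =
  fixes e :: "real^2 \<Rightarrow> real^3"
    and U V :: "((real^3) \<times> (real^3)) set"
    and \<Psi> :: "(real^3) \<times> (real^3) \<Rightarrow> (real^3) \<times> (real^3)"
  assumes e: "hemisphere_embedding e" and \<Psi>: "darboux_weinstein_chart U V \<Psi>"
begin

lemma e_smooth: "smooth_on D2 e"
  and e_bij: "bij_betw e D2 {y \<in> S2. y $ 3 \<ge> 0}"
  using e by (auto simp: hemisphere_embedding_def)

lemma e_inj: "inj_on e D2" using e_bij by (rule bij_betw_imp_inj_on)

lemma e_image: "e ` D2 = {y \<in> S2. y $ 3 \<ge> 0}" using e_bij by (rule bij_betw_imp_surj_on)

lemma e_in: "x \<in> D2 \<Longrightarrow> e x \<in> S2" "x \<in> D2 \<Longrightarrow> 0 \<le> e x $ 3"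
  using e_image by auto

definition De :: "real^2 \<Rightarrow> real^2 \<Rightarrow> real^3" where
  "De x = frechet_derivative e (at x)"

lemma e_Ck: "Ck_on k (ball 0 1) e"
  by (rule smooth_on_imp_Ck_on[OF e_smooth]) (auto simp: D2_def)

lemma e_deriv: "x \<in> ball 0 1 \<Longrightarrow> (e has_derivative De x) (at x)"
  unfolding De_def by (rule Ck_on_SucD(1)[OF e_Ck])

lemma omega_De:
  assumes "x \<in> ball 0 1"
  shows "omega (e x) (De x u) (De x v) = Omega u v"
proof -
  have xD: "x \<in> D2" using assms by (simp add: D2_def)
  obtain A where A: "(e has_derivative A) (at x within D2)" "\<And>u v. omega (e x) (A u) (A v) = Omega u v"
    using e xD unfolding hemisphere_embedding_def by blast
  have "at x within D2 = at x"
    by (rule at_within_interior) (use assms in \<open>simp add: D2_def\<close>)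
  then have "A = De x" using A(1) e_deriv[OF assms] has_derivative_unique by metis
  then show ?thesis using A(2) by simp
qed

text \<open>Differentiate \<open>e x \<bullet> e x = 1\<close>. Tangency matters because the chart
  is known to be symplectic on tangent vectors only.\<close>

lemma De_tangent:
  assumes "x \<in> ball 0 1"
  shows "De x u \<in> tangent_S2 (e x)"
proof -
  have "((\<lambda>x. e x \<bullet> e x) has_derivative (\<lambda>u. e x \<bullet> De x u + De x u \<bullet> e x)) (at x)"
    by (rule has_derivative_inner[OF e_deriv[OF assms] e_deriv[OF assms]])
  moreover have "((\<lambda>x. e x \<bullet> e x) has_derivative (\<lambda>u. 0)) (at x)"
  proof (rule has_derivative_transform_within_open[OF _ open_ball assms])
    show "((\<lambda>x. 1) has_derivative (\<lambda>u. 0)) (at x)" by simp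
    show "y \<in> ball 0 1 \<Longrightarrow> 1 = e y \<bullet> e y" for y
      using e_in(1)[of y] by (simp add: S2_def D2_def dot_square_norm)
  qed
  ultimately have "(\<lambda>u. e x \<bullet> De x u + De x u \<bullet> e x) = (\<lambda>u. 0)" by (rule has_derivative_unique)
  then have "e x \<bullet> De x u + De x u \<bullet> e x = 0" by metis
  then show ?thesis by (simp add: tangent_S2_def inner_commute)
qed

section \<open>The chart in disc coordinates\<close>

definition ee :: "(real^2) \<times> (real^2) \<Rightarrow> (real^3) \<times> (real^3)" where
  "ee z = (e (fst z), e (snd z))"

definition G :: "(real^2) \<times> (real^2) \<Rightarrow> (real^3) \<times> (real^3)" where
  "G z = \<Psi> (ee z)"

text \<open>An open convex neighbourhood of the diagonal: convexity serves the Poincare lemma and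
  turns derivative bounds into Lipschitz bounds. Its closed companion \<open>cnear\<close> supplies
  compactness, hence a Lipschitz constant for \<open>G\<close>.\<close>

definition near :: "real \<Rightarrow> ((real^2) \<times> (real^2)) set" where
  "near \<delta> = {z. fst z \<in> ball 0 1 \<and> snd z \<in> ball 0 1 \<and> norm (fst z - snd z) < \<delta>}"

definition cnear :: "real \<Rightarrow> ((real^2) \<times> (real^2)) set" where
  "cnear \<delta> = {z. fst z \<in> D2 \<and> snd z \<in> D2 \<and> norm (fst z - snd z) \<le> \<delta>}"

lemma near_subset: "near \<delta> \<subseteq> cnear \<delta>"
  by (auto simp: near_def cnear_def D2_def)

lemma open_near: "open (near \<delta>)"
proof -
  have "near \<delta> = ball 0 1 \<times> ball 0 1 \<inter> {z. norm (fst z - snd z) < \<delta>}" by (auto simp: near_def)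
  then show ?thesis
    by (simp add: open_Int open_Times open_Collect_less continuous_intros)
qed

lemma convex_near: "convex (near \<delta>)"
proof -
  have eq: "near \<delta> = ball 0 1 \<times> ball 0 1 \<inter> (\<lambda>z. fst z - snd z) -` ball 0 \<delta>"
    by (auto simp: near_def)
  have "linear (\<lambda>z::(real^2) \<times> (real^2). fst z - snd z)" by (rule linearI) (auto simp: algebra_simps)
  then show ?thesis unfolding eq
    by (intro convex_Int convex_Times convex_ball convex_linear_vimage)
qed

lemma compact_cnear: "compact (cnear \<delta>)"
proof -
  have "cnear \<delta> = D2 \<times> D2 \<inter> {z. norm (fst z - snd z) \<le> \<delta>}" by (auto simp: cnear_def)
  moreover have "closed {z::(real^2) \<times> (real^2). norm (fst z - snd z) \<le> \<delta>}"
    by (intro closed_Collect_le continuous_intros)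
  ultimately show ?thesis by (simp add: compact_Int_closed compact_Times D2_def)
qed

lemma ee_lipschitz: "\<exists>L. L-lipschitz_on (D2 \<times> D2) ee"
proof -
  obtain L where L: "L-lipschitz_on D2 e"
    using smooth_on_lipschitz_on[OF e_smooth, of D2] by (auto simp: D2_def)
  have 1: "L-lipschitz_on (D2 \<times> D2) (\<lambda>z. e (fst z))"
  proof (rule lipschitz_onI)
    fix z w assume "z \<in> D2 \<times> D2" "w \<in> D2 \<times> D2"
    then have "dist (e (fst z)) (e (fst w)) \<le> L * dist (fst z) (fst w)"
      by (intro lipschitz_onD[OF L]) auto
    also have "\<dots> \<le> L * dist z w"
      using lipschitz_on_nonneg[OF L] by (intro mult_left_mono dist_fst_le)
    finally show "dist (e (fst z)) (e (fst w)) \<le> L * dist z w" .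
  qed (rule lipschitz_on_nonneg[OF L])
  have 2: "L-lipschitz_on (D2 \<times> D2) (\<lambda>z. e (snd z))"
  proof (rule lipschitz_onI)
    fix z w assume "z \<in> D2 \<times> D2" "w \<in> D2 \<times> D2"
    then have "dist (e (snd z)) (e (snd w)) \<le> L * dist (snd z) (snd w)"
      by (intro lipschitz_onD[OF L]) auto
    also have "\<dots> \<le> L * dist z w"
      using lipschitz_on_nonneg[OF L] by (intro mult_left_mono dist_snd_le)
    finally show "dist (e (snd z)) (e (snd w)) \<le> L * dist z w" .
  qed (rule lipschitz_on_nonneg[OF L])
  show ?thesis
    unfolding ee_def[abs_def] using lipschitz_on_Pair[OF 1 2] by blast
qed

lemma U_open: "openin (top_of_set (S2 \<times> S2)) U" and U_diag: "x \<in> S2 \<Longrightarrow> (x, x) \<in> U"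
  and \<Psi>_diag: "x \<in> S2 \<Longrightarrow> \<Psi> (x, x) = (x, 0)" and \<Psi>_smooth: "smooth_on U \<Psi>"
  and \<Psi>_into: "z \<in> U \<Longrightarrow> fst (\<Psi> z) \<in> S2"
proof -
  have *: "bij_betw \<Psi> U V" "openin (top_of_set T_star_S2) V" using \<Psi> by (auto simp: darboux_weinstein_chart_def)
  show "fst (\<Psi> z) \<in> S2" if "z \<in> U"
    using bij_betw_apply[OF *(1) that] openin_imp_subset[OF *(2)] by (auto simp: T_star_S2_def)
qed (use \<Psi> in \<open>auto simp: darboux_weinstein_chart_def\<close>)

lemma G_diag: "y \<in> D2 \<Longrightarrow> G (y, y) = (e y, 0)"
  by (simp add: G_def ee_def \<Psi>_diag e_in)

text \<open>The diagonal of the sphere is compact, so \<open>U\<close> contains all points of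
  \<open>S2 \<times> S2\<close> within some fixed distance of it, and \<open>ee\<close> is
  Lipschitz.\<close>

lemma cnear_chart: "\<exists>\<delta>>0. ee ` cnear \<delta> \<subseteq> U"
proof -
  obtain W where W: "open W" "U = S2 \<times> S2 \<inter> W"
    using U_open unfolding openin_open by (elim exE conjE) (rule that)
  let ?D = "(\<lambda>x. (x, x)) ` S2"
  have cD: "compact ?D" unfolding S2_def by (intro compact_continuous_image continuous_intros) auto
  have DW: "?D \<subseteq> W" using W(2) U_diag by auto
  obtain \<epsilon> where \<epsilon>: "\<epsilon> > 0" "(\<Union>x\<in>?D. ball x \<epsilon>) \<subseteq> W"
    by (rule compact_subset_open_imp_ball_epsilon_subset[OF cD W(1) DW]) (rule that)
  obtain L where L: "L-lipschitz_on (D2 \<times> D2) ee" using ee_lipschitz by blast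
  note L0 = lipschitz_on_nonneg[OF L]
  define \<delta> where "\<delta> = \<epsilon> / (L + 1) / 2"
  have \<delta>: "\<delta> > 0" "L * \<delta> < \<epsilon>" using \<epsilon>(1) L0 mult_nonneg_nonneg[OF L0 less_imp_le[OF \<epsilon>(1)]]
    by (auto simp: \<delta>_def field_simps add_nonneg_pos)
  have "ee z \<in> U" if z: "z \<in> cnear \<delta>" for z
  proof -
    have zD: "fst z \<in> D2" "snd z \<in> D2" "norm (fst z - snd z) \<le> \<delta>" using z by (auto simp: cnear_def)
    have "dist (ee (snd z, snd z)) (ee z) \<le> L * dist (snd z, snd z) z"
      by (rule lipschitz_onD[OF L]) (use zD in \<open>auto simp: mem_Times_iff\<close>)
    also have "dist (snd z, snd z) z = norm (fst z - snd z)"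
      by (cases z) (simp add: dist_Pair_Pair dist_norm norm_minus_commute)
    also have "L * norm (fst z - snd z) \<le> L * \<delta>" using zD L0 by (intro mult_left_mono) auto
    finally have "ee z \<in> ball (ee (snd z, snd z)) \<epsilon>" using \<delta> by simp
    moreover have "ee (snd z, snd z) \<in> ?D" using zD e_in by (auto simp: ee_def)
    ultimately have "ee z \<in> W" using \<epsilon>(2) by blast
    then show ?thesis using W(2) zD e_in by (auto simp: ee_def)
  qed
  then show ?thesis using \<delta>(1) by blast
qed

context
  fixes \<delta> assumes \<delta>: "0 < \<delta>" "ee ` cnear \<delta> \<subseteq> U"
begin

lemma ee_near: "z \<in> near \<delta> \<Longrightarrow> ee z \<in> U"
  using near_subset \<delta>(2) by blast

lemma G_lipschitz: "\<exists>L. L-lipschitz_on (cnear \<delta>) G"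
proof -
  obtain L where L: "L-lipschitz_on (D2 \<times> D2) ee" using ee_lipschitz by blast
  have L': "L-lipschitz_on (cnear \<delta>) ee"
    by (rule lipschitz_on_subset[OF L]) (auto simp: cnear_def)
  have "compact (ee ` cnear \<delta>)"
    by (rule compact_continuous_image[OF lipschitz_on_continuous_on[OF L'] compact_cnear])
  then obtain M where "M-lipschitz_on (ee ` cnear \<delta>) \<Psi>"
    using smooth_on_lipschitz_on[OF \<Psi>_smooth _ \<delta>(2)] by blast
  then show ?thesis unfolding G_def[abs_def] using lipschitz_on_compose2[OF L'] by blast
qed

lemma ee_Ck: "Ck_on k (near \<delta>) ee"
proof -
  have "Ck_on k (near \<delta>) (\<lambda>z. e (fst z))" "Ck_on k (near \<delta>) (\<lambda>z. e (snd z))"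
    by (rule Ck_on_compose[OF open_near _ Ck_on_bounded_linear[OF bounded_linear_fst] e_Ck]
          Ck_on_compose[OF open_near _ Ck_on_bounded_linear[OF bounded_linear_snd] e_Ck]; auto simp: near_def)+
  note c = this[THEN Ck_on_bounded_linear_compose[OF open_near _, rotated]]
  have "Ck_on k (near \<delta>) (\<lambda>z. (e (fst z), 0) + (0, e (snd z)) :: (real^3) \<times> (real^3))"
    by (rule Ck_on_add[OF open_near c(1)[OF bounded_linear_Pair[OF bounded_linear_ident bounded_linear_zero]]
          c(2)[OF bounded_linear_Pair[OF bounded_linear_zero bounded_linear_ident]]])
  then show ?thesis by (simp add: ee_def[abs_def])
qed

lemma G_Ck: "Ck_on k (near \<delta>) G"
proof (rule Ck_on_local[OF open_near])
  fix z assume z: "z \<in> near \<delta>"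
  have zU: "ee z \<in> U" using z by (rule ee_near)
  obtain O1 g where g: "open O1" "ee z \<in> O1" "\<forall>k. Ck_on k O1 g" "\<forall>y\<in>O1 \<inter> U. g y = \<Psi> y"
    by (rule smooth_onE[OF \<Psi>_smooth zU]) (rule that)
  let ?W = "near \<delta> \<inter> ee -` O1"
  have oW: "open ?W"
    by (rule continuous_open_preimage[OF Ck_on_imp_continuous_on[OF ee_Ck] open_near g(1)])
  have "Ck_on k ?W (\<lambda>w. g (ee w))"
    by (rule Ck_on_compose[OF oW _ Ck_on_subset[OF ee_Ck] g(3)[rule_format]]) auto
  moreover have "Ck_on k ?W (\<lambda>w. g (ee w)) \<longleftrightarrow> Ck_on k ?W G"
    by (rule Ck_on_cong[OF oW]) (use g(4) ee_near in \<open>auto simp: G_def\<close>)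
  ultimately have "Ck_on k ?W G" by simp
  moreover have "?W \<inter> near \<delta> = ?W" by blast
  ultimately show "\<exists>W. open W \<and> z \<in> W \<and> Ck_on k (W \<inter> near \<delta>) G"
    using oW z g(2) by (intro exI[of _ ?W]) auto
qed

definition DG :: "(real^2) \<times> (real^2) \<Rightarrow> (real^2) \<times> (real^2) \<Rightarrow> (real^3) \<times> (real^3)" where
  "DG z = frechet_derivative G (at z)"

lemma G_deriv: "z \<in> near \<delta> \<Longrightarrow> (G has_derivative DG z) (at z)"
  unfolding DG_def by (rule Ck_on_SucD(1)[OF G_Ck])

text \<open>The chart is symplectic and the embedding preserves area, so \<open>G\<close> pulls the
  canonical form back to \<open>\<Omega> \<oplus> -\<Omega>\<close>. The chart is differentiated
  within \<open>U\<close>; this suffices for the chain rule because \<open>ee\<close> maps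
  \<open>near \<delta>\<close> into \<open>U\<close> and its derivative takes tangent
  values.\<close>

lemma omega_can_DG:
  assumes z: "z \<in> near \<delta>"
  shows "omega_can (DG z \<xi>) (DG z \<eta>) = Omega (fst \<xi>) (fst \<eta>) - Omega (snd \<xi>) (snd \<eta>)"
proof -
  have zb: "fst z \<in> ball 0 1" "snd z \<in> ball 0 1" using z by (auto simp: near_def)
  have zU: "ee z \<in> U" using z by (rule ee_near)
  obtain A where A: "(\<Psi> has_derivative A) (at (ee z) within U)"
    "\<And>\<xi> \<eta>. \<xi> \<in> tangent_S2 (fst (ee z)) \<times> tangent_S2 (snd (ee z)) \<Longrightarrow>
       \<eta> \<in> tangent_S2 (fst (ee z)) \<times> tangent_S2 (snd (ee z)) \<Longrightarrow>
       omega_can (A \<xi>) (A \<eta>) = omega2 (ee z) \<xi> \<eta>"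
    using \<Psi> zU unfolding darboux_weinstein_chart_def by blast
  let ?d = "\<lambda>\<xi>. (De (fst z) (fst \<xi>), De (snd z) (snd \<xi>))"
  have "(ee has_derivative ?d) (at z)"
  proof -
    have "((\<lambda>z. e (fst z)) has_derivative (\<lambda>\<xi>. De (fst z) (fst \<xi>))) (at z)"
      by (rule has_derivative_compose[OF has_derivative_fst[OF has_derivative_ident] e_deriv[OF zb(1)]])
    moreover have "((\<lambda>z. e (snd z)) has_derivative (\<lambda>\<xi>. De (snd z) (snd \<xi>))) (at z)"
      by (rule has_derivative_compose[OF has_derivative_snd[OF has_derivative_ident] e_deriv[OF zb(2)]])
    ultimately show ?thesis unfolding ee_def[abs_def] by (rule has_derivative_Pair)
  qed
  then have "(ee has_derivative ?d) (at z within near \<delta>)" by (rule has_derivative_at_withinI)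
  moreover have "(\<Psi> has_derivative A) (at (ee z) within ee ` near \<delta>)"
    by (rule has_derivative_subset[OF A(1)]) (use ee_near in blast)
  ultimately have "((\<lambda>z. \<Psi> (ee z)) has_derivative (\<lambda>\<xi>. A (?d \<xi>))) (at z within near \<delta>)"
    by (rule has_derivative_in_compose)
  then have "(G has_derivative (\<lambda>\<xi>. A (?d \<xi>))) (at z)"
    using at_within_open[OF z open_near] by (simp add: G_def[abs_def])
  then have "DG z = (\<lambda>\<xi>. A (?d \<xi>))" using G_deriv[OF z] has_derivative_unique by blast
  then have "omega_can (DG z \<xi>) (DG z \<eta>) = omega2 (ee z) (?d \<xi>) (?d \<eta>)"
    using A(2)[of "?d \<xi>" "?d \<eta>"] De_tangent zb by (simp add: ee_def)
  then show ?thesis by (simp add: omega2_def ee_def omega_De[OF zb(1)] omega_De[OF zb(2)])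
qed

text \<open>The form \<open>\<Psi>\<^sup>*(p dx) + \<lambda> \<oplus> (-\<lambda>)\<close> is closed, hence has a primitive \<open>R\<close> near the
  diagonal; it vanishes on the diagonal because the chart maps the diagonal to the zero section.\<close>

lemma generating_primitive:
  obtains R C where "0 \<le> C"
    "\<And>z. z \<in> near \<delta> \<Longrightarrow> (R has_derivative
       (\<lambda>\<zeta>. snd (G z) \<bullet> fst (DG z \<zeta>) + (Omega (fst z) (fst \<zeta>) - Omega (snd z) (snd \<zeta>)) / 2)) (at z)"
    "C-lipschitz_on (near \<delta>) R" "\<And>y. y \<in> ball 0 1 \<Longrightarrow> R (y, y) = 0"
proof -
  interpret O: bounded_bilinear Omega by (rule bounded_bilinear_Omega)
  define \<beta> where "\<beta> z \<zeta> = snd (G z) \<bullet> fst (DG z \<zeta>) + (Omega (fst z) (fst \<zeta>) - Omega (snd z) (snd \<zeta>)) / 2" for z \<zeta>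
  have bl: "bounded_linear (DG z)" if "z \<in> near \<delta>" for z
    using has_derivative_bounded_linear[OF G_deriv[OF that]] .
  have bl1: "bounded_linear (\<lambda>\<zeta>. snd (G z) \<bullet> fst (DG z \<zeta>))" if "z \<in> near \<delta>" for z
    by (rule bounded_linear_compose[OF bounded_linear_inner_right bounded_linear_compose[OF bounded_linear_fst bl[OF that]]])
  have bl2: "bounded_linear (\<lambda>\<zeta>. (Omega a (fst \<zeta>) - Omega b (snd \<zeta>)) / 2)" for a b
    by (rule bounded_linear_compose[OF bounded_linear_divide bounded_linear_sub[OF
          bounded_linear_compose[OF O.bounded_linear_right bounded_linear_fst] bounded_linear_compose[OF O.bounded_linear_right bounded_linear_snd]]])
  have bl3: "bounded_linear (\<lambda>z. (Omega (fst z) a - Omega (snd z) b) / 2)" for a b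
    by (rule bounded_linear_compose[OF bounded_linear_divide bounded_linear_sub[OF
          bounded_linear_compose[OF O.bounded_linear_left bounded_linear_fst] bounded_linear_compose[OF O.bounded_linear_left bounded_linear_snd]]])
  have lin: "linear (\<beta> z)" if "z \<in> near \<delta>" for z
    using bounded_linear.linear[OF bounded_linear_add[OF bl1[OF that] bl2]] by (simp add: \<beta>_def[abs_def])
  have CD: "Ck_on k (near \<delta>) (\<lambda>z. DG z \<zeta>)" for k \<zeta>
    unfolding DG_def by (rule Ck_on_SucD(2)[OF G_Ck])
  have C1: "Ck_on (Suc 0) (near \<delta>) (\<lambda>z. \<beta> z \<zeta>)" for \<zeta>
  proof -
    have a: "Ck_on (Suc 0) (near \<delta>) (\<lambda>z. snd (G z) \<bullet> fst (DG z \<zeta>))"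
      by (rule Ck_on_bilinear[OF open_near bounded_bilinear_inner
          Ck_on_bounded_linear_compose[OF open_near bounded_linear_snd G_Ck] Ck_on_bounded_linear_compose[OF open_near bounded_linear_fst CD]])
    have b: "Ck_on (Suc 0) (near \<delta>) (\<lambda>z. (Omega (fst z) (fst \<zeta>) - Omega (snd z) (snd \<zeta>)) / 2)"
      by (rule Ck_on_bounded_linear[OF bl3])
    show ?thesis unfolding \<beta>_def by (rule Ck_on_add[OF open_near a b])
  qed
  have closed: "frechet_derivative (\<lambda>z. \<beta> z \<zeta>) (at z) \<zeta>' = frechet_derivative (\<lambda>z. \<beta> z \<zeta>') (at z) \<zeta>"
    if z: "z \<in> near \<delta>" for z \<zeta> \<zeta>'
  proof -
    have d: "frechet_derivative (\<lambda>z. \<beta> z \<zeta>) (at z) \<zeta>' = snd (G z) \<bullet> fst (frechet_derivative (\<lambda>z. DG z \<zeta>) (at z) \<zeta>')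
       + snd (DG z \<zeta>') \<bullet> fst (DG z \<zeta>) + (Omega (fst \<zeta>') (fst \<zeta>) - Omega (snd \<zeta>') (snd \<zeta>)) / 2" for \<zeta> \<zeta>'
    proof -
      have 1: "((\<lambda>z. snd (G z) \<bullet> fst (DG z \<zeta>)) has_derivative (\<lambda>\<zeta>'. snd (G z) \<bullet> fst (frechet_derivative (\<lambda>z. DG z \<zeta>) (at z) \<zeta>')
          + snd (DG z \<zeta>') \<bullet> fst (DG z \<zeta>))) (at z)"
        by (rule has_derivative_inner[OF has_derivative_snd[OF G_deriv[OF z]] has_derivative_fst[OF Ck_on_SucD(1)[OF CD z]]])
      have 2: "((\<lambda>z. (Omega (fst z) (fst \<zeta>) - Omega (snd z) (snd \<zeta>)) / 2) has_derivative
          (\<lambda>\<zeta>'. (Omega (fst \<zeta>') (fst \<zeta>) - Omega (snd \<zeta>') (snd \<zeta>)) / 2)) (at z)"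
        by (rule bounded_linear_imp_has_derivative[OF bl3])
      note eq = fun_cong[OF frechet_derivative_at[OF has_derivative_add[OF 1 2]], of \<zeta>']
      show ?thesis unfolding \<beta>_def by (simp only: eq)
    qed
    have sym: "frechet_derivative (\<lambda>z. DG z \<zeta>) (at z) \<zeta>' = frechet_derivative (\<lambda>z. DG z \<zeta>') (at z) \<zeta>"
      unfolding DG_def by (rule symmetric_second_derivative[OF open_near z G_Ck])
    \<comment> \<open>The terms with second derivatives of \<open>G\<close> cancel by
      \<open>sym\<close>. The others amount to the canonical form pulled back by \<open>G\<close>,
      which balances the exterior derivative of
      \<open>\<lambda> \<oplus> -\<lambda>\<close>.\<close>
    have "snd (DG z \<zeta>') \<bullet> fst (DG z \<zeta>) - snd (DG z \<zeta>) \<bullet> fst (DG z \<zeta>') = Omega (fst \<zeta>) (fst \<zeta>') - Omega (snd \<zeta>) (snd \<zeta>')"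
      using omega_can_DG[OF z, of \<zeta> \<zeta>'] by (simp add: omega_can_def inner_commute)
    moreover have "Omega (fst \<zeta>') (fst \<zeta>) = - Omega (fst \<zeta>) (fst \<zeta>')" "Omega (snd \<zeta>') (snd \<zeta>) = - Omega (snd \<zeta>) (snd \<zeta>')"
      by (simp_all add: Omega_def)
    ultimately show ?thesis unfolding d sym by (simp add: field_simps)
  qed
  have 0: "0 \<in> near \<delta>" using \<delta> by (simp add: near_def)
  obtain R0 where R0: "\<And>z. z \<in> near \<delta> \<Longrightarrow> (R0 has_derivative \<beta> z) (at z)"
  proof (rule Poincare_one_forms[OF open_near convex_near 0 lin C1 closed])
    fix R0 assume "\<And>z. z \<in> near \<delta> \<Longrightarrow> (R0 has_derivative \<beta> z) (at z)"
    then show thesis by (rule that)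
  qed
  define R where "R z = R0 z - R0 0" for z
  have R: "(R has_derivative \<beta> z) (at z)" if "z \<in> near \<delta>" for z
    unfolding R_def[abs_def] using has_derivative_diff[OF R0[OF that] has_derivative_const[of "R0 0"]] by simp
  obtain L where L: "L-lipschitz_on (cnear \<delta>) G" using G_lipschitz by blast
  note L0 = lipschitz_on_nonneg[OF L]
  have DG_le: "norm (DG z \<zeta>) \<le> L * norm \<zeta>" if z: "z \<in> near \<delta>" for z \<zeta>
  proof -
    show ?thesis
      by (rule has_derivative_lipschitz_le[OF open_near z lipschitz_on_subset[OF L near_subset] G_deriv[OF z]])
  qed
  have p_le: "norm (snd (G z)) \<le> L * (2 * 1)" if z: "z \<in> near \<delta>" for z
  proof -
    have zD: "fst z \<in> D2" "snd z \<in> D2" using z by (auto simp: near_def D2_def)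
    have "dist (G z) (G (snd z, snd z)) \<le> L * dist z (snd z, snd z)"
      by (rule lipschitz_onD[OF L]) (use z near_subset zD \<delta> in \<open>auto simp: cnear_def\<close>)
    moreover have "norm (snd (G z)) \<le> dist (G z) (G (snd z, snd z))"
      using dist_snd_le[of "G z" "G (snd z, snd z)"] by (simp add: G_diag zD)
    moreover have "dist z (snd z, snd z) \<le> 2 * 1"
    proof -
      have "dist z (snd z, snd z) = norm (fst z - snd z)" by (cases z) (simp add: dist_Pair_Pair dist_norm)
      also have "\<dots> \<le> 2 * 1" using norm_triangle_ineq4[of "fst z" "snd z"] zD by (simp add: D2_def)
      finally show ?thesis .
    qed
    ultimately show ?thesis using L0 by (meson mult_left_mono order_trans)
  qed
  \<comment> \<open>The first summand bounds the tautological part: \<open>p\<close> vanishes on the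
    diagonal, which is at distance at most 2, and \<open>L\<close> bounds both this growth and
    \<open>DG\<close>. The summand 1 bounds the two halved \<open>Omega\<close> terms on unit
    discs.\<close>
  define C where "C = L * (2 * 1) * L + 1"
  have C: "0 \<le> C" using L0 by (simp add: C_def)
  have \<beta>_le: "\<bar>\<beta> z \<zeta>\<bar> \<le> C * norm \<zeta>" if z: "z \<in> near \<delta>" for z \<zeta>
  proof -
    have "\<bar>snd (G z) \<bullet> fst (DG z \<zeta>)\<bar> \<le> norm (snd (G z)) * norm (fst (DG z \<zeta>))" by (rule Cauchy_Schwarz_ineq2)
    also have "\<dots> \<le> L * (2 * 1) * (L * norm \<zeta>)"
      using p_le[OF z] norm_fst_le[of "fst (DG z \<zeta>)" "snd (DG z \<zeta>)"] DG_le[OF z, of \<zeta>] L0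
      by (intro mult_mono) auto
    finally have 1: "\<bar>snd (G z) \<bullet> fst (DG z \<zeta>)\<bar> \<le> L * (2 * 1) * (L * norm \<zeta>)" .
    have o: "\<bar>Omega u v\<bar> \<le> norm \<zeta>" if "norm u \<le> 1" "norm v \<le> norm \<zeta>" for u v
      using Omega_le[of u v] mult_mono[OF that] by simp
    have 2: "\<bar>Omega (fst z) (fst \<zeta>)\<bar> \<le> norm \<zeta>" "\<bar>- Omega (snd z) (snd \<zeta>)\<bar> \<le> norm \<zeta>"
      using z norm_fst_le[of "fst \<zeta>" "snd \<zeta>"] norm_snd_le[of "snd \<zeta>" "fst \<zeta>"] by (auto simp: near_def intro!: o)
    show ?thesis
      using abs_half_add_le[OF 2 1] by (simp add: \<beta>_def C_def algebra_simps)
  qed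
  have RL: "C-lipschitz_on (near \<delta>) R"
  proof (rule lipschitz_onI[OF _ C])
    fix z w assume "z \<in> near \<delta>" "w \<in> near \<delta>"
    then show "dist (R z) (R w) \<le> C * dist z w"
      unfolding dist_norm using \<beta>_le
      by (intro differentiable_bound[OF convex_near has_derivative_at_withinI[OF R]] onorm_le) auto
  qed
  have Rd: "R (y, y) = 0" if y: "y \<in> ball 0 1" for y
  proof -
    \<comment> \<open>On the diagonal \<open>p\<close> is 0 and the two copies of
      \<open>\<lambda>\<close> cancel, so \<open>R\<close> is constant there; the subtraction of
      \<open>R0 0\<close> makes the constant 0.\<close>
    have d0: "((\<lambda>y. R (y, y)) has_derivative (\<lambda>h. 0)) (at x within ball 0 1)" if x: "x \<in> ball 0 1" for x
    proof -
      have xx: "(x, x) \<in> near \<delta>" using x \<delta> by (simp add: near_def)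
      have "((\<lambda>y. R (y, y)) has_derivative (\<lambda>h. \<beta> (x, x) (h, h))) (at x within ball 0 1)"
        by (rule has_derivative_compose[OF has_derivative_Pair[OF has_derivative_ident has_derivative_ident] R[OF xx]])
      moreover have "\<beta> (x, x) (h, h) = 0" for h
        using x by (simp add: \<beta>_def G_diag D2_def)
      ultimately show ?thesis by simp
    qed
    obtain c where c: "\<And>x. x \<in> ball 0 1 \<Longrightarrow> R (x, x) = c"
      using has_derivative_zero_constant[OF convex_ball d0] by auto
    show ?thesis using c[OF y] c[of 0] by (simp add: R_def zero_prod_def)
  qed
  show ?thesis by (rule that[OF C R[unfolded \<beta>_def] RL Rd])
qed

end

end

section \<open>Graphical maps\<close>

context disc_chart
begin

text \<open>The extended map is the identity on the lower hemisphere, so each point \<open>Y\<close>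
  there is already the base point of \<open>(Y, Y)\<close>. Injectivity forbids a graph point over
  the closed upper hemisphere to share it.\<close>

lemma graphical_base_map:
  assumes gr: "graphical e U \<Psi> \<phi>" and \<phi>: "\<phi> ` D2 \<subseteq> D2"
  shows "y \<in> D2 \<Longrightarrow> fst (G (\<phi> y, y)) \<in> {u \<in> S2. 0 \<le> u $ 3}"
    and "inj_on (\<lambda>y. fst (G (\<phi> y, y))) D2"
proof -
  let ?\<Gamma> = "sphere_graph (sphere_extension e \<phi>)"
  have sub: "?\<Gamma> \<subseteq> U" and inj: "inj_on (\<lambda>z. fst (\<Psi> z)) ?\<Gamma>"
    using gr by (auto simp: graphical_def)
  have up: "ee (\<phi> y, y) \<in> ?\<Gamma>" if y: "y \<in> D2" for y
  proof -
    have "sphere_extension e \<phi> (e y) = e (\<phi> y)"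
      using y by (simp add: sphere_extension_def inv_into_f_f[OF e_inj])
    then show ?thesis
      unfolding sphere_graph_def ee_def using e_in(1)[OF y] by (intro image_eqI[of _ _ "e y"]) auto
  qed
  have low: "(Y, Y) \<in> ?\<Gamma>" if Y: "Y \<in> S2" "Y $ 3 < 0" for Y
  proof -
    have "Y \<notin> e ` D2" using Y(2) by (auto simp: e_image)
    then have "sphere_extension e \<phi> Y = Y" by (simp add: sphere_extension_def)
    then show ?thesis unfolding sphere_graph_def using Y(1) by (intro image_eqI[of _ _ Y]) auto
  qed
  show "fst (G (\<phi> y, y)) \<in> {u \<in> S2. 0 \<le> u $ 3}" if y: "y \<in> D2"
  proof -
    let ?Y = "fst (G (\<phi> y, y))"
    have S: "?Y \<in> S2" unfolding G_def using \<Psi>_into up[OF y] sub by blast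
    moreover have "0 \<le> ?Y $ 3"
    proof (rule ccontr)
      assume "\<not> 0 \<le> ?Y $ 3"
      then have neg: "?Y $ 3 < 0" by simp
      have "(?Y, ?Y) = ee (\<phi> y, y)"
        by (rule inj_onD[OF inj _ low[OF S neg] up[OF y]]) (unfold \<Psi>_diag[OF S], simp add: G_def)
      then have "?Y = e y" unfolding ee_def prod.inject snd_conv by (rule conjunct2)
      then show False using e_in(2)[OF y] neg by simp
    qed
    ultimately show ?thesis by simp
  qed
  show "inj_on (\<lambda>y. fst (G (\<phi> y, y))) D2"
  proof (rule inj_onI)
    fix x y assume xy: "x \<in> D2" "y \<in> D2" "fst (G (\<phi> x, x)) = fst (G (\<phi> y, y))"
    then have "ee (\<phi> x, x) = ee (\<phi> y, y)"
      using inj_onD[OF inj _ up[OF xy(1)] up[OF xy(2)]] by (simp add: G_def)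
    then have "e x = e y" by (simp add: ee_def)
    then show "x = y" using e_inj xy by (auto dest: inj_onD)
  qed
qed

lemma stereo_e_image: "(\<lambda>y. stereo (e y)) ` D2 = cball 0 1"
proof
  show "(\<lambda>y. stereo (e y)) ` D2 \<subseteq> cball 0 1"
    using stereo_in_disc e_in by auto
  show "cball 0 1 \<subseteq> (\<lambda>y. stereo (e y)) ` D2"
  proof
    fix z :: "real^2" assume "z \<in> cball 0 1"
    then have z: "norm z \<le> 1" by simp
    have "unstereo z \<in> e ` D2" using unstereo_hemisphere[OF z] by (simp add: e_image)
    then obtain y where "y \<in> D2" "e y = unstereo z" by auto
    then show "z \<in> (\<lambda>y. stereo (e y)) ` D2"
      using unstereo_hemisphere(3)[OF z] by (intro image_eqI[of _ _ y]) auto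
  qed
qed

text \<open>\<open>b\<close> coincides with \<open>unstereo \<circ> B\<close> on the disc, so the
  chain rule expresses \<open>b'\<close> through the derivative of the planar map
  \<open>B\<close>.\<close>

lemma hemisphere_map_derivative:
  assumes b: "(b has_derivative b') (at y)" and y: "y \<in> ball 0 1"
    and h: "\<And>x. x \<in> D2 \<Longrightarrow> b x \<in> {u \<in> S2. 0 \<le> u $ 3}"
  defines "B \<equiv> \<lambda>x. stereo (b x)"
  shows "(B has_derivative frechet_derivative B (at y)) (at y)"
    and "b' v = dunstereo (B y) (frechet_derivative B (at y) v)"
proof -
  have yD: "y \<in> D2" using y by (simp add: D2_def)
  have "stereo differentiable (at (b y))" using h[OF yD] by (intro stereo_differentiable) auto
  then obtain s where "(stereo has_derivative s) (at (b y))" by (auto simp: differentiable_def)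
  from has_derivative_compose[OF b this] have "B differentiable (at y)"
    unfolding B_def by (rule differentiableI)
  then show B: "(B has_derivative frechet_derivative B (at y)) (at y)"
    by (simp add: frechet_derivative_works)
  have "((\<lambda>x. unstereo (B x)) has_derivative (\<lambda>v. dunstereo (B y) (frechet_derivative B (at y) v))) (at y)"
    by (rule has_derivative_compose[OF B has_derivative_unstereo])
  then have "(b has_derivative (\<lambda>v. dunstereo (B y) (frechet_derivative B (at y) v))) (at y)"
    by (rule has_derivative_transform_within_open[OF _ open_ball y])
      (use h in \<open>auto simp: B_def D2_def unstereo_stereo\<close>)
  then show "b' v = dunstereo (B y) (frechet_derivative B (at y) v)"
    using has_derivative_unique[OF b] by metis
qed

text \<open>The embedding and inverse stereographic projection both respect the orientation given by
  \<open>omega\<close>, hence so does the transition between them.\<close>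

lemma stereo_e_orientation:
  assumes y: "y \<in> ball 0 1"
  defines "E' \<equiv> frechet_derivative (\<lambda>x. stereo (e x)) (at y)"
  shows "0 \<le> Omega (E' (axis 1 1)) (E' (axis 2 1))"
proof -
  have yD: "y \<in> D2" using y by (simp add: D2_def)
  let ?z = "stereo (e y)"
  have De: "De y v = dunstereo ?z (E' v)" for v
    unfolding E'_def by (rule hemisphere_map_derivative(2)[OF e_deriv[OF y] y]) (use e_in in auto)
  have "omega (e y) (De y (axis 1 1)) (De y (axis 2 1)) = 1"
    by (simp only: omega_De[OF y] Omega_axis)
  moreover have "e y = unstereo ?z" using unstereo_stereo e_in[OF yD] by simp
  ultimately have "(2 / (1 + (?z $ 1)\<^sup>2 + (?z $ 2)\<^sup>2))\<^sup>2 / 2 * Omega (E' (axis 1 1)) (E' (axis 2 1)) = 1"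
    using omega_dunstereo[of ?z "E' (axis 1 1)" "E' (axis 2 1)"] by (simp add: De)
  moreover have "0 \<le> (2 / (1 + (?z $ 1)\<^sup>2 + (?z $ 2)\<^sup>2))\<^sup>2 / 2" by simp
  ultimately show ?thesis by (smt (verit) mult_nonneg_nonpos)
qed

text \<open>Over the base, the graph of \<open>\<phi>\<close> is a Lagrangian section with potential
  \<open>f = R(\<phi>(y), y) - A(y)\<close> and slope \<open>p\<close>, and \<open>p\<close> is small when \<open>\<phi>\<close> is \<open>C\<^sup>0\<close>-small.\<close>

lemma action_le:
  "\<exists>\<delta>>0. \<exists>C\<ge>0. \<forall>\<phi> A L r \<eta>. 0 \<le> r \<longrightarrow> r < 1 \<longrightarrow> is_action \<phi> A \<longrightarrow>
    L-lipschitz_on D2 A \<longrightarrow> L-lipschitz_on D2 \<phi> \<longrightarrow> inj_on \<phi> D2 \<longrightarrow> \<phi> ` D2 \<subseteq> D2 \<longrightarrow>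
    (\<forall>x\<in>D2. r < norm x \<longrightarrow> \<phi> x = x \<and> A x = 0) \<longrightarrow> graphical e U \<Psi> \<phi> \<longrightarrow>
    (\<forall>x\<in>D2. norm (\<phi> x - x) \<le> \<eta>) \<longrightarrow> \<eta> < \<delta> \<longrightarrow> (\<forall>y\<in>D2. \<bar>A y\<bar> \<le> C * \<eta>)"
proof -
  obtain \<delta> where \<delta>: "0 < \<delta>" "ee ` cnear \<delta> \<subseteq> U" using cnear_chart by blast
  obtain M where M: "M-lipschitz_on (cnear \<delta>) G" using G_lipschitz[OF \<delta>] by blast
  note M0 = lipschitz_on_nonneg[OF M]
  obtain R C where C: "0 \<le> C"
    and R: "\<And>z. z \<in> near \<delta> \<Longrightarrow> (R has_derivative
       (\<lambda>\<zeta>. snd (G z) \<bullet> fst (DG z \<zeta>) + (Omega (fst z) (fst \<zeta>) - Omega (snd z) (snd \<zeta>)) / 2)) (at z)"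
    and RL: "C-lipschitz_on (near \<delta>) R" and Rd: "\<And>y. y \<in> ball 0 1 \<Longrightarrow> R (y, y) = 0"
  proof (rule generating_primitive[OF \<delta>])
    fix R C assume "0 \<le> C" "\<And>z. z \<in> near \<delta> \<Longrightarrow> (R has_derivative
       (\<lambda>\<zeta>. snd (G z) \<bullet> fst (DG z \<zeta>) + (Omega (fst z) (fst \<zeta>) - Omega (snd z) (snd \<zeta>)) / 2)) (at z)"
      "C-lipschitz_on (near \<delta>) R" "\<And>y. y \<in> ball 0 1 \<Longrightarrow> R (y, y) = 0"
    then show thesis by (rule that)
  qed
  \<comment> \<open>256 is 32 from the gradient estimate times 8 from the bound on
    \<open>dunstereo\<close>. Neither \<open>L\<close> nor \<open>r\<close> occurs, so the bound is
    uniform over all maps considered.\<close>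
  have "\<bar>A y\<bar> \<le> (C + 256 * M) * \<eta>"
    if r: "0 \<le> r" "r < 1" and A: "is_action \<phi> A" and AL: "L-lipschitz_on D2 A" and \<phi>L: "L-lipschitz_on D2 \<phi>"
      and \<phi>inj: "inj_on \<phi> D2" and \<phi>D: "\<phi> ` D2 \<subseteq> D2"
      and out: "\<forall>x\<in>D2. r < norm x \<longrightarrow> \<phi> x = x \<and> A x = 0" and gr: "graphical e U \<Psi> \<phi>"
      and \<eta>: "\<forall>x\<in>D2. norm (\<phi> x - x) \<le> \<eta>" "\<eta> < \<delta>" and y: "y \<in> D2" for \<phi> A L r \<eta> y
  proof -
    have bD: "x \<in> D2" if "x \<in> ball 0 1" for x :: "real^2" using that by (simp add: D2_def)
    have \<eta>0: "0 \<le> \<eta>" using \<eta>(1)[rule_format, OF y] norm_ge_zero order_trans by blast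
    \<comment> \<open>A value on the unit circle would be a fixed point of \<open>\<phi>\<close>, so
      by injectivity \<open>x\<close> would lie on the circle as well.\<close>
    have \<phi>b: "\<phi> x \<in> ball 0 1" if x: "x \<in> ball 0 1" for x
    proof (rule ccontr)
      assume "\<phi> x \<notin> ball 0 1"
      moreover have \<phi>x: "\<phi> x \<in> D2" using \<phi>D bD[OF x] by blast
      ultimately have n: "norm (\<phi> x) = 1" by (simp add: D2_def)
      then have "\<phi> (\<phi> x) = \<phi> x" using out \<phi>x r by simp
      then have "\<phi> x = x" using \<phi>inj \<phi>x bD[OF x] by (auto dest: inj_onD)
      then show False using n x by simp
    qed
    define F where "F x = (\<phi> x, x)" for x
    have Fc: "F x \<in> cnear \<delta>" if "x \<in> D2" for x
      using that \<phi>D \<eta> by (auto simp: F_def cnear_def intro: order_trans less_imp_le)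
    have Fn: "F x \<in> near \<delta>" if "x \<in> ball 0 1" for x
      using that \<phi>b[OF that] \<eta> bD[OF that] by (auto simp: F_def near_def)
    have FL: "(sqrt (L\<^sup>2 + 1\<^sup>2))-lipschitz_on D2 F"
      unfolding F_def[abs_def] by (rule lipschitz_on_Pair[OF \<phi>L lipschitz_on_id])
    have dF: "dist (F x) (x, x) \<le> \<eta>" if "x \<in> D2" for x
      using \<eta>(1) that by (simp add: F_def dist_Pair_Pair dist_norm)
    define b where "b x = fst (G (F x))" for x
    define p where "p x = snd (G (F x))" for x
    have b_hemi: "b x \<in> {u \<in> S2. 0 \<le> u $ 3}" if "x \<in> D2" for x
      unfolding b_def F_def by (rule graphical_base_map(1)[OF gr \<phi>D that])
    have b_inj: "inj_on b D2"
      using graphical_base_map(2)[OF gr \<phi>D] by (simp add: b_def[abs_def] F_def)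
    have p_le: "norm (p x) \<le> M * \<eta>" if x: "x \<in> D2" for x
    proof -
      have "norm (p x) \<le> dist (G (F x)) (G (x, x))"
        using dist_snd_le[of "G (F x)" "G (x, x)"] by (simp add: p_def G_diag[OF x])
      also have "\<dots> \<le> M * dist (F x) (x, x)"
        by (rule lipschitz_onD[OF M Fc[OF x]]) (use x \<delta> in \<open>simp add: cnear_def\<close>)
      also have "\<dots> \<le> M * \<eta>" using dF[OF x] M0 by (rule mult_left_mono)
      finally show ?thesis .
    qed
    define B where "B x = stereo (b x)" for x
    define E where "E x = stereo (e x)" for x
    \<comment> \<open>\<open>R\<close> is controlled over the open disc only; 0 is the continuous
      value on the unit circle, since \<open>f\<close> vanishes near it.\<close>
    define f where "f x = (if norm x < 1 then R (F x) - A x else 0)" for x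
    have stereo_inj: "inj_on stereo {u \<in> S2. 0 \<le> u $ 3}"
      by (rule inj_on_inverseI[of _ unstereo]) (auto intro: unstereo_stereo)
    have fst_lip: "1-lipschitz_on S fst" for S :: "((real^3) \<times> (real^3)) set"
      by (rule lipschitz_onI) (auto intro: dist_fst_le)
    obtain L1 where L1: "L1-lipschitz_on D2 B"
    proof -
      have "M-lipschitz_on (F ` D2) G" by (rule lipschitz_on_subset[OF M]) (use Fc in auto)
      from lipschitz_on_compose2[OF FL this]
      obtain K where "K-lipschitz_on D2 (\<lambda>x. G (F x))" by blast
      from lipschitz_on_compose2[OF this fst_lip]
      obtain K' where K': "K'-lipschitz_on D2 b" by (auto simp: b_def[abs_def])
      have "6-lipschitz_on (b ` D2) stereo"
        by (rule lipschitz_on_subset[OF stereo_lipschitz]) (use b_hemi in blast)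
      from lipschitz_on_compose2[OF K' this] that show thesis by (auto simp: B_def[abs_def])
    qed
    obtain L2 where L2: "L2-lipschitz_on D2 E"
    proof -
      obtain K where K: "K-lipschitz_on D2 e"
        using smooth_on_lipschitz_on[OF e_smooth, of D2] by (auto simp: D2_def)
      have "6-lipschitz_on (e ` D2) stereo"
        by (rule lipschitz_on_subset[OF stereo_lipschitz]) (simp add: e_image)
      from lipschitz_on_compose2[OF K this] that show thesis by (auto simp: E_def[abs_def])
    qed
    have f0: "f x = 0" if "x \<in> D2" "r < norm x" for x
    proof (cases "norm x < 1")
      case True
      then have "F x = (x, x)" using out that by (simp add: F_def)
      then show ?thesis using out that Rd[of x] True by (simp add: f_def)
    qed (simp add: f_def)
    \<comment> \<open>The Lipschitz bound is obtained on the open ball and passes to the closed one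
      by continuity.\<close>
    obtain L3 where L3: "L3-lipschitz_on D2 f"
    proof -
      have "(sqrt (L\<^sup>2 + 1\<^sup>2))-lipschitz_on (ball 0 1) F"
        by (rule lipschitz_on_subset[OF FL]) (auto simp: D2_def)
      moreover have "C-lipschitz_on (F ` ball 0 1) R" by (rule lipschitz_on_subset[OF RL]) (use Fn in blast)
      ultimately obtain K where K: "K-lipschitz_on (ball 0 1) (\<lambda>x. R (F x))"
        using lipschitz_on_compose2 by blast
      have "L-lipschitz_on (ball 0 1) A" by (rule lipschitz_on_subset[OF AL]) (auto simp: D2_def)
      from lipschitz_on_diff[OF K this] have "(K + L)-lipschitz_on (ball 0 1) f"
        by (rule lipschitz_on_transform) (simp add: f_def)
      moreover have "continuous_on (closure (ball 0 1)) f"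
      proof -
        let ?S = "ball (0::real^2) 1" and ?T = "{x::real^2. r < norm x} \<inter> cball 0 1"
        have ST: "closure ?S = ?S \<union> ?T" using r by auto
        have 1: "openin (top_of_set (?S \<union> ?T)) ?S"
          unfolding openin_open by (intro exI[of _ ?S]) auto
        have "open {x::real^2. r < norm x}" by (intro open_Collect_less continuous_intros)
        then have 2: "openin (top_of_set (?S \<union> ?T)) ?T"
          unfolding openin_open by (intro exI[of _ "{x. r < norm x}"]) auto
        have "continuous_on ?S f" using \<open>(K + L)-lipschitz_on (ball 0 1) f\<close> by (rule lipschitz_on_continuous_on)
        moreover have "continuous_on ?T f"
          by (rule continuous_on_eq[OF continuous_on_const[of _ 0]]) (use f0 in \<open>auto simp: D2_def\<close>)
        ultimately show ?thesis unfolding ST by (rule continuous_on_Un_local_open[OF 1 2])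
      qed
      ultimately have "(K + L)-lipschitz_on (closure (ball 0 1)) f" by (rule lipschitz_on_closure)
      then show thesis using that by (simp add: D2_def)
    qed
    define N where "N = max L1 (max L2 L3)"
    have N: "N-lipschitz_on (cball 0 1) B" "N-lipschitz_on (cball 0 1) E" "N-lipschitz_on (cball 0 1) f"
      using L1 L2 L3 by (auto simp: N_def D2_def intro: lipschitz_on_le)
    have Binj: "inj_on B (cball 0 1)"
    proof -
      have "b ` D2 \<subseteq> {u \<in> S2. 0 \<le> u $ 3}" using b_hemi by blast
      from comp_inj_on[OF b_inj inj_on_subset[OF stereo_inj this]]
      show ?thesis by (simp add: B_def[abs_def] o_def D2_def)
    qed
    have Einj: "inj_on E (cball 0 1)"
    proof -
      have "e ` D2 \<subseteq> {u \<in> S2. 0 \<le> u $ 3}" by (simp add: e_image)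
      from comp_inj_on[OF e_inj inj_on_subset[OF stereo_inj this]]
      show ?thesis by (simp add: E_def[abs_def] o_def D2_def)
    qed
    have E_im: "E ` cball 0 1 = cball 0 1" using stereo_e_image by (simp add: E_def[abs_def] D2_def)
    have B_im: "B ` cball 0 1 \<subseteq> cball 0 1"
      using b_hemi stereo_in_disc by (auto simp: B_def D2_def)
    \<comment> \<open>The components of the covector \<open>p\<close> in stereographic coordinates
      on the base.\<close>
    define P where "P x = (vector [p x \<bullet> dunstereo (B x) (axis 1 1), p x \<bullet> dunstereo (B x) (axis 2 1)] :: real^2)" for x
    have bder: "\<exists>b'. (b has_derivative b') (at x) \<and> (f has_derivative (\<lambda>v. p x \<bullet> b' v)) (at x)" if x: "x \<in> ball 0 1" for x
    proof -
      obtain \<phi>' where \<phi>': "(\<phi> has_derivative \<phi>') (at x)"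
        "(A has_derivative (\<lambda>v. (Omega (\<phi> x) (\<phi>' v) - Omega x v) / 2)) (at x)"
        using A x unfolding is_action_def by blast
      have F': "(F has_derivative (\<lambda>v. (\<phi>' v, v))) (at x)"
        unfolding F_def[abs_def] by (rule has_derivative_Pair[OF \<phi>'(1) has_derivative_ident])
      have b': "(b has_derivative (\<lambda>v. fst (DG (F x) (\<phi>' v, v)))) (at x)"
        unfolding b_def[abs_def]
        by (rule has_derivative_fst[OF has_derivative_compose[OF F' G_deriv[OF \<delta> Fn[OF x]]]])
      \<comment> \<open>Along the graph the \<open>Omega\<close> terms in the derivative of
        \<open>R\<close> are exactly the derivative of \<open>A\<close>, so only the tautological
        term survives.\<close>
      have "((\<lambda>x. R (F x) - A x) has_derivative (\<lambda>v. p x \<bullet> fst (DG (F x) (\<phi>' v, v)))) (at x)"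
        using has_derivative_diff[OF has_derivative_compose[OF F' R[OF Fn[OF x]]] \<phi>'(2)]
        by (simp add: F_def p_def)
      then have "(f has_derivative (\<lambda>v. p x \<bullet> fst (DG (F x) (\<phi>' v, v)))) (at x)"
        by (rule has_derivative_transform_within_open[OF _ open_ball x]) (simp add: f_def)
      then show ?thesis using b' by blast
    qed
    have B': "(B has_derivative frechet_derivative B (at x)) (at x)"
      and f': "(f has_derivative (\<lambda>v. P x $ 1 * frechet_derivative B (at x) v $ 1 + P x $ 2 * frechet_derivative B (at x) v $ 2)) (at x)"
      if x: "x \<in> ball 0 1" for x
    proof -
      obtain b' where b': "(b has_derivative b') (at x)" "(f has_derivative (\<lambda>v. p x \<bullet> b' v)) (at x)"
        using bder[OF x] by blast
      show "(B has_derivative frechet_derivative B (at x)) (at x)"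
        unfolding B_def[abs_def] by (rule hemisphere_map_derivative(1)[OF b'(1) x b_hemi])
      have H: "b' v = dunstereo (B x) (frechet_derivative B (at x) v)" for v
        unfolding B_def[abs_def] by (rule hemisphere_map_derivative(2)[OF b'(1) x b_hemi])
      have "p x \<bullet> b' v = P x $ 1 * frechet_derivative B (at x) v $ 1 + P x $ 2 * frechet_derivative B (at x) v $ 2" for v
      proof -
        let ?w = "frechet_derivative B (at x) v"
        have w: "?w = ?w $ 1 *\<^sub>R axis 1 1 + ?w $ 2 *\<^sub>R axis 2 1" by (simp add: vec_eq_iff forall_2 axis_def)
        have "dunstereo (B x) ?w = ?w $ 1 *\<^sub>R dunstereo (B x) (axis 1 1) + ?w $ 2 *\<^sub>R dunstereo (B x) (axis 2 1)"
          by (subst w) (simp only: linear_add[OF linear_dunstereo] linear_cmul[OF linear_dunstereo])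
        then show ?thesis by (simp add: H P_def inner_add_right mult.commute)
      qed
      then show "(f has_derivative (\<lambda>v. P x $ 1 * frechet_derivative B (at x) v $ 1 + P x $ 2 * frechet_derivative B (at x) v $ 2)) (at x)"
        using b'(2) by simp
    qed
    have E': "(E has_derivative frechet_derivative E (at x)) (at x)" if "x \<in> ball 0 1" for x
      unfolding E_def[abs_def] by (rule hemisphere_map_derivative(1)[OF e_deriv[OF that] that]) (use e_in in auto)
    have P_le: "\<bar>P x $ 1\<bar> \<le> 8 * M * \<eta>" if "x \<in> ball 0 1" for x
    proof -
      have "\<bar>P x $ 1\<bar> \<le> norm (p x) * norm (dunstereo (B x) (axis 1 1))"
        using Cauchy_Schwarz_ineq2 by (simp add: P_def)
      also have "\<dots> \<le> (M * \<eta>) * (8 * norm (axis 1 1 :: real^2))"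
        using p_le[OF bD[OF that]] M0 \<eta>0 by (intro mult_mono norm_dunstereo_le) auto
      finally show ?thesis by simp
    qed
    have fb: "\<bar>f x\<bar> \<le> 32 * (8 * M * \<eta>)" if "x \<in> cball 0 1" for x
    proof (rule abs_le_of_gradient_small[OF r(2) N(1) N(2) N(3) Binj Einj B_im _ _ _ B' E' f' P_le _ that])
      show "B ` cball 0 1 \<subseteq> E ` cball 0 1" using B_im E_im by simp
      show "B x = E x" if "r < norm x" "norm x \<le> 1" for x
      proof -
        have "x \<in> D2" using that by (simp add: D2_def)
        then show ?thesis using out that G_diag by (simp add: B_def E_def b_def F_def)
      qed
      show "f x = 0" if "r < norm x" "norm x \<le> 1" for x using f0 that by (simp add: D2_def)
      show "0 \<le> Omega (frechet_derivative E (at x) (axis 1 1)) (frechet_derivative E (at x) (axis 2 1))" if "x \<in> ball 0 1" for x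
        unfolding E_def[abs_def] by (rule stereo_e_orientation[OF that])
    qed
    show ?thesis
    proof (cases "norm y < 1")
      case True
      then have yb: "y \<in> ball 0 1" by simp
      \<comment> \<open>\<open>A\<close> is the value of \<open>R\<close> on the graph, small
        because \<open>R\<close> vanishes on the diagonal, minus \<open>f\<close>, small by the
        gradient estimate.\<close>
      have "dist (R (F y)) (R (y, y)) \<le> C * dist (F y) (y, y)"
        by (rule lipschitz_onD[OF RL Fn[OF yb]]) (use yb \<delta> in \<open>simp add: near_def\<close>)
      also have "\<dots> \<le> C * \<eta>" using dF[OF y] C by (rule mult_left_mono)
      finally have "\<bar>R (F y)\<bar> \<le> C * \<eta>" using Rd[OF yb] by simp
      moreover have "A y = R (F y) - f y" using True by (simp add: f_def)
      ultimately show ?thesis using fb[of y] True abs_triangle_ineq4[of "R (F y)" "f y"]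
        by (simp add: algebra_simps)
    next
      case False
      then show ?thesis using out y r C M0 \<eta>0 by simp
    qed
  qed
  then show ?thesis
    using \<delta>(1) C M0 by (intro exI[of _ \<delta>] conjI exI[of _ "C + 256 * M"]) auto
qed

end

theorem theorem1p10:
  fixes e :: "real^2 \<Rightarrow> real^3"
    and U V :: "((real^3) \<times> (real^3)) set"
    and \<Psi> :: "(real^3) \<times> (real^3) \<Rightarrow> (real^3) \<times> (real^3)"
    and \<phi> :: "nat \<Rightarrow> real^2 \<Rightarrow> real^2"
    and H :: "nat \<Rightarrow> real \<Rightarrow> real^2 \<Rightarrow> real"
  assumes "hemisphere_embedding e"
    and "darboux_weinstein_chart U V \<Psi>"
    and "\<And>i. \<phi> i \<in> Ham_D2"
    and "\<And>i. graphical e U \<Psi> (\<phi> i)"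
    and "uniform_limit D2 \<phi> (\<lambda>x. x) sequentially"
    and "\<And>i. hamiltonian (H i)"
    and "\<And>i. time_one_map (H i) (\<phi> i)"
    and "L1inf_convergent H"
  shows "(\<lambda>i. Cal (\<phi> i)) \<longlonglongrightarrow> 0"
proof -
  interpret disc_chart e U V \<Psi> by unfold_locales (fact assms)+
  obtain \<delta> C where \<delta>: "0 < \<delta>" and C: "0 \<le> C" and le: "\<forall>\<phi> A L r \<eta>. 0 \<le> r \<longrightarrow> r < 1 \<longrightarrow> is_action \<phi> A \<longrightarrow>
    L-lipschitz_on D2 A \<longrightarrow> L-lipschitz_on D2 \<phi> \<longrightarrow> inj_on \<phi> D2 \<longrightarrow> \<phi> ` D2 \<subseteq> D2 \<longrightarrow>
    (\<forall>x\<in>D2. r < norm x \<longrightarrow> \<phi> x = x \<and> A x = 0) \<longrightarrow> graphical e U \<Psi> \<phi> \<longrightarrow>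
    (\<forall>x\<in>D2. norm (\<phi> x - x) \<le> \<eta>) \<longrightarrow> \<eta> < \<delta> \<longrightarrow> (\<forall>y\<in>D2. \<bar>A y\<bar> \<le> C * \<eta>)"
    using action_le by (elim exE conjE) (rule that)
  define m where "m = measure lebesgue D2"
  have D2m: "D2 \<in> lmeasurable" by (simp add: D2_def)
  have m: "0 \<le> m" by (simp add: m_def)
  have bound: "\<bar>Cal (\<phi> i)\<bar> \<le> C * m * \<eta>"
    if \<eta>: "\<forall>x\<in>D2. norm (\<phi> i x - x) \<le> \<eta>" "\<eta> < \<delta>" "0 < \<eta>" for i \<eta>
  proof -
    obtain A L r where A: "0 \<le> r" "r < 1" "is_action (\<phi> i) A"
      "L-lipschitz_on D2 A" "L-lipschitz_on D2 (\<phi> i)" "inj_on (\<phi> i) D2" "\<phi> i ` D2 \<subseteq> D2"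
      "\<And>x. x \<in> D2 \<Longrightarrow> r < norm x \<Longrightarrow> \<phi> i x = x \<and> A x = 0"
    proof (rule hamiltonian_action[OF assms(6)[of i] assms(7)[of i]])
      fix A L r assume "0 \<le> r" "r < 1" "is_action (\<phi> i) A"
        "L-lipschitz_on D2 A" "L-lipschitz_on D2 (\<phi> i)" "inj_on (\<phi> i) D2" "\<phi> i ` D2 \<subseteq> D2"
        "\<And>x. x \<in> D2 \<Longrightarrow> r < norm x \<Longrightarrow> \<phi> i x = x \<and> A x = 0"
      then show thesis by (rule that)
    qed
    have "\<forall>x\<in>D2. r < norm x \<longrightarrow> \<phi> i x = x \<and> A x = 0" using A(8) by simp
    from le[rule_format, OF A(1-7) this[rule_format] assms(4)[of i] \<eta>(1)[rule_format] \<eta>(2)]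
    have Ay: "\<bar>A y\<bar> \<le> C * \<eta>" if "y \<in> D2" for y using that by blast
    have int: "A integrable_on D2"
      using integrable_on_D2(2)[OF lipschitz_on_continuous_on[OF A(4)]] by (simp add: absolutely_integrable_on_def)
    have "norm (integral D2 A) \<le> integral D2 (\<lambda>x. C * \<eta> * 1)"
      by (rule integral_norm_bound_integral[OF int integrable_on_const[OF D2m]]) (use Ay in simp)
    also have "\<dots> = C * m * \<eta>"
      by (simp only: integral_mult_right lmeasure_integral[OF D2m, symmetric] m_def[symmetric]) (simp add: mult.commute)
    finally have "\<bar>integral D2 A\<bar> \<le> C * m * \<eta>" by simp
    moreover have "0 \<le> C * m * \<eta>" using C m \<eta>(3) by simp
    ultimately show ?thesis using Cal_eq_action[OF assms(3) A(3)] by simp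
  qed
  show ?thesis
  proof (rule LIMSEQ_I)
    fix \<epsilon> :: real assume \<epsilon>: "0 < \<epsilon>"
    \<comment> \<open>The summand 1 covers \<open>C * m = 0\<close>, and the halves make both
      resulting inequalities strict.\<close>
    define \<eta> where "\<eta> = min (\<delta> / 2) (\<epsilon> / (C * m + 1) / 2)"
    have Cm: "0 \<le> C * m" using C m by simp
    have "\<eta> \<le> \<delta> / 2" unfolding \<eta>_def by (rule min.cobounded1)
    then have \<eta>: "0 < \<eta>" "\<eta> < \<delta>" using \<delta> \<epsilon> Cm by (auto simp: \<eta>_def)
    have "(C * m + 1) * \<eta> \<le> (C * m + 1) * (\<epsilon> / (C * m + 1) / 2)"
      using Cm by (intro mult_left_mono) (auto simp: \<eta>_def)
    also have "\<dots> = \<epsilon> / 2" using Cm by (metis add_nonneg_eq_0_iff nonzero_mult_div_cancel_left times_divide_eq_right zero_le_one zero_neq_one)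
    also have "\<dots> < \<epsilon>" using \<epsilon> by simp
    finally have small: "C * m * \<eta> < \<epsilon>" using \<eta> by (simp add: algebra_simps)
    have "\<forall>\<^sub>F i in sequentially. \<forall>x\<in>D2. dist (\<phi> i x) x < \<eta>"
      using uniform_limitD[OF assms(5) \<eta>(1)] .
    then obtain i0 where i0: "\<And>i x. i \<ge> i0 \<Longrightarrow> x \<in> D2 \<Longrightarrow> dist (\<phi> i x) x < \<eta>"
      by (auto simp: eventually_sequentially)
    have "norm (Cal (\<phi> i) - 0) < \<epsilon>" if "i \<ge> i0" for i
      using bound[of i \<eta>] i0[OF that] \<eta> small by (force simp: dist_norm intro: less_imp_le)
    then show "\<exists>no. \<forall>n\<ge>no. norm (Cal (\<phi> n) - 0) < \<epsilon>" by blast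
  qed
qed

end
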